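(* Let $\Gamma\subset\mathbb{R}^2$ be a rational lattice, let $a_\Gamma(n)$ be the number of well-rounded sublattices of $\Gamma$ of index $n$, and $\Phi_{\Gamma,\mathsf{wr}}(s)=\sum_{n\ge1}a_\Gamma(n)n^{-s}$. Then $\Phi_{\Gamma,\mathsf{wr}}$ has an analytic continuation to the half plane $\{\mathrm{Re}(s)>\tfrac12\}$ except for a pole of order $2$ at $s=1$. Hence there is a constant $c>0$ such that $A_\Gamma(x)=\sum_{n\le x}a_\Gamma(n)\sim c\,x\log x$ as $x\to\infty$.
   Context: A lattice in $\mathbb{R}^2$ is well-rounded if its non-zero vectors of minimal length span $\mathbb{R}^2$; a sublattice means a subgroup of finite index. A lattice is rational if its similarity class (lattices obtained from it by rotation and positive scaling) contains a lattice whose Gram matrix has rational entries. *)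

theory Defs
  imports "HOL-Complex_Analysis.Complex_Analysis" "HOL-Algebra.Coset"
begin

definition lattice_basis :: "(2 \<Rightarrow> real^2) \<Rightarrow> (real^2) set \<Rightarrow> bool" where
  "lattice_basis b L \<longleftrightarrow> inj b \<and> independent (range b) \<and>
     L = {(\<Sum>i\<in>UNIV. of_int (z i) *\<^sub>R b i) | z :: 2 \<Rightarrow> int. True}"

definition planar_lattice :: "(real^2) set \<Rightarrow> bool" where
  "planar_lattice L \<longleftrightarrow> (\<exists>b. lattice_basis b L)"

definition gram_matrix :: "(2 \<Rightarrow> real^2) \<Rightarrow> real^2^2" where
  "gram_matrix b = (\<chi> i j. b i \<bullet> b j)"

definition similar_lattice :: "(real^2) set \<Rightarrow> (real^2) set \<Rightarrow> bool" where
  "similar_lattice L L' \<longleftrightarrow>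
     (\<exists>c Q. c > 0 \<and> rotation_matrix Q \<and> L' = (\<lambda>x. c *\<^sub>R (Q *v x)) ` L)"

definition rational_lattice :: "(real^2) set \<Rightarrow> bool" where
  "rational_lattice L \<longleftrightarrow> planar_lattice L \<and>
     (\<exists>L' b. similar_lattice L L' \<and> lattice_basis b L' \<and> (\<forall>i j. gram_matrix b $ i $ j \<in> \<rat>))"

definition minimal_vectors :: "(real^2) set \<Rightarrow> (real^2) set" where
  "minimal_vectors M = {x \<in> M. x \<noteq> 0 \<and> (\<forall>y\<in>M. y \<noteq> 0 \<longrightarrow> norm x \<le> norm y)}"

definition well_rounded :: "(real^2) set \<Rightarrow> bool" where
  "well_rounded M \<longleftrightarrow> span (minimal_vectors M) = UNIV"

definition additive_group :: "(real^2) set \<Rightarrow> (real^2) monoid" where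
  "additive_group L = \<lparr>carrier = L, monoid.mult = (+), one = 0\<rparr>"

definition lattice_index :: "(real^2) set \<Rightarrow> (real^2) set \<Rightarrow> nat" where
  "lattice_index L M = card (rcosets\<^bsub>additive_group L\<^esub> M)"

definition sublattice :: "(real^2) set \<Rightarrow> (real^2) set \<Rightarrow> bool" where
  "sublattice M L \<longleftrightarrow> subgroup M (additive_group L) \<and> finite (rcosets\<^bsub>additive_group L\<^esub> M)"

definition wr_count :: "(real^2) set \<Rightarrow> nat \<Rightarrow> nat" where
  "wr_count L n = card {M. sublattice M L \<and> well_rounded M \<and> lattice_index L M = n}"

definition wr_dirichlet_term :: "(real^2) set \<Rightarrow> complex \<Rightarrow> nat \<Rightarrow> complex" where
  "wr_dirichlet_term L s n = of_nat (wr_count L n) * of_nat n powr (- s)"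

text \<open>The sum over \<open>n \<ge> 1\<close> is shifted to \<open>Suc n\<close>, as \<^const>\<open>suminf\<close> starts at 0.\<close>

definition wr_dirichlet :: "(real^2) set \<Rightarrow> complex \<Rightarrow> complex" where
  "wr_dirichlet L s = (\<Sum>n. wr_dirichlet_term L s (Suc n))"

definition wr_summatory :: "(real^2) set \<Rightarrow> real \<Rightarrow> real" where
  "wr_summatory L x = (\<Sum>n | 1 \<le> n \<and> real n \<le> x. real (wr_count L n))"

end

theory Submission
  imports Defs "HOL-Real_Asymp.Real_Asymp" "HOL-Number_Theory.Cong"
    "HOL-Computational_Algebra.Squarefree"
begin

text \<open>
  A well-rounded lattice is generated by two minimal vectors \<open>v\<close>, \<open>w\<close> of equal length, and then
  \<open>a = v + w\<close> and \<open>b = w - v\<close> are orthogonal with \<open>|a|\<^sup>2 \<le> 3 |b|\<^sup>2\<close> and \<open>|b|\<^sup>2 \<le> 3 |a|\<^sup>2\<close>. If the Gram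
  matrix of the ambient lattice is integral up to scaling, write \<open>a = k u\<close> with \<open>u\<close> primitive and
  \<open>b = l u'\<close>, where \<open>u'\<close> is the primitive vector orthogonal to \<open>u\<close>. The admissible \<open>(k, l)\<close> are the
  points of a sector satisfying a parity condition, and sector and parity depend only on \<open>u\<close> modulo
  \<open>2 D\<close>, where \<open>D\<close> is the determinant of the form; within such a class the index is proportional to
  \<open>k l |u|\<^sup>2\<close>. Hence the number of well-rounded sublattices is a finite sum of Dirichlet
  convolutions of the number of primitive \<open>u\<close> with \<open>|u|\<^sup>2 = m\<close> and the weighted number of \<open>(k, l)\<close>
  with \<open>k l = m\<close>. Counting lattice points in
  ellipses and in the regions \<open>k l \<le> x\<close> shows that either factor has summatory function
  \<open>C x + O(x\<^bsup>1/2+\<epsilon>\<^esup>)\<close>, so by Abel summation its Dirichlet series continues to \<open>Re s > 1/2\<close> with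
  at most a simple pole at \<open>1\<close>, and the product has a double pole. The asymptotics follow from the
  same estimates by summing over one factor of the convolution.
\<close>

section \<open>Dirichlet series of sequences with linear summatory function\<close>

text \<open>What separates the variables is a cancellation. Let \<open>g\<close> be the gcd of the
  coordinates of the Gram matrix applied to the primitive vector \<open>u\<close>. Then
  \<open>g^2 |u'|^2 = D |u|^2\<close>, so \<open>|u|^2\<close> drops out of the two inequalities
  between \<open>k u\<close> and \<open>l u'\<close>, and only \<open>g\<close> and \<open>D\<close>
  remain. As \<open>g\<close> divides \<open>D\<close>, it is determined by \<open>u\<close> modulo
  \<open>D\<close>; the parity of \<open>u'\<close>, which arises by division by \<open>g\<close>,
  needs \<open>u\<close> modulo \<open>2 D\<close>. The index \<open>n\<close> satisfies
  \<open>2 g n = k l |u|^2\<close>, so the convolutions are evaluated at multiples of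
  \<open>2 g\<close>. Lattices are counted through their reduced bases, with weight 1/3 in the
  hexagonal case. Hexagonal lattices form the boundary rays of the sector, so the weight is a
  mixture of the closed and the open sector. The sector avoids the axes, hence its part below the
  hyperbola has finite area and this factor has no logarithm. For the other factor, Moebius
  inversion leaves an error of \<open>(x / d^2)^\<theta>\<close> summed over \<open>d\<close>, which
  converges for \<open>\<theta> > 1/2\<close>. The double pole cannot cancel: all contributions to
  its coefficient are nonnegative, and the class of \<open>(1, 0)\<close> gives a positive
  one.\<close>

definition summatory :: "(nat \<Rightarrow> real) \<Rightarrow> real \<Rightarrow> real" where
  "summatory a x = (\<Sum>n\<in>{1..nat \<lfloor>x\<rfloor>}. a n)"

definition linear_growth :: "(nat \<Rightarrow> real) \<Rightarrow> real \<Rightarrow> bool" where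
  "linear_growth a C \<longleftrightarrow>
     (\<forall>\<theta>>1/2. \<exists>K. \<forall>x\<ge>1. \<bar>summatory a x - C * x\<bar> \<le> K * x powr \<theta>)"

lemma linear_growthE:
  assumes "linear_growth a C" "\<theta> > 1/2"
  obtains K where "K \<ge> 0" "\<And>x. x \<ge> 1 \<Longrightarrow> \<bar>summatory a x - C * x\<bar> \<le> K * x powr \<theta>"
proof -
  obtain K where K: "\<And>x. x \<ge> 1 \<Longrightarrow> \<bar>summatory a x - C * x\<bar> \<le> K * x powr \<theta>"
    using assms by (auto simp: linear_growth_def)
  have "\<bar>summatory a x - C * x\<bar> \<le> \<bar>K\<bar> * x powr \<theta>" if "x \<ge> 1" for x
    using K[OF that] by (smt (verit) mult_right_mono powr_ge_zero)
  thus ?thesis using that[of "\<bar>K\<bar>"] by auto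
qed

lemma summatory_of_nat: "summatory a (real n) = (\<Sum>m\<in>{1..n}. a m)"
  by (simp add: summatory_def)

text \<open>Mean value inequality on the segment from \<open>m\<close> to \<open>m + 1\<close>,
  where the derivative of \<open>z powr (-s)\<close> is largest in norm at the left end. It controls
  the differences that Abel summation produces.\<close>

lemma powr_neg_diff_bound:
  fixes s :: complex and m :: nat and t :: real
  assumes m: "m \<ge> 1" and t: "real m \<le> t" "t \<le> real m + 1" and s: "Re s > 0"
  shows "norm (of_real t powr (-s) - of_nat m powr (-s)) \<le> norm s * real m powr (-Re s - 1)"
proof -
  let ?S = "closed_segment (complex_of_real (real m)) (complex_of_real (real m + 1))"
  have seg: "\<exists>u. z = of_real u \<and> real m \<le> u \<and> u \<le> real m + 1" if "z \<in> ?S" for z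
    using that unfolding closed_segment_of_real by (auto simp: closed_segment_eq_real_ivl)
  have inS: "complex_of_real u \<in> ?S" if "real m \<le> u" "u \<le> real m + 1" for u
    using that unfolding closed_segment_of_real by (auto simp: closed_segment_eq_real_ivl)
  have "norm (of_real t powr (-s) - complex_of_real (real m) powr (-s))
     \<le> (norm s * real m powr (-Re s - 1)) * norm (complex_of_real t - complex_of_real (real m))"
  proof (rule field_differentiable_bound[of ?S "\<lambda>z. z powr (-s)" "\<lambda>z. -s * z powr (-s - 1)"])
    fix z assume z: "z \<in> ?S"
    obtain u where u: "z = of_real u" "real m \<le> u" "u \<le> real m + 1" using seg[OF z] by auto
    have u0: "u > 0" using u m by auto
    show "((\<lambda>z. z powr - s) has_field_derivative - s * z powr (- s - 1)) (at z within ?S)"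
      unfolding u(1)
      by (rule has_field_derivative_at_within[OF has_field_derivative_powr]) (use u0 in auto)
    have "norm (-s * z powr (-s-1)) = norm s * u powr (-Re s - 1)"
      using u0 by (simp add: u(1) norm_mult norm_powr_real_powr)
    also have "\<dots> \<le> norm s * real m powr (-Re s - 1)"
      using u m s by (intro mult_left_mono powr_mono2') auto
    finally show "norm (-s * z powr (-s-1)) \<le> norm s * real m powr (-Re s - 1)" .
  qed (use t inS in auto)
  also have "\<dots> \<le> (norm s * real m powr (-Re s - 1)) * 1"
  proof (intro mult_left_mono)
    have "norm (complex_of_real t - complex_of_real (real m)) = \<bar>t - real m\<bar>"
      by (metis norm_of_real of_real_diff)
    thus "norm (complex_of_real t - complex_of_real (real m)) \<le> 1" using t by auto
  qed auto
  finally show ?thesis by simp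
qed

text \<open>The expression is \<open>s - 1\<close> times the integral of
  \<open>m powr (-s) - t powr (-s)\<close> over \<open>t\<close> from \<open>m\<close> to
  \<open>m + 1\<close>. Keeping the factor \<open>s - 1\<close> avoids a division at
  \<open>s = 1\<close>.\<close>

lemma zeta_term_bound:
  fixes s :: complex and m :: nat
  assumes m: "m \<ge> 1" and s: "Re s > 0"
  shows "norm ((s - 1) * of_nat m powr (-s) + of_nat (Suc m) powr (1 - s) - of_nat m powr (1 - s))
     \<le> norm (s - 1) * norm s * real m powr (-Re s - 1)"
proof -
  let ?S = "closed_segment (complex_of_real (real m)) (complex_of_real (real m + 1))"
  \<comment> \<open>The increment of \<open>?f\<close> over the segment is the expression to be
    bounded; its derivative is \<open>(1 - s) * (z powr (-s) - m powr (-s))\<close>, to which the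
    preceding bound applies.\<close>
  let ?f = "\<lambda>z. z powr (1 - s) + (s - 1) * of_nat m powr (-s) * z"
  have seg: "\<exists>u. z = of_real u \<and> real m \<le> u \<and> u \<le> real m + 1" if "z \<in> ?S" for z
    using that unfolding closed_segment_of_real by (auto simp: closed_segment_eq_real_ivl)
  have "norm (?f (complex_of_real (real m + 1)) - ?f (complex_of_real (real m)))
     \<le> (norm (s-1) * norm s * real m powr (-Re s - 1)) *
         norm (complex_of_real (real m + 1) - complex_of_real (real m))"
  proof (rule field_differentiable_bound[of ?S ?f
         "\<lambda>z. (1 - s) * z powr (1 - s - 1) + (s - 1) * of_nat m powr (-s)"])
    fix z assume z: "z \<in> ?S"
    obtain u where u: "z = of_real u" "real m \<le> u" "u \<le> real m + 1" using seg[OF z] by auto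
    have u0: "u > 0" using u m by auto
    have d: "((\<lambda>z. z powr (1-s)) has_field_derivative (1-s) * z powr (1 - s - 1)) (at z within ?S)"
      unfolding u(1)
      by (rule has_field_derivative_at_within[OF has_field_derivative_powr]) (use u0 in auto)
    show "(?f has_field_derivative (1 - s) * z powr (1 - s - 1) + (s - 1) * of_nat m powr (-s)) (at z within ?S)"
      by (intro DERIV_add d DERIV_cmult_Id)
    have "(1 - s) * z powr (1 - s - 1) + (s - 1) * of_nat m powr (-s)
        = (1 - s) * (of_real u powr (-s) - of_nat m powr (-s))"
      unfolding u(1) by (simp add: algebra_simps)
    also have "norm \<dots> \<le> norm (1 - s) * (norm s * real m powr (-Re s - 1))"
      unfolding norm_mult by (intro mult_left_mono powr_neg_diff_bound m s u) auto
    finally show "norm ((1 - s) * z powr (1 - s - 1) + (s - 1) * of_nat m powr (-s))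
       \<le> norm (s-1) * norm s * real m powr (-Re s - 1)" by (simp add: norm_minus_commute mult.assoc)
  qed auto
  also have "?f (complex_of_real (real m + 1)) - ?f (complex_of_real (real m)) =
     (s - 1) * of_nat m powr (-s) + of_nat (Suc m) powr (1 - s) - of_nat m powr (1 - s)"
    by (simp add: algebra_simps)
  finally show ?thesis by simp
qed

lemma summable_Suc_powr: "p < -1 \<Longrightarrow> summable (\<lambda>n. real (Suc n) powr p)"
  using summable_real_powr_iff[of p] summable_Suc_iff[of "\<lambda>n. real n powr p"] by simp

lemma tendsto_Suc_powr_neg: "p < 0 \<Longrightarrow> (\<lambda>n. real (Suc n) powr p) \<longlonglongrightarrow> 0"
  by (intro tendsto_neg_powr filterlim_compose[OF filterlim_real_sequentially filterlim_Suc])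

lemma open_Re_gt: "open {s. Re s > c}"
  by (intro open_Collect_less continuous_intros)

text \<open>Weierstrass test on closed discs: the polynomial factor in \<open>norm s\<close> is
  bounded on each disc, and the exponent below -1 gives a summable majorant.\<close>

lemma holomorphic_suminf_half_plane:
  fixes f :: "nat \<Rightarrow> complex \<Rightarrow> complex"
  assumes hol: "\<And>n. f n holomorphic_on {s. Re s > c}"
  assumes bound: "\<And>\<delta>. \<delta> > 0 \<Longrightarrow> \<exists>K. \<forall>n s. Re s \<ge> c + \<delta> \<longrightarrow>
      norm (f n s) \<le> K * (1 + norm s)\<^sup>2 * real (Suc n) powr (-1 - \<delta>/2)"
  shows "(\<lambda>s. \<Sum>n. f n s) holomorphic_on {s. Re s > c}"
    and "\<And>s. Re s > c \<Longrightarrow> summable (\<lambda>n. f n s)"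
proof -
  have *: "\<exists>d M. d > 0 \<and> cball x d \<subseteq> {s. Re s > c} \<and> summable M \<and> (\<forall>n. \<forall>s\<in>cball x d. norm (f n s) \<le> M n)"
    if x: "Re x > c" for x
  proof -
    \<comment> \<open>Half the distance to the boundary line, so that the disc of radius
      \<open>d\<close> keeps distance at least \<open>d\<close> from it.\<close>
    define d where "d = (Re x - c) / 2"
    have d: "d > 0" using x by (simp add: d_def)
    obtain K where K: "\<And>n s. Re s \<ge> c + d \<Longrightarrow>
      norm (f n s) \<le> K * (1 + norm s)\<^sup>2 * real (Suc n) powr (-1 - d/2)"
      using bound[OF d] by blast
    have re: "Re s \<ge> c + d" if "s \<in> cball x d" for s
    proof -
      have "Re x - Re s \<le> norm (x - s)" using complex_Re_le_cmod[of "x - s"] by simp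
      also have "\<dots> \<le> d" using that by (simp add: dist_norm)
      finally show ?thesis by (simp add: d_def field_simps)
    qed
    define M where "M n = \<bar>K\<bar> * (1 + norm x + d)\<^sup>2 * real (Suc n) powr (-1 - d/2)" for n
    have "summable M" unfolding M_def using d by (intro summable_mult summable_Suc_powr) auto
    moreover have "norm (f n s) \<le> M n" if "s \<in> cball x d" for n s
    proof -
      have "norm s \<le> norm x + d" using that by (simp add: dist_norm) norm
      hence "K * (1 + norm s)\<^sup>2 * real (Suc n) powr (-1 - d/2) \<le> M n"
        unfolding M_def using d by (intro mult_right_mono mult_mono power_mono) auto
      thus ?thesis using K[OF re[OF that], of n] by linarith
    qed
    ultimately show ?thesis using d re by (intro exI[of _ d] exI[of _ M]) fastforce
  qed
  show "(\<lambda>s. \<Sum>n. f n s) holomorphic_on {s. Re s > c}"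
  proof (rule holomorphic_uniform_sequence[OF open_Re_gt])
    show "(\<lambda>s. \<Sum>i<n. f i s) holomorphic_on {s. Re s > c}" for n
      by (intro holomorphic_on_sum hol)
    fix x assume "x \<in> {s. Re s > c}"
    then obtain d M where dM: "d > 0" "cball x d \<subseteq> {s. Re s > c}" "summable M"
       "\<And>n s. s \<in> cball x d \<Longrightarrow> norm (f n s) \<le> M n" using *[of x] by auto
    show "\<exists>d>0. cball x d \<subseteq> {s. c < Re s} \<and>
             uniform_limit (cball x d) (\<lambda>n s. \<Sum>i<n. f i s) (\<lambda>s. \<Sum>n. f n s) sequentially"
      using dM by (intro exI[of _ d] conjI Weierstrass_m_test[of _ _ M]) auto
  qed
  fix s assume "Re s > c"
  then obtain d M where dM: "d > 0" "summable M"
       "\<And>n t. t \<in> cball s d \<Longrightarrow> norm (f n t) \<le> M n" using *[of s] by auto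
  show "summable (\<lambda>n. f n s)"
    by (rule summable_comparison_test[of _ M]) (use dM in auto)
qed

lemma abel_summation:
  fixes r f :: "nat \<Rightarrow> 'a::comm_ring"
  shows "(\<Sum>m<n. r (Suc m) * f (Suc m)) =
     (\<Sum>m\<in>{1..n}. r m) * f (Suc n) + (\<Sum>m<n. (\<Sum>j\<in>{1..Suc m}. r j) * (f (Suc m) - f (Suc (Suc m))))"
proof (induction n)
  case (Suc n)
  have "(\<Sum>m\<in>{1..Suc n}. r m) = (\<Sum>m\<in>{1..n}. r m) + r (Suc n)" by simp
  note s = this
  show ?case unfolding sum.lessThan_Suc Suc.IH s by (simp only: algebra_simps)
qed auto

text \<open>Split \<open>a n\<close> into \<open>C\<close> and \<open>a n - C\<close>. The second
  part has partial sums of order \<open>n powr \<theta>\<close>, so Abel summation makes its series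
  converge for Re s > 1/2. The first part is \<open>C\<close> times the zeta function, and
  \<open>s - 1\<close> times zeta is \<open>1\<close> plus the sum of the terms \<open>g\<close>.
  Thus \<open>H\<close> is \<open>s - 1\<close> times the series, and \<open>H 1\<close> is the
  residue.\<close>

lemma dirichlet_series_continuation:
  fixes a :: "nat \<Rightarrow> real"
  assumes lg: "linear_growth a C"
  obtains H where "H holomorphic_on {s. Re s > 1/2}" "H 1 = of_real C"
    "\<And>s. Re s > 1 \<Longrightarrow> (\<lambda>n. of_real (a (Suc n)) * of_nat (Suc n) powr (-s)) sums (H s / (s - 1))"
proof -
  define R where "R n = (\<Sum>m\<in>{1..n}. a m - C)" for n
  have R_eq: "R n = summatory a n - C * n" for n
    by (simp add: R_def sum_subtractf summatory_of_nat)
  define f where "f n s = complex_of_real (R (Suc n)) *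
      (of_nat (Suc n) powr (-s) - of_nat (Suc (Suc n)) powr (-s))" for n s
  define g where "g n s = (s - 1) * of_nat (Suc n) powr (-s) + of_nat (Suc (Suc n)) powr (1 - s)
      - of_nat (Suc n) powr (1 - s)" for n and s :: complex
  have f_hol: "f n holomorphic_on {s. Re s > 1/2}" for n
    unfolding f_def by (intro holomorphic_intros)
  have g_hol: "g n holomorphic_on {s. Re s > 1/2}" for n
    unfolding g_def by (intro holomorphic_intros)
  have f_bound: "\<exists>K. \<forall>n s. Re s \<ge> 1/2 + \<delta> \<longrightarrow>
      norm (f n s) \<le> K * (1 + norm s)\<^sup>2 * real (Suc n) powr (-1 - \<delta>/2)" if "\<delta> > 0" for \<delta>
  proof -
    obtain K where K: "K \<ge> 0" "\<And>x. x \<ge> 1 \<Longrightarrow> \<bar>summatory a x - C * x\<bar> \<le> K * x powr (1/2 + \<delta>/2)"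
      using linear_growthE[OF lg, of "1/2+\<delta>/2"] \<open>\<delta> > 0\<close> by auto
    show ?thesis
    proof (intro exI[of _ K] allI impI)
      fix n s assume s: "Re s \<ge> 1/2 + \<delta>"
      have "norm (of_real (real (Suc n) + 1) powr (-s) - of_nat (Suc n) powr (-s)) \<le> norm s * real (Suc n) powr (-Re s - 1)"
        using s \<open>\<delta> > 0\<close> by (intro powr_neg_diff_bound) auto
      hence 1: "norm (of_nat (Suc n) powr (-s) - of_nat (Suc (Suc n)) powr (-s)) \<le> norm s * real (Suc n) powr (-Re s - 1)"
        by (simp add: norm_minus_commute add_ac)
      have "norm (f n s) = \<bar>R (Suc n)\<bar> * norm (of_nat (Suc n) powr (-s) - of_nat (Suc (Suc n)) powr (-s))"
        by (simp add: f_def norm_mult)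
      also have "\<dots> \<le> (K * real (Suc n) powr (1/2 + \<delta>/2)) * (norm s * real (Suc n) powr (-Re s - 1))"
        unfolding R_eq by (intro mult_mono 1 K) (use K in auto)
      also have "\<dots> = K * norm s * real (Suc n) powr (1/2 + \<delta>/2 - Re s - 1)"
        by (simp add: powr_add[symmetric] algebra_simps)
      also have "\<dots> \<le> K * (1 + norm s)\<^sup>2 * real (Suc n) powr (-1 - \<delta>/2)"
      proof (intro mult_mono powr_mono)
        show "norm s \<le> (1 + norm s)\<^sup>2" using norm_ge_zero[of s] by (simp add: power2_eq_square algebra_simps)
      qed (use K s \<open>\<delta> > 0\<close> in \<open>auto simp: field_simps\<close>)
      finally show "norm (f n s) \<le> K * (1 + norm s)\<^sup>2 * real (Suc n) powr (-1 - \<delta>/2)" .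
    qed
  qed
  have g_bound: "\<exists>K. \<forall>n s. Re s \<ge> 1/2 + \<delta> \<longrightarrow>
      norm (g n s) \<le> K * (1 + norm s)\<^sup>2 * real (Suc n) powr (-1 - \<delta>/2)" if "\<delta> > 0" for \<delta>
  proof (intro exI[of _ 1] allI impI)
    fix n s assume s: "Re s \<ge> 1/2 + \<delta>"
    have "norm (g n s) \<le> norm (s - 1) * norm s * real (Suc n) powr (-Re s - 1)"
      unfolding g_def by (intro zeta_term_bound) (use s \<open>\<delta> > 0\<close> in auto)
    also have "\<dots> \<le> 1 * (1 + norm s)\<^sup>2 * real (Suc n) powr (-1 - \<delta>/2)"
    proof -
      have "norm (s - 1) \<le> 1 + norm s" using norm_triangle_ineq4[of s 1] by simp
      hence "norm (s - 1) * norm s \<le> (1 + norm s) * (1 + norm s)"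
        by (rule mult_mono) auto
      hence *: "norm (s - 1) * norm s \<le> 1 * (1 + norm s)\<^sup>2"
        by (simp only: power2_eq_square mult_1)
      show ?thesis
        by (rule mult_mono[OF * powr_mono]) (use s \<open>\<delta> > 0\<close> in auto)
    qed
    finally show "norm (g n s) \<le> 1 * (1 + norm s)\<^sup>2 * real (Suc n) powr (-1 - \<delta>/2)" .
  qed
  note f_sum = holomorphic_suminf_half_plane[OF f_hol f_bound]
  note g_sum = holomorphic_suminf_half_plane[OF g_hol g_bound]
  define H where "H s = (s - 1) * (\<Sum>n. f n s) + of_real C * (1 + (\<Sum>n. g n s))" for s
  show ?thesis
  proof (rule that)
    show "H holomorphic_on {s. Re s > 1/2}"
      unfolding H_def by (intro holomorphic_intros f_sum(1) g_sum(1))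
    \<comment> \<open>Every \<open>g n 1\<close> vanishes, since both powers with exponent
      \<open>1 - s\<close> are then 1.\<close>
    show "H 1 = of_real C" by (simp add: H_def g_def del: of_nat_Suc)
    fix s :: complex assume s: "Re s > 1"
    have s1: "s \<noteq> 1" using s by auto
    have f1: "(\<lambda>n. \<Sum>i<n. f i s) \<longlonglongrightarrow> (\<Sum>n. f n s)"
      using f_sum(2)[of s] s summable_LIMSEQ by auto
    have g1: "(\<lambda>n. \<Sum>i<n. g i s) \<longlonglongrightarrow> (\<Sum>n. g n s)"
      using g_sum(2)[of s] s summable_LIMSEQ by auto
    have lim0: "(\<lambda>n. of_nat (Suc n) powr (1 - s)) \<longlonglongrightarrow> (0 :: complex)"
    proof (rule tendsto_norm_zero_cancel)
      have "(\<lambda>n. real (Suc n) powr (1 - Re s)) \<longlonglongrightarrow> 0" using s by (intro tendsto_Suc_powr_neg) auto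
      thus "(\<lambda>n. norm (of_nat (Suc n) powr (1 - s) :: complex)) \<longlonglongrightarrow> 0"
        by (simp add: norm_powr_real_powr del: of_nat_Suc)
    qed
    \<comment> \<open>In the sum of the \<open>g i s\<close> the powers with exponent
      \<open>1 - s\<close> telescope, which leaves the partial sums of the zeta series.\<close>
    have tel: "(\<Sum>i<n. of_nat (Suc i) powr (-s)) = (1 + (\<Sum>i<n. g i s) - of_nat (Suc n) powr (1 - s)) / (s - 1)" for n
    proof -
      have "(s - 1) * (\<Sum>i<n. of_nat (Suc i) powr (-s)) = 1 + (\<Sum>i<n. g i s) - of_nat (Suc n) powr (1 - s)"
      proof (induction n)
        case (Suc n)
        show ?case unfolding sum.lessThan_Suc distrib_left Suc.IH by (simp add: g_def del: of_nat_Suc)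
      qed simp
      thus ?thesis using s1 by (simp add: field_simps)
    qed
    have "(\<lambda>n. (1 + (\<Sum>i<n. g i s) - of_nat (Suc n) powr (1 - s)) / (s - 1)) \<longlonglongrightarrow> (1 + (\<Sum>n. g n s) - 0) / (s - 1)"
      by (intro tendsto_intros g1 lim0) (use s1 in auto)
    hence z: "(\<lambda>n. \<Sum>i<n. of_nat (Suc i) powr (-s)) \<longlonglongrightarrow> (1 + (\<Sum>n. g n s)) / (s - 1)"
      unfolding tel by simp
    have Rlim: "(\<lambda>n. of_real (R n) * of_nat (Suc n) powr (-s)) \<longlonglongrightarrow> (0 :: complex)"
    proof -
      \<comment> \<open>Here Re s > 1, so the exponent 1 already makes the boundary term of Abel
        summation vanish in the limit.\<close>
      obtain K where K: "K \<ge> 0" "\<And>x. x \<ge> 1 \<Longrightarrow> \<bar>summatory a x - C * x\<bar> \<le> K * x powr 1"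
        using linear_growthE[OF lg, of 1] by auto
      have lim: "(\<lambda>n. K * (real (Suc n) powr (1 - Re s))) \<longlonglongrightarrow> 0"
        using s by (intro tendsto_mult_right_zero tendsto_Suc_powr_neg) auto
      have "norm (of_real (R n) * of_nat (Suc n) powr (-s) :: complex) \<le> K * (real (Suc n) powr (1 - Re s))" for n
      proof -
        have "\<bar>R n\<bar> \<le> K * real (Suc n)"
          using K(2)[of "real n"] K(1) by (cases "n = 0") (auto simp: R_eq summatory_def algebra_simps)
        hence "norm (of_real (R n) * of_nat (Suc n) powr (-s) :: complex) \<le> (K * real (Suc n)) * (real (Suc n) powr (- Re s))"
          unfolding norm_mult using K(1) by (intro mult_mono) (auto simp: norm_powr_real_powr simp del: of_nat_Suc)
        also have "\<dots> = K * (real (Suc n) powr (1 - Re s))"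
          unfolding diff_conv_add_uminus powr_add by (simp del: of_nat_Suc)
        finally show ?thesis .
      qed
      thus ?thesis by (intro Lim_null_comparison[OF _ lim] always_eventually allI)
    qed
    have partial: "(\<Sum>m<n. of_real (a (Suc m)) * of_nat (Suc m) powr (-s)) =
       of_real (R n) * of_nat (Suc n) powr (-s) + (\<Sum>i<n. f i s) + of_real C * (\<Sum>i<n. of_nat (Suc i) powr (-s))" for n
    proof -
      have "(\<Sum>m<n. of_real (a (Suc m) - C) * of_nat (Suc m) powr (-s)) =
         of_real (R n) * of_nat (Suc n) powr (-s) + (\<Sum>i<n. f i s)"
        unfolding f_def R_def of_real_sum
        by (rule abel_summation[of "\<lambda>m. of_real (a m - C)" "\<lambda>m. of_nat m powr (-s)"])
      moreover have "(\<Sum>m<n. of_real (a (Suc m) - C) * of_nat (Suc m) powr (-s)) =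
        (\<Sum>m<n. of_real (a (Suc m)) * of_nat (Suc m) powr (-s)) - of_real C * (\<Sum>i<n. of_nat (Suc i) powr (-s))"
        unfolding sum_distrib_left sum_subtractf[symmetric] of_real_diff left_diff_distrib by (rule refl)
      ultimately show ?thesis by (simp only: diff_eq_eq)
    qed
    have lim: "(\<lambda>n. of_real (R n) * of_nat (Suc n) powr (-s) + (\<Sum>i<n. f i s) + of_real C * (\<Sum>i<n. of_nat (Suc i) powr (-s)))
       \<longlonglongrightarrow> 0 + (\<Sum>n. f n s) + of_real C * ((1 + (\<Sum>n. g n s)) / (s - 1))"
      by (intro tendsto_intros Rlim f1 z)
    have val: "0 + (\<Sum>n. f n s) + of_real C * ((1 + (\<Sum>n. g n s)) / (s - 1)) = H s / (s - 1)"
      using s1 by (simp add: H_def field_simps)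
    show "(\<lambda>n. of_real (a (Suc n)) * of_nat (Suc n) powr (-s)) sums (H s / (s - 1))"
      using lim unfolding sums_def partial val .
  qed
qed

section \<open>Dirichlet convolution\<close>

definition dirichlet_conv :: "(nat \<Rightarrow> real) \<Rightarrow> (nat \<Rightarrow> real) \<Rightarrow> nat \<Rightarrow> real" where
  "dirichlet_conv a b n = (\<Sum>d | d dvd n. a d * b (n div d))"

lemma summatory_conv:
  assumes "x \<ge> 0"
  shows "summatory (dirichlet_conv a b) x = (\<Sum>m\<in>{1..nat \<lfloor>x\<rfloor>}. a m * summatory b (x / real m))"
proof -
  have "summatory (dirichlet_conv a b) x = (\<Sum>n\<in>{1..nat \<lfloor>x\<rfloor>}. \<Sum>d | d dvd n. a d * b (n div d))"
    by (simp add: summatory_def dirichlet_conv_def)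
  also have "\<dots> = (\<Sum>(n,d)\<in>(SIGMA n:{1..nat \<lfloor>x\<rfloor>}. {d. d dvd n}). a d * b (n div d))"
    by (rule sum.Sigma) auto
  also have "\<dots> = (\<Sum>(m,e)\<in>(SIGMA m:{1..nat \<lfloor>x\<rfloor>}. {1..nat \<lfloor>x / real m\<rfloor>}). a m * b e)"
  proof (rule sum.reindex_bij_witness[of _ "\<lambda>(m,e). (m * e, m)" "\<lambda>(n,d). (d, n div d)"])
    fix p assume "p \<in> (SIGMA n:{1..nat \<lfloor>x\<rfloor>}. {d. d dvd n})"
    then obtain n d where p: "p = (n,d)" "n \<ge> 1" "real n \<le> x" "d dvd n"
      using assms by (auto simp: le_nat_iff le_floor_iff)
    then obtain e where e: "n = d * e" by blast
    have de: "d \<ge> 1" "e \<ge> 1" using p e by (auto simp: Suc_le_eq)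
    have "real d * 1 \<le> real d * real e" using de by (intro mult_left_mono) auto
    also have "\<dots> = real n" by (simp add: e)
    finally have "real d \<le> x" using p(3) by simp
    moreover have "real e \<le> x / real d" using p e de by (simp add: field_simps)
    ultimately show "(case case p of (n, d) \<Rightarrow> (d, n div d) of (m, e) \<Rightarrow> (m * e, m)) = p"
     "(case p of (n, d) \<Rightarrow> (d, n div d)) \<in> (SIGMA m:{1..nat \<lfloor>x\<rfloor>}. {1..nat \<lfloor>x / real m\<rfloor>})"
     "(case case p of (n, d) \<Rightarrow> (d, n div d) of (m, e) \<Rightarrow> a m * b e) = (case p of (n, d) \<Rightarrow> a d * b (n div d))"
      using p e de assms by (auto simp: le_nat_iff le_floor_iff)
  next
    fix p assume "p \<in> (SIGMA m:{1..nat \<lfloor>x\<rfloor>}. {1..nat \<lfloor>x / real m\<rfloor>})"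
    then obtain m e where p: "p = (m,e)" "m \<ge> 1" "e \<ge> 1" "real m \<le> x" "real e \<le> x / real m"
      using assms by (auto simp: le_nat_iff le_floor_iff)
    have "real m * real e \<le> x" using p by (simp add: field_simps)
    thus "(case case p of (m, e) \<Rightarrow> (m * e, m) of (n, d) \<Rightarrow> (d, n div d)) = p"
     "(case p of (m, e) \<Rightarrow> (m * e, m)) \<in> (SIGMA n:{1..nat \<lfloor>x\<rfloor>}. {d. d dvd n})"
      using p assms by (auto simp: le_nat_iff le_floor_iff)
  qed
  also have "\<dots> = (\<Sum>m\<in>{1..nat \<lfloor>x\<rfloor>}. \<Sum>e\<in>{1..nat \<lfloor>x / real m\<rfloor>}. a m * b e)"
    by (rule sum.Sigma[symmetric]) auto
  finally show ?thesis by (simp add: summatory_def sum_distrib_left)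
qed

text \<open>A negative slope would eventually outweigh the error and make the partial sums negative.
  This later excludes cancellation in the leading coefficient.\<close>

lemma linear_growth_nonneg:
  assumes "\<And>n. a n \<ge> 0" "linear_growth a C" shows "C \<ge> 0"
proof (rule ccontr)
  assume "\<not> C \<ge> 0"
  hence C: "C < 0" by simp
  obtain K where K: "K \<ge> 0" "\<And>x. x \<ge> 1 \<Longrightarrow> \<bar>summatory a x - C * x\<bar> \<le> K * x powr (3/4)"
    using linear_growthE[OF assms(2), of "3/4"] by auto
  have "eventually (\<lambda>x. K * x powr (3/4) < -C * x) at_top"
    using C by real_asymp
  hence "eventually (\<lambda>x. K * x powr (3/4) < -C * x \<and> x \<ge> 1) at_top"
    using eventually_ge_at_top eventually_conj by blast
  then obtain x where x: "K * x powr (3/4) < -C * x" "x \<ge> 1"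
    by (metis (mono_tags, lifting) eventually_at_top_linorder order_refl)
  have "summatory a x \<ge> 0" unfolding summatory_def by (intro sum_nonneg assms)
  thus False using K(2)[OF x(2)] x(1) by simp
qed

lemma linear_growth_bound_all:
  assumes "linear_growth a C" "1/2 < \<theta>" "\<theta> \<le> 1"
  obtains K where "K \<ge> 0" "\<And>x. x > 0 \<Longrightarrow> \<bar>summatory a x - C * x\<bar> \<le> K * x powr \<theta>"
proof -
  obtain K where K: "K \<ge> 0" "\<And>x. x \<ge> 1 \<Longrightarrow> \<bar>summatory a x - C * x\<bar> \<le> K * x powr \<theta>"
    using linear_growthE[OF assms(1), of \<theta>] assms(2) by auto
  have "\<bar>summatory a x - C * x\<bar> \<le> (K + \<bar>C\<bar>) * x powr \<theta>" if "x > 0" for x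
  proof (cases "x \<ge> 1")
    case True
    have "K * x powr \<theta> \<le> (K + \<bar>C\<bar>) * x powr \<theta>" by (intro mult_right_mono) auto
    thus ?thesis using K(2)[OF True] by linarith
  next
    case False
    hence "summatory a x = 0" using that by (auto simp: summatory_def intro!: sum.neutral)
    moreover have "x powr 1 \<le> x powr \<theta>" using that False assms by (intro powr_mono') auto
    hence "\<bar>C\<bar> * x \<le> (K + \<bar>C\<bar>) * x powr \<theta>" using that K(1) by (intro mult_mono) auto
    ultimately show ?thesis using that by (simp add: abs_mult)
  qed
  thus ?thesis using that[of "K + \<bar>C\<bar>"] K(1) by auto
qed

text \<open>Comparison with an integral: \<open>4 * z powr (1/4)\<close> has derivative
  \<open>z powr (-(3/4))\<close>.\<close>

lemma sum_powr_upper: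
  "(\<Sum>m\<in>{1..n}. real m powr (-(3/4))) \<le> 4 * real n powr (1/4)"
proof (induction n)
  case (Suc n)
  have "(real n + 1) powr (-(3/4)) \<le> 4 * ((real n + 1) powr (1/4) - real n powr (1/4))"
  proof (cases "n = 0")
    case False
    have "\<exists>z::real. real n < z \<and> z < real n + 1 \<and>
        (real n + 1) powr (1/4) - real n powr (1/4) = (real n + 1 - real n) * ((1/4) * z powr (1/4 - 1))"
      by (rule MVT2) (use False in \<open>auto intro!: derivative_eq_intros simp: powr_diff\<close>)
    then obtain z where z: "real n < z" "z < real n + 1"
        "(real n + 1) powr (1/4) - real n powr (1/4) = (1/4) * z powr (-(3/4))" by auto
    have "(real n + 1) powr (-(3/4)) \<le> z powr (-(3/4))" using z by (intro powr_mono2') auto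
    thus ?thesis using z(3) by simp
  qed auto
  thus ?case using Suc by (simp add: add.commute)
qed auto

lemma sum_inverse_bounds:
  assumes "n \<ge> 1"
  shows "\<bar>(\<Sum>m\<in>{1..n}. 1 / real m) - ln (real n)\<bar> \<le> 1"
proof -
  have eq: "(\<Sum>m\<in>{1..n}. 1 / real m) = harm n" by (simp add: harm_def divide_inverse)
  have "ln (real n) \<le> ln (real n + 1)" using assms by auto
  also have "\<dots> \<le> harm n" by (rule ln_le_harm)
  finally have 1: "ln (real n) \<le> harm n" .
  obtain k where k: "n = Suc k" using assms by (cases n) auto
  have "harm (Suc k) - ln (real (Suc k)) \<le> harm (Suc 0) - ln (real (Suc 0))"
    using decseqD[OF decseq_harm_diff_ln, of 0 k] by simp
  hence "harm n - ln (real n) \<le> 1" by (simp add: k harm_Suc harm_expand)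
  with 1 show ?thesis unfolding eq by linarith
qed

text \<open>Abel summation is used in both directions. Since the weights decrease, the partial sums
  of \<open>a\<close> may be replaced by those of a constant sequence; the result is then turned
  back into a plain sum of powers.\<close>

lemma sum_weighted_powr_upper:
  assumes nn: "\<And>n. a n \<ge> (0::real)" and lg: "linear_growth a C"
  obtains K where "K \<ge> 0" "\<And>n. (\<Sum>m\<in>{1..n}. a m * real m powr (-(3/4))) \<le> K * real n powr (1/4)"
proof -
  obtain K0 where K0: "K0 \<ge> 0" "\<And>x. x \<ge> 1 \<Longrightarrow> \<bar>summatory a x - C * x\<bar> \<le> K0 * x powr 1"
    using linear_growthE[OF lg, of 1] by auto
  define K where "K = K0 + \<bar>C\<bar>"
  have K: "K \<ge> 0" using K0 by (simp add: K_def)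
  have S: "(\<Sum>m\<in>{1..n}. a m) \<le> K * real n" for n
  proof (cases "n = 0")
    case False
    have "C * real n \<le> \<bar>C\<bar> * real n" by (intro mult_right_mono) auto
    moreover have "\<bar>(\<Sum>m\<in>{1..n}. a m) - C * real n\<bar> \<le> K0 * real n"
      using K0(2)[of "real n"] False by (simp add: summatory_of_nat)
    ultimately show ?thesis unfolding K_def distrib_right by linarith
  qed auto
  let ?f = "\<lambda>m. real m powr (-(3/4))"
  have "(\<Sum>m\<in>{1..n}. a m * ?f m) \<le> (4*K) * real n powr (1/4)" for n
  proof -
    have sh: "(\<Sum>m\<in>{1..n}. h m) = (\<Sum>m<n. h (Suc m))" for h :: "nat \<Rightarrow> real"
      using sum.atLeast1_atMost_eq[of h n] by simp
    have dec: "?f (Suc (Suc m)) \<le> ?f (Suc m)" for m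
      by (intro powr_mono2') auto
    have "(\<Sum>m\<in>{1..n}. a m * ?f m) = (\<Sum>m\<in>{1..n}. a m) * ?f (Suc n) +
        (\<Sum>m<n. (\<Sum>j\<in>{1..Suc m}. a j) * (?f (Suc m) - ?f (Suc (Suc m))))"
      unfolding sh[of "\<lambda>m. a m * ?f m"] by (rule abel_summation)
    also have "\<dots> \<le> (K * real n) * ?f (Suc n) +
        (\<Sum>m<n. (K * real (Suc m)) * (?f (Suc m) - ?f (Suc (Suc m))))"
      by (intro add_mono sum_mono mult_right_mono S) (use dec in \<open>simp_all del: of_nat_Suc\<close>)
    also have "\<dots> = K * ((\<Sum>j\<in>{1..n}. 1) * ?f (Suc n) +
        (\<Sum>m<n. (\<Sum>j\<in>{1..Suc m}. 1) * (?f (Suc m) - ?f (Suc (Suc m)))))"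
      by (simp add: sum_distrib_left algebra_simps)
    also have "\<dots> = K * (\<Sum>m<n. 1 * ?f (Suc m))"
      by (subst abel_summation[of "\<lambda>_. 1" ?f]) simp
    also have "(\<Sum>m<n. 1 * ?f (Suc m)) = (\<Sum>m\<in>{1..n}. ?f m)"
      unfolding sh by simp
    also have "K * \<dots> \<le> K * (4 * real n powr (1/4))"
      by (intro mult_left_mono sum_powr_upper K)
    finally show ?thesis by (simp add: mult_ac)
  qed
  thus ?thesis using that[of "4*K"] K by auto
qed

text \<open>For \<open>a - C\<close>, partial sums of order \<open>n powr (3/4)\<close> meet weight
  differences of order \<open>n powr (-2)\<close>, which leaves a convergent series with exponent
  -5/4. The constant part is \<open>C\<close> times a harmonic sum.\<close>

lemma sum_over_n_bound:
  assumes lg: "linear_growth a C"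
  obtains K where "K \<ge> 0" "\<And>n. n \<ge> 1 \<Longrightarrow> \<bar>(\<Sum>m\<in>{1..n}. a m / real m) - C * ln (real n)\<bar> \<le> K"
proof -
  obtain K where K: "K \<ge> 0" "\<And>x. x \<ge> 1 \<Longrightarrow> \<bar>summatory a x - C * x\<bar> \<le> K * x powr (3/4)"
    using linear_growthE[OF lg, of "3/4"] by auto
  define R where "R n = (\<Sum>m\<in>{1..n}. a m - C)" for n
  have R_eq: "R n = summatory a n - C * n" for n
    by (simp add: R_def sum_subtractf summatory_of_nat)
  have Rb: "\<bar>R n\<bar> \<le> K * real n powr (3/4)" for n
  proof (cases "n = 0")
    case False thus ?thesis using K(2)[of "real n"] by (simp add: R_eq)
  qed (simp add: R_def)
  define T where "T = (\<Sum>m. real (Suc m) powr (-(5/4)))"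
  have sT: "summable (\<lambda>m. real (Suc m) powr (-(5/4)))" by (intro summable_Suc_powr) auto
  have T0: "T \<ge> 0" unfolding T_def by (intro suminf_nonneg sT) auto
  have sh: "(\<Sum>m\<in>{1..n}. h m) = (\<Sum>m<n. h (Suc m))" for h :: "nat \<Rightarrow> real" and n
    using sum.atLeast1_atMost_eq[of h n] by simp
  have main: "\<bar>\<Sum>m\<in>{1..n}. (a m - C) * (1 / real m)\<bar> \<le> K + K * T" for n
  proof -
    have "(\<Sum>m\<in>{1..n}. (a m - C) * (1 / real m)) = R n * (1 / real (Suc n)) +
       (\<Sum>m<n. R (Suc m) * (1 / real (Suc m) - 1 / real (Suc (Suc m))))"
      unfolding R_def sh[of "\<lambda>m. (a m - C) * (1 / real m)"] by (rule abel_summation[of "\<lambda>m. a m - C" "\<lambda>m. 1 / real m"])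
    also have "\<bar>\<dots>\<bar> \<le> \<bar>R n * (1 / real (Suc n))\<bar> + (\<Sum>m<n. \<bar>R (Suc m) * (1 / real (Suc m) - 1 / real (Suc (Suc m)))\<bar>)"
      by (intro order_trans[OF abs_triangle_ineq] add_mono sum_abs order_refl)
    also have "\<dots> \<le> K + (\<Sum>m<n. K * real (Suc m) powr (-(5/4)))"
    proof (intro add_mono sum_mono)
      have "real n powr (3/4) \<le> real (Suc n) powr (3/4)" by (intro powr_mono2) auto
      also have "\<dots> \<le> real (Suc n) powr 1" by (intro powr_mono) auto
      finally have "K * real n powr (3/4) \<le> K * real (Suc n)" using K(1) by (intro mult_left_mono) auto
      with Rb[of n] have "\<bar>R n\<bar> \<le> K * real (Suc n)" by linarith
      thus "\<bar>R n * (1 / real (Suc n))\<bar> \<le> K" by (simp add: abs_mult field_simps)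
    next
      fix m
      have "1 / real (Suc m) - 1 / real (Suc (Suc m)) = 1 / (real (Suc m) * real (Suc (Suc m)))"
        by (simp add: field_simps)
      also have "\<dots> \<le> 1 / (real (Suc m) * real (Suc m))"
        by (intro divide_left_mono mult_left_mono) auto
      also have "\<dots> = real (Suc m) powr (-2)"
        by (simp add: powr_minus power2_eq_square field_simps del: of_nat_Suc)
      finally have le: "1 / real (Suc m) - 1 / real (Suc (Suc m)) \<le> real (Suc m) powr (-2)" .
      have ge: "1 / real (Suc m) - 1 / real (Suc (Suc m)) \<ge> 0" by (simp add: field_simps)
      have "\<bar>R (Suc m) * (1 / real (Suc m) - 1 / real (Suc (Suc m)))\<bar> =
        \<bar>R (Suc m)\<bar> * (1 / real (Suc m) - 1 / real (Suc (Suc m)))"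
        using ge by (simp only: abs_mult abs_of_nonneg)
      also have "\<dots> \<le> (K * real (Suc m) powr (3/4)) * real (Suc m) powr (-2)"
        using le ge K(1) by (intro mult_mono Rb) auto
      also have "\<dots> = K * real (Suc m) powr (3/4 + -2)" unfolding powr_add by (simp only: mult.assoc)
      finally show "\<bar>R (Suc m) * (1 / real (Suc m) - 1 / real (Suc (Suc m)))\<bar> \<le> K * real (Suc m) powr (-(5/4))"
        by simp
    qed
    also have "(\<Sum>m<n. K * real (Suc m) powr (-(5/4))) \<le> K * T"
      unfolding T_def sum_distrib_left[symmetric] using K(1)
      by (intro mult_left_mono sum_le_suminf sT) auto
    finally show ?thesis by simp
  qed
  show ?thesis
  proof (rule that[of "K + K * T + \<bar>C\<bar>"])
    show "0 \<le> K + K * T + \<bar>C\<bar>" using K(1) T0 by simp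
    fix n :: nat assume n: "n \<ge> 1"
    have "(\<Sum>m\<in>{1..n}. a m / real m) = (\<Sum>m\<in>{1..n}. (a m - C) * (1 / real m)) + C * (\<Sum>m\<in>{1..n}. 1 / real m)"
      unfolding sum_distrib_left sum.distrib[symmetric] by (intro sum.cong) (auto simp: field_simps)
    hence "(\<Sum>m\<in>{1..n}. a m / real m) - C * ln (real n) =
       (\<Sum>m\<in>{1..n}. (a m - C) * (1 / real m)) + C * ((\<Sum>m\<in>{1..n}. 1 / real m) - ln (real n))"
      by (simp add: algebra_simps)
    moreover have "\<bar>C * ((\<Sum>m\<in>{1..n}. 1 / real m) - ln (real n))\<bar> \<le> \<bar>C\<bar> * 1"
      unfolding abs_mult by (intro mult_left_mono sum_inverse_bounds n) auto
    ultimately show "\<bar>(\<Sum>m\<in>{1..n}. a m / real m) - C * ln (real n)\<bar> \<le> K + K * T + \<bar>C\<bar>"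
      using main[of n] by linarith
  qed
qed

text \<open>Summation over the variable of \<open>a\<close> alone is precise enough: the remainder
  of \<open>b\<close> contributes \<open>x powr (3/4)\<close> times the sum of
  \<open>a m * m powr (-(3/4))\<close>, which is O(x), and this is negligible against
  \<open>x * ln x\<close>. The exponent 3/4 stands for any number strictly between 1/2 and
  1.\<close>

lemma summatory_conv_asymptotics:
  assumes a: "\<And>n. a n \<ge> 0" "linear_growth a \<alpha>" and b: "linear_growth b \<beta>"
  obtains K where "\<And>x. x \<ge> 1 \<Longrightarrow> \<bar>summatory (dirichlet_conv a b) x - \<alpha> * \<beta> * x * ln x\<bar> \<le> K * x"
proof -
  obtain K1 where K1: "K1 \<ge> 0" "\<And>x. x > 0 \<Longrightarrow> \<bar>summatory b x - \<beta> * x\<bar> \<le> K1 * x powr (3/4)"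
    using linear_growth_bound_all[OF b, of "3/4"] by auto
  obtain K2 where K2: "K2 \<ge> 0" "\<And>n. (\<Sum>m\<in>{1..n}. a m * real m powr (-(3/4))) \<le> K2 * real n powr (1/4)"
    using sum_weighted_powr_upper[OF a] by blast
  obtain K3 where K3: "K3 \<ge> 0" "\<And>n. n \<ge> 1 \<Longrightarrow> \<bar>(\<Sum>m\<in>{1..n}. a m / real m) - \<alpha> * ln (real n)\<bar> \<le> K3"
    using sum_over_n_bound[OF a(2)] by blast
  show ?thesis
  proof (rule that[of "K1 * K2 + \<bar>\<beta>\<bar> * K3 + \<bar>\<alpha> * \<beta>\<bar>"])
    fix x :: real assume x: "x \<ge> 1"
    define n where "n = nat \<lfloor>x\<rfloor>"
    have n: "n \<ge> 1" "real n \<le> x" "x < real n + 1" using x by (auto simp: n_def le_nat_iff le_floor_iff)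
    have e1: "\<bar>(\<Sum>m\<in>{1..n}. a m * summatory b (x / real m)) - (\<Sum>m\<in>{1..n}. a m * (\<beta> * (x / real m)))\<bar> \<le> K1 * K2 * x"
    proof -
      have "\<bar>(\<Sum>m\<in>{1..n}. a m * summatory b (x / real m)) - (\<Sum>m\<in>{1..n}. a m * (\<beta> * (x / real m)))\<bar> \<le>
        (\<Sum>m\<in>{1..n}. \<bar>a m * summatory b (x / real m) - a m * (\<beta> * (x / real m))\<bar>)"
        unfolding sum_subtractf[symmetric] by (rule sum_abs)
      also have "\<dots> \<le> (\<Sum>m\<in>{1..n}. a m * (K1 * (x powr (3/4) * real m powr (-(3/4)))))"
      proof (intro sum_mono)
        fix m assume m: "m \<in> {1..n}"
        have "\<bar>a m * summatory b (x / real m) - a m * (\<beta> * (x / real m))\<bar> = a m * \<bar>summatory b (x / real m) - \<beta> * (x / real m)\<bar>"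
          unfolding right_diff_distrib[symmetric] abs_mult using a(1)[of m] by simp
        also have "\<dots> \<le> a m * (K1 * (x / real m) powr (3/4))"
          using m x by (intro mult_left_mono K1 a) auto
        also have "(x / real m) powr (3/4) = x powr (3/4) * real m powr (-(3/4))"
          using x by (simp add: powr_divide powr_minus field_simps)
        finally show "\<bar>a m * summatory b (x / real m) - a m * (\<beta> * (x / real m))\<bar> \<le> a m * (K1 * (x powr (3/4) * real m powr (-(3/4))))" .
      qed
      also have "\<dots> = K1 * x powr (3/4) * (\<Sum>m\<in>{1..n}. a m * real m powr (-(3/4)))"
        unfolding sum_distrib_left by (intro sum.cong) (auto simp: mult_ac)
      also have "\<dots> \<le> K1 * x powr (3/4) * (K2 * x powr (1/4))"
      proof (intro mult_left_mono order_trans[OF K2(2)])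
        show "real n powr (1/4) \<le> x powr (1/4)" using n by (intro powr_mono2) auto
      qed (use K1 K2 in auto)
      also have "\<dots> = K1 * K2 * x" using x by (simp add: powr_add[symmetric] mult_ac)
      finally show ?thesis .
    qed
    have e2: "\<bar>(\<Sum>m\<in>{1..n}. a m * (\<beta> * (x / real m))) - \<beta> * x * (\<alpha> * ln (real n))\<bar> \<le> \<bar>\<beta>\<bar> * K3 * x"
    proof -
      have "(\<Sum>m\<in>{1..n}. a m * (\<beta> * (x / real m))) - \<beta> * x * (\<alpha> * ln (real n)) =
         \<beta> * x * ((\<Sum>m\<in>{1..n}. a m / real m) - \<alpha> * ln (real n))"
        unfolding right_diff_distrib sum_distrib_left by (simp add: mult_ac)
      also have "\<bar>\<dots>\<bar> \<le> \<bar>\<beta> * x\<bar> * K3" unfolding abs_mult[of "\<beta> * x"] by (intro mult_left_mono K3 n) auto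
      finally show ?thesis using x by (simp add: abs_mult mult_ac)
    qed
    \<comment> \<open>Replacing \<open>ln (real n)\<close> by \<open>ln x\<close> costs at most
      \<open>ln 2\<close>, because \<open>x \<le> 2 * real n\<close>.\<close>
    have e3: "\<bar>\<beta> * x * (\<alpha> * ln (real n)) - \<alpha> * \<beta> * x * ln x\<bar> \<le> \<bar>\<alpha> * \<beta>\<bar> * x"
    proof -
      have "real n \<ge> 1" using n(1) by simp
      hence "x \<le> 2 * real n" using n(3) by linarith
      hence "ln x \<le> ln (2 * real n)" using x by (intro iffD2[OF ln_le_cancel_iff]) auto
      also have "\<dots> = ln 2 + ln (real n)" using n by (simp add: ln_mult)
      finally have "ln x - ln (real n) \<le> 1" using ln_2_less_1 by linarith
      moreover have "ln (real n) \<le> ln x" using n by simp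
      ultimately have d: "\<bar>ln (real n) - ln x\<bar> \<le> 1" by linarith
      have "\<beta> * x * (\<alpha> * ln (real n)) - \<alpha> * \<beta> * x * ln x = \<alpha> * \<beta> * x * (ln (real n) - ln x)"
        by (simp add: algebra_simps)
      also have "\<bar>\<dots>\<bar> \<le> \<bar>\<alpha> * \<beta> * x\<bar> * 1" unfolding abs_mult[of "\<alpha> * \<beta> * x"] by (intro mult_left_mono d) auto
      finally show ?thesis using x by (simp add: abs_mult)
    qed
    have "summatory (dirichlet_conv a b) x = (\<Sum>m\<in>{1..n}. a m * summatory b (x / real m))"
      unfolding n_def using x by (intro summatory_conv) auto
    with e1 e2 e3 show "\<bar>summatory (dirichlet_conv a b) x - \<alpha> * \<beta> * x * ln x\<bar> \<le> (K1 * K2 + \<bar>\<beta>\<bar> * K3 + \<bar>\<alpha> * \<beta>\<bar>) * x"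
      unfolding distrib_right by linarith
  qed
qed

text \<open>Absolute convergence turns the product into an unordered sum over all pairs
  \<open>(m, n)\<close>, which is then regrouped according to \<open>m * n\<close>.\<close>

lemma has_sum_dirichlet_conv:
  fixes A B s :: complex
  assumes a: "((\<lambda>n. of_real (a n) * of_nat n powr (-s)) has_sum A) {1..}"
    and a': "(\<lambda>n. norm (of_real (a n) * of_nat n powr (-s) :: complex)) summable_on {1..}"
    and b: "((\<lambda>n. of_real (b n) * of_nat n powr (-s)) has_sum B) {1..}"
    and b': "(\<lambda>n. norm (of_real (b n) * of_nat n powr (-s) :: complex)) summable_on {1..}"
  shows "((\<lambda>n. of_real (dirichlet_conv a b n) * of_nat n powr (-s)) has_sum (A * B)) {1..}"
proof -
  define f where "f n = of_real (a n) * (of_nat n powr (-s) :: complex)" for n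
  define g where "g n = of_real (b n) * (of_nat n powr (-s) :: complex)" for n
  have abs: "(\<lambda>p. norm (case p of (m,n) \<Rightarrow> f m * g n)) summable_on {1..} \<times> {1..}"
  proof (subst Infinite_Sum.abs_summable_on_Sigma_iff, intro conjI ballI)
    fix m :: nat
    show "(\<lambda>n. norm (case (m, n) of (m, n) \<Rightarrow> f m * g n)) summable_on {1..}"
      using b' unfolding g_def[symmetric] by (simp add: norm_mult summable_on_cmult_right)
  next
    have "(\<lambda>m. norm (f m) * infsum (\<lambda>n. norm (g n)) {1..}) summable_on {1..}"
      using a' unfolding f_def[symmetric] by (intro summable_on_cmult_left)
    hence "(\<lambda>m. norm (norm (f m) * infsum (\<lambda>n. norm (g n)) {1..})) summable_on {1..}"
      by (rule summable_on_cong[THEN iffD1, rotated]) (simp add: infsum_nonneg)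
    thus "(\<lambda>m. norm (\<Sum>\<^sub>\<infinity>n\<in>{1..}. norm (case (m, n) of (m, n) \<Rightarrow> f m * g n))) summable_on {1..}"
      by (simp add: norm_mult infsum_cmult_right')
  qed
  have "((\<lambda>(m,n). f m * g n) has_sum (A * B)) ({1..} \<times> {1..})"
  proof (rule has_sum_SigmaI)
    show "((\<lambda>n. case (m, n) of (m, n) \<Rightarrow> f m * g n) has_sum f m * B) {1..}" for m
      using b unfolding g_def[symmetric] by (simp add: has_sum_cmult_right)
    show "((\<lambda>m. f m * B) has_sum A * B) {1..}"
      using a unfolding f_def[symmetric] by (rule has_sum_cmult_left)
    show "(\<lambda>(m,n). f m * g n) summable_on {1..} \<times> {1..}"
      using abs by (rule abs_summable_summable)
  qed
  also have "?this \<longleftrightarrow> ((\<lambda>(n,d). (of_real (a d * b (n div d)) * of_nat n powr (-s))) has_sum (A * B)) (SIGMA n:{1..}. {d. d dvd n})"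
  proof (rule has_sum_reindex_bij_witness[of _ "\<lambda>(n,d). (d, n div d)" "\<lambda>(m,n). (m * n, m)"])
    fix p :: "nat \<times> nat" assume p: "p \<in> (SIGMA n:{1..}. {d. d dvd n})"
    show "(case case p of (n, d) \<Rightarrow> (d, n div d) of (m, n) \<Rightarrow> (m * n, m)) = p"
      using p by auto
    show "(case p of (n, d) \<Rightarrow> (d, n div d)) \<in> {1..} \<times> {1..}"
      using p by (auto simp: Suc_le_eq elim!: dvdE)
  next
    fix p :: "nat \<times> nat" assume p: "p \<in> {1..} \<times> {1..}"
    then obtain m n where mn: "p = (m,n)" "m \<ge> 1" "n \<ge> 1" by auto
    have "(of_nat (m * n) :: complex) powr (-s) = of_nat m powr (-s) * of_nat n powr (-s)"
      unfolding of_nat_mult by (intro powr_times_real) auto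
    thus "(case case p of (m, n) \<Rightarrow> (m * n, m) of (n, d) \<Rightarrow> of_real (a d * b (n div d)) * of_nat n powr - s) = (case p of (m, n) \<Rightarrow> f m * g n)"
      using mn by (simp add: f_def g_def mult_ac)
  qed auto
  finally show ?thesis
  proof (rule has_sum_SigmaD)
    fix n :: nat assume n: "n \<in> {1..}"
    have "of_real (dirichlet_conv a b n) * of_nat n powr (-s) = (\<Sum>d | d dvd n. of_real (a d * b (n div d)) * (of_nat n powr (-s) :: complex))"
      by (simp add: dirichlet_conv_def sum_distrib_right)
    thus "((\<lambda>d. case (n, d) of (n, d) \<Rightarrow> of_real (a d * b (n div d)) * of_nat n powr (-s)) has_sum
          of_real (dirichlet_conv a b n) * of_nat n powr (-s)) {d. d dvd n}"
      using n by (auto intro!: has_sum_finiteI)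
  qed
qed

lemma has_sum_atLeast1_iff:
  "(f has_sum S) {1::nat..} \<longleftrightarrow> ((\<lambda>n. f (Suc n)) has_sum S) UNIV"
proof -
  have "bij_betw Suc UNIV {1..}"
    by (rule bij_betwI[of _ _ _ "\<lambda>n. n - 1"]) auto
  from has_sum_reindex_bij_betw[OF this, of f S] show ?thesis by simp
qed

text \<open>For nonnegative coefficients the norms of the terms at \<open>s\<close> are the terms at
  the real point \<open>Re s\<close>, so convergence there is absolute convergence at
  \<open>s\<close>.\<close>

lemma dirichlet_has_sum_of_sums:
  fixes a :: "nat \<Rightarrow> real" and H :: "complex \<Rightarrow> complex"
  assumes nn: "\<And>n. a n \<ge> 0"
    and sums: "\<And>s. Re s > 1 \<Longrightarrow> (\<lambda>n. of_real (a (Suc n)) * of_nat (Suc n) powr (-s)) sums H s"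
    and s: "Re s > 1"
  shows "((\<lambda>n. of_real (a n) * of_nat n powr (-s)) has_sum H s) {1..}"
    and "(\<lambda>n. norm (of_real (a n) * of_nat n powr (-s) :: complex)) summable_on {1..}"
proof -
  have eq: "(of_real (a (Suc n)) * of_nat (Suc n) powr (- of_real (Re s)) :: complex)
     = of_real (norm (of_real (a (Suc n)) * of_nat (Suc n) powr (-s) :: complex))" for n
    using nn[of "Suc n"] powr_of_real[of "real (Suc n)" "- Re s"]
    by (simp add: norm_mult norm_powr_real_powr del: of_nat_Suc)
  have "summable (\<lambda>n. complex_of_real (norm (of_real (a (Suc n)) * of_nat (Suc n) powr (-s) :: complex)))"
    unfolding eq[symmetric] using sums_summable[OF sums[of "of_real (Re s)"]] s by simp
  hence sm: "summable (\<lambda>n. norm (of_real (a (Suc n)) * of_nat (Suc n) powr (-s) :: complex))"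
    by (simp only: summable_of_real_iff)
  show "((\<lambda>n. of_real (a n) * of_nat n powr (-s)) has_sum H s) {1..}"
    unfolding has_sum_atLeast1_iff by (rule norm_summable_imp_has_sum[OF sm sums[OF s]])
  have "((\<lambda>n. norm (of_real (a (Suc n)) * of_nat (Suc n) powr (-s) :: complex)) has_sum
      (\<Sum>n. norm (of_real (a (Suc n)) * of_nat (Suc n) powr (-s) :: complex))) UNIV"
    by (rule norm_summable_imp_has_sum) (use sm in \<open>simp_all only: abs_norm_cancel real_norm_def summable_sums\<close>)
  thus "(\<lambda>n. norm (of_real (a n) * of_nat n powr (-s) :: complex)) summable_on {1..}"
    unfolding has_sum_atLeast1_iff[of "\<lambda>n. norm (of_real (a n) * of_nat n powr (-s) :: complex)", symmetric]
    by (rule has_sum_imp_summable)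
qed

lemma has_sum_finite_sum:
  fixes f :: "'i \<Rightarrow> 'a \<Rightarrow> 'b::topological_comm_monoid_add"
  assumes "finite I" "\<And>i. i \<in> I \<Longrightarrow> (f i has_sum S i) A"
  shows "((\<lambda>x. \<Sum>i\<in>I. f i x) has_sum (\<Sum>i\<in>I. S i)) A"
  using assms by (induction I rule: finite_induct) (auto intro!: has_sum_add)

section \<open>Dilation of the argument and the double pole\<close>

text \<open>The index enters the convolutions only through a fixed multiple. When nothing is
  supported off the multiples of \<open>\<kappa>\<close>, the dilation rescales \<open>x\<close>;
  for the Dirichlet series it becomes the factor \<open>\<kappa> powr s\<close>.\<close>

lemma summatory_multiples:
  assumes "\<kappa> \<ge> 1" "\<And>n. n > 0 \<Longrightarrow> \<not> \<kappa> dvd n \<Longrightarrow> f n = 0" "x \<ge> 0"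
  shows "summatory (\<lambda>n. f (\<kappa> * n)) x = summatory f (real \<kappa> * x)"
proof -
  have "summatory f (real \<kappa> * x) = (\<Sum>n\<in>(\<lambda>n. \<kappa> * n) ` {1..nat \<lfloor>x\<rfloor>}. f n)"
    unfolding summatory_def
  proof (rule sum.mono_neutral_right)
    show "(\<lambda>n. \<kappa> * n) ` {1..nat \<lfloor>x\<rfloor>} \<subseteq> {1..nat \<lfloor>real \<kappa> * x\<rfloor>}"
      using assms by (auto simp: le_nat_iff le_floor_iff)
    show "\<forall>n\<in>{1..nat \<lfloor>real \<kappa> * x\<rfloor>} - (\<lambda>n. \<kappa> * n) ` {1..nat \<lfloor>x\<rfloor>}. f n = 0"
    proof safe
      fix n assume n: "n \<in> {1..nat \<lfloor>real \<kappa> * x\<rfloor>}" "n \<notin> (\<lambda>n. \<kappa> * n) ` {1..nat \<lfloor>x\<rfloor>}"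
      show "f n = 0"
      proof (rule assms(2))
        show "n > 0" using n by auto
        show "\<not> \<kappa> dvd n"
        proof
          assume "\<kappa> dvd n"
          then obtain m where m: "n = \<kappa> * m" by blast
          have "real n \<le> real \<kappa> * x" using n assms by (auto simp: le_nat_iff le_floor_iff)
          hence "real m \<le> x" using m assms by simp
          moreover have "m \<ge> 1" using n m by (cases m) auto
          ultimately have "m \<in> {1..nat \<lfloor>x\<rfloor>}" using assms by (auto simp: le_nat_iff le_floor_iff)
          thus False using n(2) m by blast
        qed
      qed
    qed
  qed auto
  also have "\<dots> = summatory (\<lambda>n. f (\<kappa> * n)) x"
    unfolding summatory_def using assms by (subst sum.reindex) (auto simp: inj_on_def o_def)
  finally show ?thesis ..
qed

lemma has_sum_multiples:
  fixes f :: "nat \<Rightarrow> real" and s :: complex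
  assumes \<kappa>: "\<kappa> \<ge> 1" and 0: "\<And>n. n > 0 \<Longrightarrow> \<not> \<kappa> dvd n \<Longrightarrow> f n = 0"
    and S: "((\<lambda>n. of_real (f n) * of_nat n powr (-s)) has_sum S) {1..}"
  shows "((\<lambda>n. of_real (f (\<kappa> * n)) * of_nat n powr (-s)) has_sum (of_nat \<kappa> powr s * S)) {1..}"
proof -
  have "((\<lambda>n. of_real (f n) * of_nat n powr (-s)) has_sum S) ((\<lambda>n. \<kappa> * n) ` {1..})"
  proof (rule has_sum_cong_neutral[THEN iffD1, OF _ _ _ S])
    fix n assume "n \<in> {1..} - (\<lambda>n. \<kappa> * n) ` {1..}"
    hence "n > 0" "\<not> \<kappa> dvd n" by (auto elim!: dvdE)
    thus "of_real (f n) * of_nat n powr (-s) = 0" using 0 by simp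
  qed (use \<kappa> in auto)
  hence "((\<lambda>n. of_real (f (\<kappa> * n)) * of_nat (\<kappa> * n) powr (-s)) has_sum S) {1..}"
    by (subst (asm) has_sum_reindex) (use \<kappa> in \<open>auto simp: inj_on_def o_def\<close>)
  hence "((\<lambda>n. of_nat \<kappa> powr s * (of_real (f (\<kappa> * n)) * of_nat (\<kappa> * n) powr (-s))) has_sum (of_nat \<kappa> powr s * S)) {1..}"
    by (rule has_sum_cmult_right)
  also have "?this \<longleftrightarrow> ?thesis"
  proof (rule has_sum_cong)
    fix n :: nat
    have "of_nat (\<kappa> * n) powr (-s) = (of_nat \<kappa> powr (-s) * of_nat n powr (-s) :: complex)"
      unfolding of_nat_mult by (intro powr_times_real) auto
    moreover have "of_nat \<kappa> powr s * of_nat \<kappa> powr (-s) = (1 :: complex)"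
      using \<kappa> by (simp add: powr_minus)
    ultimately show "of_nat \<kappa> powr s * (of_real (f (\<kappa> * n)) * of_nat (\<kappa> * n) powr (-s)) = of_real (f (\<kappa> * n)) * of_nat n powr (-s)"
      by (metis (no_types, lifting) mult.left_commute mult.right_neutral mult.assoc)
  qed
  finally show ?thesis .
qed

lemma is_pole_zorder_double:
  assumes h: "h holomorphic_on {s. Re s > 1/2}" "h 1 \<noteq> 0"
  shows "is_pole (\<lambda>s. h s / (s - 1)\<^sup>2) 1" "zorder (\<lambda>s. h s / (s - 1)\<^sup>2) 1 = -2"
proof -
  have "isCont h 1"
    using continuous_on_eq_continuous_at[OF open_Re_gt[of "1/2"], of h] holomorphic_on_imp_continuous_on[OF h(1)]
    by (auto dest: bspec[of _ _ 1])
  hence lim: "h \<midarrow>1\<rightarrow> h 1" by (simp add: isCont_def)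
  have "((\<lambda>s. (s - 1)\<^sup>2) \<longlongrightarrow> 0) (at (1::complex))" by (auto intro!: tendsto_eq_intros)
  hence at0: "filterlim (\<lambda>s. (s - 1)\<^sup>2) (at 0) (at (1::complex))"
    by (auto simp: filterlim_at eventually_at_filter)
  show "is_pole (\<lambda>s. h s / (s - 1)\<^sup>2) 1"
    unfolding is_pole_def by (rule filterlim_divide_at_infinity[OF lim at0 h(2)])
  show "zorder (\<lambda>s. h s / (s - 1)\<^sup>2) 1 = -2"
    by (rule zorder_eqI[OF open_Re_gt[of "1/2"] _ h(1) h(2)])
       (simp_all add: power_int_minus inverse_eq_divide)
qed

text \<open>Each convolution has the Dirichlet series
  \<open>Hz i s * He i s / (s - 1)\<^sup>2\<close>. The coefficient of the double pole of the total
  is the same number \<open>c\<close> that multiplies \<open>x * ln x\<close>; it is positive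
  because all its summands are nonnegative and one is positive.\<close>

lemma double_pole_of_convolutions:
  fixes f :: "nat \<Rightarrow> real" and z e :: "'i \<Rightarrow> nat \<Rightarrow> real"
  assumes fin: "finite I"
    and w: "\<And>i. i \<in> I \<Longrightarrow> w i \<ge> (0::real)"
    and z: "\<And>i n. i \<in> I \<Longrightarrow> z i n \<ge> 0" "\<And>i. i \<in> I \<Longrightarrow> linear_growth (z i) (\<alpha> i)"
    and e: "\<And>i n. i \<in> I \<Longrightarrow> e i n \<ge> 0" "\<And>i. i \<in> I \<Longrightarrow> linear_growth (e i) (\<beta> i)"
    and \<kappa>: "\<And>i. i \<in> I \<Longrightarrow> \<kappa> i \<ge> (1::nat)"
    and multiples: "\<And>i n. i \<in> I \<Longrightarrow> n > 0 \<Longrightarrow> \<not> \<kappa> i dvd n \<Longrightarrow> dirichlet_conv (z i) (e i) n = 0"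
    and f: "\<And>n. n \<ge> 1 \<Longrightarrow> f n = (\<Sum>i\<in>I. w i * dirichlet_conv (z i) (e i) (\<kappa> i * n))"
    and pos: "\<exists>i\<in>I. w i > 0 \<and> \<alpha> i > 0 \<and> \<beta> i > 0"
  shows "\<exists>F. F holomorphic_on ({s. Re s > 1/2} - {1}) \<and> is_pole F 1 \<and> zorder F 1 = -2 \<and>
            (\<forall>s. Re s > 1 \<longrightarrow> (\<lambda>n. of_real (f (Suc n)) * of_nat (Suc n) powr (-s)) sums F s)"
    and "\<exists>c>0. summatory f \<sim>[at_top] (\<lambda>x. c * x * ln x)"
proof -
  have ab: "\<alpha> i \<ge> 0" "\<beta> i \<ge> 0" if "i \<in> I" for i
    using linear_growth_nonneg[of "z i" "\<alpha> i"] linear_growth_nonneg[of "e i" "\<beta> i"] z e that by auto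
  define c where "c = (\<Sum>i\<in>I. w i * (\<alpha> i * \<beta> i * real (\<kappa> i)))"
  have c: "c > 0"
  proof -
    obtain i where i: "i \<in> I" "w i > 0" "\<alpha> i > 0" "\<beta> i > 0" using pos by blast
    show ?thesis unfolding c_def
    proof (rule sum_pos2[OF fin i(1)])
      show "0 < w i * (\<alpha> i * \<beta> i * real (\<kappa> i))" using i \<kappa>[OF i(1)] by simp
      show "0 \<le> w i * (\<alpha> i * \<beta> i * real (\<kappa> i))" if "i \<in> I" for i using that w ab by simp
    qed
  qed
  have "\<forall>i\<in>I. \<exists>H. H holomorphic_on {s. Re s > 1/2} \<and> H 1 = of_real (\<alpha> i) \<and>
    (\<forall>s. Re s > 1 \<longrightarrow> (\<lambda>n. of_real (z i (Suc n)) * of_nat (Suc n) powr (-s)) sums (H s / (s - 1)))"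
  proof
    fix i assume i: "i \<in> I"
    show "\<exists>H. H holomorphic_on {s. Re s > 1/2} \<and> H 1 = of_real (\<alpha> i) \<and>
    (\<forall>s. Re s > 1 \<longrightarrow> (\<lambda>n. of_real (z i (Suc n)) * of_nat (Suc n) powr (-s)) sums (H s / (s - 1)))"
      by (rule dirichlet_series_continuation[OF z(2)[OF i]]) blast
  qed
  from bchoice[OF this] obtain Hz where Hz': "\<forall>i\<in>I. Hz i holomorphic_on {s. Re s > 1/2} \<and> Hz i 1 = of_real (\<alpha> i) \<and>
    (\<forall>s. Re s > 1 \<longrightarrow> (\<lambda>n. of_real (z i (Suc n)) * of_nat (Suc n) powr (-s)) sums (Hz i s / (s - 1)))"
    by (rule exE)
  have Hz: "\<And>i. i \<in> I \<Longrightarrow> Hz i holomorphic_on {s. Re s > 1/2}" "\<And>i. i \<in> I \<Longrightarrow> Hz i 1 = of_real (\<alpha> i)"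
    "\<And>i s. i \<in> I \<Longrightarrow> Re s > 1 \<Longrightarrow> (\<lambda>n. of_real (z i (Suc n)) * of_nat (Suc n) powr (-s)) sums (Hz i s / (s - 1))"
    using Hz' by blast+
  have "\<forall>i\<in>I. \<exists>H. H holomorphic_on {s. Re s > 1/2} \<and> H 1 = of_real (\<beta> i) \<and>
    (\<forall>s. Re s > 1 \<longrightarrow> (\<lambda>n. of_real (e i (Suc n)) * of_nat (Suc n) powr (-s)) sums (H s / (s - 1)))"
  proof
    fix i assume i: "i \<in> I"
    show "\<exists>H. H holomorphic_on {s. Re s > 1/2} \<and> H 1 = of_real (\<beta> i) \<and>
    (\<forall>s. Re s > 1 \<longrightarrow> (\<lambda>n. of_real (e i (Suc n)) * of_nat (Suc n) powr (-s)) sums (H s / (s - 1)))"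
      by (rule dirichlet_series_continuation[OF e(2)[OF i]]) blast
  qed
  from bchoice[OF this] obtain He where He': "\<forall>i\<in>I. He i holomorphic_on {s. Re s > 1/2} \<and> He i 1 = of_real (\<beta> i) \<and>
    (\<forall>s. Re s > 1 \<longrightarrow> (\<lambda>n. of_real (e i (Suc n)) * of_nat (Suc n) powr (-s)) sums (He i s / (s - 1)))"
    by (rule exE)
  have He: "\<And>i. i \<in> I \<Longrightarrow> He i holomorphic_on {s. Re s > 1/2}" "\<And>i. i \<in> I \<Longrightarrow> He i 1 = of_real (\<beta> i)"
    "\<And>i s. i \<in> I \<Longrightarrow> Re s > 1 \<Longrightarrow> (\<lambda>n. of_real (e i (Suc n)) * of_nat (Suc n) powr (-s)) sums (He i s / (s - 1))"
    using He' by blast+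
  define h where "h s = (\<Sum>i\<in>I. of_real (w i) * (of_nat (\<kappa> i) powr s * (Hz i s * He i s)))" for s
  have h_hol: "h holomorphic_on {s. Re s > 1/2}"
    unfolding h_def by (intro holomorphic_intros Hz He)
  have "h 1 = of_real c"
    unfolding h_def c_def of_real_sum using Hz(2) He(2) \<kappa>
    by (intro sum.cong) (auto simp: mult_ac)
  hence h1: "h 1 \<noteq> 0" using c by simp
  show "\<exists>F. F holomorphic_on ({s. Re s > 1/2} - {1}) \<and> is_pole F 1 \<and> zorder F 1 = -2 \<and>
            (\<forall>s. Re s > 1 \<longrightarrow> (\<lambda>n. of_real (f (Suc n)) * of_nat (Suc n) powr (-s)) sums F s)"
  proof (intro exI[of _ "\<lambda>s. h s / (s - 1)\<^sup>2"] conjI allI impI is_pole_zorder_double h_hol h1)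
    show "(\<lambda>s. h s / (s - 1)\<^sup>2) holomorphic_on ({s. Re s > 1/2} - {1})"
      by (intro holomorphic_intros holomorphic_on_subset[OF h_hol]) auto
    fix s :: complex assume s: "Re s > 1"
    have conv: "((\<lambda>n. of_real (dirichlet_conv (z i) (e i) (\<kappa> i * n)) * of_nat n powr (-s)) has_sum
         (of_nat (\<kappa> i) powr s * (Hz i s / (s - 1) * (He i s / (s - 1))))) {1..}" if i: "i \<in> I" for i
    proof -
      note z' = dirichlet_has_sum_of_sums[of "z i" "\<lambda>s. Hz i s / (s - 1)", OF z(1)[OF i] Hz(3)[OF i] s]
      note e' = dirichlet_has_sum_of_sums[of "e i" "\<lambda>s. He i s / (s - 1)", OF e(1)[OF i] He(3)[OF i] s]
      show ?thesis
        by (rule has_sum_multiples[OF \<kappa>[OF i] multiples[OF i] has_sum_dirichlet_conv[OF z' e']])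
    qed
    have "((\<lambda>n. \<Sum>i\<in>I. of_real (w i) * (of_real (dirichlet_conv (z i) (e i) (\<kappa> i * n)) * of_nat n powr (-s))) has_sum
         (\<Sum>i\<in>I. of_real (w i) * (of_nat (\<kappa> i) powr s * (Hz i s / (s - 1) * (He i s / (s - 1)))))) {1..}"
      by (intro has_sum_finite_sum fin has_sum_cmult_right conv)
    also have "(\<Sum>i\<in>I. of_real (w i) * (of_nat (\<kappa> i) powr s * (Hz i s / (s - 1) * (He i s / (s - 1))))) = h s / (s - 1)\<^sup>2"
      unfolding h_def sum_divide_distrib by (simp add: power2_eq_square)
    finally have "((\<lambda>n. of_real (f n) * of_nat n powr (-s)) has_sum (h s / (s - 1)\<^sup>2)) {1..}"
      by (rule has_sum_cong[THEN iffD1, rotated]) (simp add: f sum_distrib_right mult.assoc)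
    thus "(\<lambda>n. of_real (f (Suc n)) * of_nat (Suc n) powr (-s)) sums (h s / (s - 1)\<^sup>2)"
      unfolding has_sum_atLeast1_iff by (rule has_sum_imp_sums)
  qed
  have "\<forall>i\<in>I. \<exists>K. \<forall>x\<ge>1. \<bar>summatory (dirichlet_conv (z i) (e i)) x - \<alpha> i * \<beta> i * x * ln x\<bar> \<le> K * x"
  proof
    fix i assume i: "i \<in> I"
    show "\<exists>K. \<forall>x\<ge>1. \<bar>summatory (dirichlet_conv (z i) (e i)) x - \<alpha> i * \<beta> i * x * ln x\<bar> \<le> K * x"
      by (rule summatory_conv_asymptotics[OF z(1)[OF i] z(2)[OF i] e(2)[OF i]]) blast
  qed
  from bchoice[OF this] obtain K where K': "\<forall>i\<in>I. \<forall>x\<ge>1. \<bar>summatory (dirichlet_conv (z i) (e i)) x - \<alpha> i * \<beta> i * x * ln x\<bar> \<le> K i * x"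
    by (rule exE)
  have K: "\<bar>summatory (dirichlet_conv (z i) (e i)) x - \<alpha> i * \<beta> i * x * ln x\<bar> \<le> K i * x" if "i \<in> I" "x \<ge> 1" for i x
    using K' that by blast
  define C where "C = (\<Sum>i\<in>I. w i * (real (\<kappa> i) * (K i + \<alpha> i * \<beta> i * ln (real (\<kappa> i)))))"
  have bound: "\<bar>summatory f x - c * x * ln x\<bar> \<le> C * x" if x: "x \<ge> 1" for x
  proof -
    have "summatory f x = (\<Sum>i\<in>I. w i * summatory (\<lambda>n. dirichlet_conv (z i) (e i) (\<kappa> i * n)) x)"
      unfolding summatory_def sum_distrib_left by (subst sum.swap) (intro sum.cong refl f, auto)
    also have "\<dots> = (\<Sum>i\<in>I. w i * summatory (dirichlet_conv (z i) (e i)) (real (\<kappa> i) * x))"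
      using x by (intro sum.cong arg_cong2[of _ _ _ _ "(*)"] refl summatory_multiples \<kappa> multiples) auto
    finally have sf: "summatory f x = (\<Sum>i\<in>I. w i * summatory (dirichlet_conv (z i) (e i)) (real (\<kappa> i) * x))" .
    have "c * x * ln x = (\<Sum>i\<in>I. w i * (\<alpha> i * \<beta> i * real (\<kappa> i) * x * ln x))"
      unfolding c_def sum_distrib_right by (simp only: mult.assoc)
    with sf have diff: "summatory f x - c * x * ln x = (\<Sum>i\<in>I. w i * (summatory (dirichlet_conv (z i) (e i)) (real (\<kappa> i) * x) - \<alpha> i * \<beta> i * real (\<kappa> i) * x * ln x))"
      by (simp only: right_diff_distrib sum_subtractf)
    have "\<bar>summatory f x - c * x * ln x\<bar> \<le> (\<Sum>i\<in>I. \<bar>w i * (summatory (dirichlet_conv (z i) (e i)) (real (\<kappa> i) * x) - \<alpha> i * \<beta> i * real (\<kappa> i) * x * ln x)\<bar>)"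
      unfolding diff by (rule sum_abs)
    also have "\<dots> \<le> (\<Sum>i\<in>I. w i * (real (\<kappa> i) * (K i + \<alpha> i * \<beta> i * ln (real (\<kappa> i)))) * x)"
    proof (rule sum_mono)
      fix i assume i: "i \<in> I"
      have k1: "real (\<kappa> i) \<ge> 1" using \<kappa>[OF i] by simp
      have "1 * 1 \<le> real (\<kappa> i) * x" using k1 x by (intro mult_mono) auto
      hence kx: "real (\<kappa> i) * x \<ge> 1" by simp
      \<comment> \<open>Rescaling by \<open>\<kappa> i\<close> changes the logarithm by the constant
        \<open>ln (\<kappa> i)\<close>, which only affects the O(x) term.\<close>
      have "\<alpha> i * \<beta> i * (real (\<kappa> i) * x) * ln (real (\<kappa> i) * x) =
         \<alpha> i * \<beta> i * real (\<kappa> i) * x * ln x + \<alpha> i * \<beta> i * real (\<kappa> i) * x * ln (real (\<kappa> i))"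
        using k1 x by (simp add: ln_mult algebra_simps)
      moreover have "\<alpha> i * \<beta> i * real (\<kappa> i) * x * ln (real (\<kappa> i)) \<ge> 0" using ab[OF i] k1 x by simp
      ultimately have "\<bar>summatory (dirichlet_conv (z i) (e i)) (real (\<kappa> i) * x) - \<alpha> i * \<beta> i * real (\<kappa> i) * x * ln x\<bar>
          \<le> K i * (real (\<kappa> i) * x) + \<alpha> i * \<beta> i * real (\<kappa> i) * x * ln (real (\<kappa> i))"
        using K[OF i kx] by linarith
      also have "\<dots> = real (\<kappa> i) * (K i + \<alpha> i * \<beta> i * ln (real (\<kappa> i))) * x" by (simp add: algebra_simps)
      finally have "w i * \<bar>summatory (dirichlet_conv (z i) (e i)) (real (\<kappa> i) * x) - \<alpha> i * \<beta> i * real (\<kappa> i) * x * ln x\<bar> \<le>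
         w i * (real (\<kappa> i) * (K i + \<alpha> i * \<beta> i * ln (real (\<kappa> i))) * x)" using w[OF i] by (rule mult_left_mono)
      thus "\<bar>w i * (summatory (dirichlet_conv (z i) (e i)) (real (\<kappa> i) * x) - \<alpha> i * \<beta> i * real (\<kappa> i) * x * ln x)\<bar> \<le>
         w i * (real (\<kappa> i) * (K i + \<alpha> i * \<beta> i * ln (real (\<kappa> i)))) * x" using w[OF i] by (simp add: abs_mult mult.assoc)
    qed
    also have "\<dots> = C * x" by (simp add: C_def sum_distrib_right)
    finally show ?thesis .
  qed
  have "summatory f \<sim>[at_top] (\<lambda>x. c * x * ln x)"
  proof (rule smallo_imp_asymp_equiv)
    have "(\<lambda>x. summatory f x - c * x * ln x) \<in> O[at_top](\<lambda>x. x)"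
    proof (rule bigoI[of _ C])
      show "\<forall>\<^sub>F x in at_top. norm (summatory f x - c * x * ln x) \<le> C * norm x"
        using eventually_ge_at_top[of 1] by eventually_elim (use bound in auto)
    qed
    also have "(\<lambda>x::real. x) \<in> o[at_top](\<lambda>x. c * x * ln x)" using c by real_asymp
    finally show "(\<lambda>x. summatory f x - c * x * ln x) \<in> o[at_top](\<lambda>x. c * x * ln x)" .
  qed
  thus "\<exists>c>0. summatory f \<sim>[at_top] (\<lambda>x. c * x * ln x)" using c by blast
qed

section \<open>Counting lattice points\<close>

text \<open>The upper estimate is for closed intervals and the lower one for open intervals, so that
  together they cover every kind of endpoint.\<close>

lemma card_congruent_ints:
  fixes N i :: int
  assumes N: "N \<ge> 1"
  shows "finite {m. [m = i] (mod N) \<and> a \<le> real_of_int m \<and> real_of_int m \<le> b}"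
    and "a \<le> b \<Longrightarrow> card {m. [m = i] (mod N) \<and> a \<le> real_of_int m \<and> real_of_int m \<le> b} \<le> (b - a) / N + 1"
    and "(b - a) / N - 1 \<le> card {m. [m = i] (mod N) \<and> a < real_of_int m \<and> real_of_int m < b}"
proof -
  let ?f = "\<lambda>t. i + N * t"
  have N0: "real_of_int N > 0" using N by simp
  have inj: "inj ?f" using N by (auto simp: inj_def)
  have surj: "\<exists>t. m = ?f t" if "[m = i] (mod N)" for m
    using cong_sym[OF that] by (auto simp: cong_iff_lin)
  have cong: "[?f t = i] (mod N)" "[i + t * N = i] (mod N)" for t by (simp_all add: cong_def)
  have closed: "{m. [m = i] (mod N) \<and> a \<le> real_of_int m \<and> real_of_int m \<le> b} =
     ?f ` {\<lceil>(a - i) / N\<rceil>..\<lfloor>(b - i) / N\<rfloor>}" (is "?L = ?R")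
  proof safe
    fix m assume m: "[m = i] (mod N)" "a \<le> real_of_int m" "real_of_int m \<le> b"
    obtain t where t: "m = ?f t" using surj[OF m(1)] by blast
    have "t \<in> {\<lceil>(a - i) / N\<rceil>..\<lfloor>(b - i) / N\<rfloor>}"
      using m(2,3) N0 unfolding t by (auto simp: ceiling_le_iff le_floor_iff field_simps)
    thus "m \<in> ?f ` {\<lceil>(a - i) / N\<rceil>..\<lfloor>(b - i) / N\<rfloor>}" using t by blast
  next
    fix t assume "t \<in> {\<lceil>(a - i) / N\<rceil>..\<lfloor>(b - i) / N\<rfloor>}"
    thus "a \<le> ?f t" "?f t \<le> b" "[?f t = i] (mod N)"
      using N0 cong[of t] by (auto simp: ceiling_le_iff le_floor_iff pos_divide_le_eq pos_le_divide_eq algebra_simps)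
  qed
  show "finite ?L" unfolding closed by simp
  show "card ?L \<le> (b - a) / N + 1" if "a \<le> b"
  proof -
    have "card ?L = nat (\<lfloor>(b - i) / N\<rfloor> - \<lceil>(a - i) / N\<rceil> + 1)"
      unfolding closed by (subst card_image) (use inj in \<open>auto intro: inj_on_subset\<close>)
    moreover have "real_of_int (\<lfloor>(b - i) / N\<rfloor> - \<lceil>(a - i) / N\<rceil> + 1) \<le> (b - i) / N - (a - i) / N + 1"
      using of_int_floor_le[of "(b - i) / N"] le_of_int_ceiling[of "(a - i) / N"]
      unfolding of_int_add of_int_diff of_int_1 by linarith
    moreover have "(b - i) / N - (a - i) / N = (b - a) / N" by (simp add: diff_divide_distrib)
    moreover have "(b - a) / N \<ge> 0" using that N0 by simp
    ultimately show ?thesis by (simp add: of_nat_nat)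
  qed
  have opened: "{m. [m = i] (mod N) \<and> a < real_of_int m \<and> real_of_int m < b} =
     ?f ` {\<lfloor>(a - i) / N\<rfloor> + 1..\<lceil>(b - i) / N\<rceil> - 1}" (is "?L' = ?R'")
  proof safe
    fix m assume m: "[m = i] (mod N)" "a < real_of_int m" "real_of_int m < b"
    obtain t where t: "m = ?f t" using surj[OF m(1)] by blast
    have "\<lfloor>(a - i) / N\<rfloor> < t" "t < \<lceil>(b - i) / N\<rceil>"
      using m(2,3) N0 unfolding t by (auto simp: floor_less_iff less_ceiling_iff field_simps)
    thus "m \<in> ?f ` {\<lfloor>(a - i) / N\<rfloor> + 1..\<lceil>(b - i) / N\<rceil> - 1}" using t by auto
  next
    fix t assume "t \<in> {\<lfloor>(a - i) / N\<rfloor> + 1..\<lceil>(b - i) / N\<rceil> - 1}"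
    hence "\<lfloor>(a - i) / N\<rfloor> < t" "t < \<lceil>(b - i) / N\<rceil>" by auto
    thus "a < ?f t" "?f t < b" "[?f t = i] (mod N)"
      using N0 cong[of t] by (auto simp: floor_less_iff less_ceiling_iff pos_divide_less_eq pos_less_divide_eq algebra_simps)
  qed
  have "card ?L' = nat (\<lceil>(b - i) / N\<rceil> - 1 - (\<lfloor>(a - i) / N\<rfloor> + 1) + 1)"
    unfolding opened by (subst card_image) (use inj in \<open>auto intro: inj_on_subset\<close>)
  hence "real (card ?L') \<ge> real_of_int (\<lceil>(b - i) / N\<rceil> - 1 - (\<lfloor>(a - i) / N\<rfloor> + 1) + 1)"
    by (simp add: of_nat_nat)
  moreover have "(b - i) / N - (a - i) / N = (b - a) / N" by (simp add: diff_divide_distrib)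
  ultimately show "(b - a) / N - 1 \<le> card ?L'"
    using of_int_floor_le[of "(a - i) / N"] le_of_int_ceiling[of "(b - i) / N"]
    unfolding of_int_add of_int_diff of_int_1 by linarith
qed

text \<open>A nonempty bounded convex set of reals lies between the open and the closed interval
  from its infimum to its supremum. Both have the same length, and each supplies one side of the
  estimate.\<close>

lemma card_congruent_ints_convex:
  fixes N i :: int and I :: "real set"
  assumes N: "N \<ge> 1" and I: "convex I" "bounded I"
  shows "\<bar>card {m. [m = i] (mod N) \<and> real_of_int m \<in> I} - measure lborel I / N\<bar> \<le> 1"
proof (cases "I = {}")
  case False
  define a b where "a = Inf I" and "b = Sup I"
  have bdd: "bdd_below I" "bdd_above I" using I(2) by (auto simp: bounded_imp_bdd_below bounded_imp_bdd_above)
  have 1: "{a<..<b} \<subseteq> I"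
  proof
    fix x assume x: "x \<in> {a<..<b}"
    obtain u where u: "u \<in> I" "u < x" using x False cInf_lessD[of I x] by (auto simp: a_def)
    obtain v where v: "v \<in> I" "x < v" using x False less_cSupD[of I x] by (auto simp: b_def)
    show "x \<in> I" using I(1) u v by (meson is_interval_convex_1 mem_is_interval_1_I less_imp_le)
  qed
  have 2: "I \<subseteq> {a..b}" using bdd by (auto simp: a_def b_def intro: cInf_lower cSup_upper)
  have ab: "a \<le> b" using False 2 by force
  have Ib: "I \<in> sets lborel" using I(1) by (simp add: real_interval_borel_measurable is_interval_convex_1)
  have fin: "emeasure lborel I < \<infinity>" using I(2) by (rule emeasure_bounded_finite)
  have m: "measure lborel I = b - a"
  proof (rule antisym)
    have "measure lborel I \<le> measure lborel {a..b}"
      using 2 Ib emeasure_bounded_finite[OF compact_imp_bounded[OF compact_Icc], of a b]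
      by (intro measure_mono_fmeasurable) (auto simp: fmeasurable_def)
    thus "measure lborel I \<le> b - a" using ab by simp
    have "measure lborel {a<..<b} \<le> measure lborel I"
      using 1 Ib fin by (intro measure_mono_fmeasurable) (auto simp: fmeasurable_def)
    thus "b - a \<le> measure lborel I" using ab by simp
  qed
  note c = card_congruent_ints[OF N]
  have finI: "finite {m. [m = i] (mod N) \<and> real_of_int m \<in> I}"
    by (rule finite_subset[OF _ c(1)[of i a b]]) (use 2 in auto)
  have "card {m. [m = i] (mod N) \<and> real_of_int m \<in> I} \<le> card {m. [m = i] (mod N) \<and> a \<le> real_of_int m \<and> real_of_int m \<le> b}"
    by (intro card_mono c) (use 2 in auto)
  moreover have "card {m. [m = i] (mod N) \<and> a < real_of_int m \<and> real_of_int m < b} \<le> card {m. [m = i] (mod N) \<and> real_of_int m \<in> I}"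
    by (intro card_mono finI) (use 1 in auto)
  ultimately show ?thesis using c(2)[OF ab, of i] c(3)[where a=a and b=b and i=i] unfolding m by linarith
qed auto

text \<open>The number of lattice points is compared with the area by summing over horizontal
  lines and then exchanging sum and integral, so that vertical slices are counted as well.\<close>

lemma lattice_point_count:
  fixes S :: "(real \<times> real) set" and N i j :: int
  assumes N: "N \<ge> 1" and meas: "S \<in> sets borel"
    and B: "\<And>x y. (x, y) \<in> S \<Longrightarrow> \<bar>x\<bar> \<le> B \<and> \<bar>y\<bar> \<le> B" "B \<ge> 0"
    and hor: "\<And>y. convex {x. (x, y) \<in> S}" and ver: "\<And>x. convex {y. (x, y) \<in> S}"
  shows "\<bar>card {(m, n). [m = i] (mod N) \<and> [n = j] (mod N) \<and> (real_of_int m, real_of_int n) \<in> S}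
            - measure lborel S / N\<^sup>2\<bar> \<le> 4 * B + 1"
    and "finite {(m, n). [m = i] (mod N) \<and> [n = j] (mod N) \<and> (real_of_int m, real_of_int n) \<in> S}"
proof -
  define Y where "Y = {n. [n = j] (mod N) \<and> -B \<le> real_of_int n \<and> real_of_int n \<le> B}"
  have finY: "finite Y" unfolding Y_def by (rule card_congruent_ints[OF N])
  have N1: "real_of_int N \<ge> 1" using N by simp
  have cardY: "card Y \<le> 2 * B / N + 1"
    using card_congruent_ints(2)[OF N, of "-B" B j] B(2) by (simp add: Y_def)
  have "2 * B / N \<le> 2 * B / 1" using N1 B(2) by (intro divide_left_mono) auto
  with cardY have cardY': "card Y \<le> 2 * B + 1" by simp
  define H where "H y = {x. (x, y) \<in> S}" for y
  define V where "V x = {y. (x, y) \<in> S}" for x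
  have bdH: "bounded (H y)" for y
    using B(1) by (auto simp: H_def bounded_iff intro!: exI[of _ B])
  have bdV: "bounded (V x)" for x
    using B(1) by (auto simp: V_def bounded_iff intro!: exI[of _ B])
  have mS: "S \<in> sets (lborel \<Otimes>\<^sub>M lborel)" unfolding lborel_prod using meas by simp
  have mH: "H y \<in> sets lborel" for y
    using sets_Pair2[OF mS, of y] by (simp add: vimage_def H_def)
  have mV: "V x \<in> sets lborel" for x
    using sets_Pair1[OF mS, of x] by (simp add: vimage_def V_def)
  have fS: "emeasure (lborel \<Otimes>\<^sub>M lborel) S < \<infinity>"
  proof -
    have "bounded S"
      by (rule bounded_subset[of "{-B..B} \<times> {-B..B}"]) (use B(1) in \<open>force intro!: bounded_Times\<close>)+
    thus ?thesis unfolding lborel_prod by (rule emeasure_bounded_finite)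
  qed
  let ?card = "card {(m, n). [m = i] (mod N) \<and> [n = j] (mod N) \<and> (real_of_int m, real_of_int n) \<in> S}"
  have eq: "{(m, n). [m = i] (mod N) \<and> [n = j] (mod N) \<and> (real_of_int m, real_of_int n) \<in> S} =
     (\<lambda>(n,m). (m,n)) ` (SIGMA n:Y. {m. [m = i] (mod N) \<and> real_of_int m \<in> H (real_of_int n)})"
    using B(1) by (force simp: Y_def H_def image_iff)
  have finH: "finite {m. [m = i] (mod N) \<and> real_of_int m \<in> H y}" for y
    by (rule finite_subset[OF _ card_congruent_ints(1)[OF N, of i "-B" B]]) (use B(1) in \<open>force simp: H_def\<close>)
  show "finite {(m, n). [m = i] (mod N) \<and> [n = j] (mod N) \<and> (real_of_int m, real_of_int n) \<in> S}"
    unfolding eq using finY finH by auto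
  have "?card = card (SIGMA n:Y. {m. [m = i] (mod N) \<and> real_of_int m \<in> H (real_of_int n)})"
    unfolding eq by (rule card_image) (auto simp: inj_on_def)
  also have "\<dots> = (\<Sum>n\<in>Y. card {m. [m = i] (mod N) \<and> real_of_int m \<in> H (real_of_int n)})"
    using finY finH by (subst card_SigmaI) auto
  finally have card: "real ?card = (\<Sum>n\<in>Y. real (card {m. [m = i] (mod N) \<and> real_of_int m \<in> H (real_of_int n)}))" by simp
  \<comment> \<open>\<open>T\<close> mediates between points and area: it is the total length of the
    horizontal slices at the admissible heights. The number of points is close to
    \<open>T / N\<close>, and \<open>T\<close> is close to the area divided by
    \<open>N\<close>.\<close>
  define T where "T = (\<Sum>n\<in>Y. measure lborel (H (real_of_int n)))"
  have "\<bar>real ?card - T / N\<bar> = \<bar>\<Sum>n\<in>Y. card {m. [m = i] (mod N) \<and> real_of_int m \<in> H (real_of_int n)} - measure lborel (H (real_of_int n)) / N\<bar>"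
    by (simp add: card T_def sum_subtractf sum_divide_distrib)
  also have "\<dots> \<le> (\<Sum>n\<in>Y. \<bar>card {m. [m = i] (mod N) \<and> real_of_int m \<in> H (real_of_int n)} - measure lborel (H (real_of_int n)) / N\<bar>)"
    by (rule sum_abs)
  also have "\<dots> \<le> (\<Sum>n\<in>Y. 1)"
    by (intro sum_mono card_congruent_ints_convex N bdH) (use hor in \<open>simp add: H_def\<close>)
  also have "\<dots> \<le> 2 * B + 1" using cardY' by simp
  finally have step1: "\<bar>real ?card - T / N\<bar> \<le> 2 * B + 1" .
  have intS: "integrable (lborel \<Otimes>\<^sub>M lborel) (indicator S :: _ \<Rightarrow> real)"
    using mS fS by (rule integrable_real_indicator)
  have indV: "(\<integral>y. indicator S (x, y) \<partial>lborel) = measure lborel (V x)" for x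
  proof -
    have "(\<lambda>y. indicator S (x, y) :: real) = indicator (V x)" by (auto simp: V_def indicator_def)
    thus ?thesis using mV[of x] by simp
  qed
  have area: "measure lborel S = (\<integral>x. measure lborel (V x) \<partial>lborel)"
  proof -
    have "measure (lborel \<Otimes>\<^sub>M lborel) S = integral\<^sup>L (lborel \<Otimes>\<^sub>M lborel) (indicator S)"
      using mS by simp
    also have "\<dots> = (\<integral>x. (\<integral>y. indicator S (x, y) \<partial>lborel) \<partial>lborel)"
      by (rule lborel_pair.integral_fst'[OF intS, symmetric])
    finally show ?thesis unfolding indV lborel_prod .
  qed
  have intV: "integrable lborel (\<lambda>x. measure lborel (V x))"
    using lborel_pair.integrable_fst'[OF intS] unfolding indV .
  define cnt where "cnt x = real (card {n. [n = j] (mod N) \<and> real_of_int n \<in> V x})" for x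
  have cnt: "cnt x = (\<Sum>n\<in>Y. indicator (H (real_of_int n)) x)" for x
  proof -
    have "{n. [n = j] (mod N) \<and> real_of_int n \<in> V x} = {n\<in>Y. x \<in> H (real_of_int n)}"
      using B(1) by (force simp: Y_def V_def H_def)
    hence "cnt x = real (card {n\<in>Y. x \<in> H (real_of_int n)})" by (simp add: cnt_def)
    also have "\<dots> = (\<Sum>n\<in>Y. indicator (H (real_of_int n)) x)"
      using finY by (simp add: indicator_def sum.If_cases Int_def)
    finally show ?thesis .
  qed
  have intH: "integrable lborel (indicator (H y) :: _ \<Rightarrow> real)" for y
    using mH bdH by (intro integrable_real_indicator emeasure_bounded_finite)
  have T: "T = (\<integral>x. cnt x \<partial>lborel)"
    unfolding cnt T_def using intH mH by (subst Bochner_Integration.integral_sum) auto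
  have int_cnt: "integrable lborel cnt" unfolding cnt using intH by (intro Bochner_Integration.integrable_sum)
  have "\<bar>T - measure lborel S / N\<bar> = \<bar>\<integral>x. cnt x - measure lborel (V x) / N \<partial>lborel\<bar>"
    unfolding T area using int_cnt intV by simp
  also have "\<dots> \<le> (\<integral>x. \<bar>cnt x - measure lborel (V x) / N\<bar> \<partial>lborel)"
    by (rule integral_abs_bound)
  \<comment> \<open>Inside \<open>{-B..B}\<close> the one-dimensional estimate has error at most 1;
    outside, the vertical slice and its count both vanish.\<close>
  also have "\<dots> \<le> (\<integral>x. indicator {-B..B} x \<partial>lborel)"
  proof (rule integral_mono)
    show "integrable lborel (\<lambda>x. \<bar>cnt x - measure lborel (V x) / N\<bar>)"
      using int_cnt intV by auto
    show "integrable lborel (indicator {-B..B} :: real \<Rightarrow> real)" 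
      using emeasure_bounded_finite[OF compact_imp_bounded[OF compact_Icc], of "-B" B]
      by (intro integrable_real_indicator) auto
    fix x
    show "\<bar>cnt x - measure lborel (V x) / N\<bar> \<le> indicator {-B..B} x"
    proof (cases "x \<in> {-B..B}")
      case True
      thus ?thesis using card_congruent_ints_convex[OF N _ bdV, of x j] ver[of x] by (simp add: cnt_def V_def)
    next
      case False
      hence "V x = {}" using B(1) by (force simp: V_def)
      thus ?thesis using False by (simp add: cnt_def)
    qed
  qed
  also have "\<dots> = 2 * B" using B(2) by simp
  finally have step2: "\<bar>T - measure lborel S / N\<bar> \<le> 2 * B" .
  have "T / N - measure lborel S / N\<^sup>2 = (T - measure lborel S / N) / N"
    using N1 by (simp add: power2_eq_square field_simps)
  hence "\<bar>T / N - measure lborel S / N\<^sup>2\<bar> = \<bar>T - measure lborel S / N\<bar> / N"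
    using N1 by (simp add: abs_divide)
  also have "\<dots> \<le> \<bar>T - measure lborel S / N\<bar> / 1" using N1 by (intro divide_left_mono) auto
  finally have step3: "\<bar>T / N - measure lborel S / N\<^sup>2\<bar> \<le> 2 * B" using step2 by simp
  have tri: "\<bar>u - w\<bar> \<le> p + q" if "\<bar>u - v\<bar> \<le> p" "\<bar>v - w\<bar> \<le> q" for u v w p q :: real
    using that by linarith
  show "\<bar>real ?card - measure lborel S / N\<^sup>2\<bar> \<le> 4 * B + 1"
    using tri[OF step1 step3] by (simp add: add_ac)
qed

lemma measure_lborel_scaled:
  fixes S :: "(real \<times> real) set"
  assumes "S \<in> sets borel" "t > 0"
  shows "{(x, y). (x / t, y / t) \<in> S} \<in> sets borel"
    and "measure lborel {(x, y). (x / t, y / t) \<in> S} = t\<^sup>2 * measure lborel S"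
proof -
  have eq: "{(x, y). (x / t, y / t) \<in> S} = (\<lambda>p. t *\<^sub>R p + 0) ` S"
  proof safe
    fix x y assume "(x / t, y / t) \<in> S"
    thus "(x, y) \<in> (\<lambda>p. t *\<^sub>R p + 0) ` S" using assms(2) by (intro image_eqI[of _ _ "(x / t, y / t)"]) auto
  qed (use assms(2) in auto)
  have "(\<lambda>(x,y). (x / t, y / t)) -` S \<inter> space borel \<in> sets (borel :: (real \<times> real) measure)"
    by (rule measurable_sets[OF _ assms(1)]) (intro borel_measurable_continuous_onI continuous_intros, auto simp: case_prod_beta divide_inverse intro!: continuous_intros)
  thus b: "{(x, y). (x / t, y / t) \<in> S} \<in> sets borel" by (simp add: vimage_def case_prod_unfold)
  have "measure lebesgue ((\<lambda>p. t *\<^sub>R p + 0) ` S) = \<bar>t\<bar> ^ DIM(real \<times> real) * measure lebesgue S"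
    by (rule measure_lebesgue_affine)
  moreover have "measure lebesgue ((\<lambda>p. t *\<^sub>R p + 0) ` S) = measure lborel ((\<lambda>p. t *\<^sub>R p + 0) ` S)"
    using b unfolding eq by (intro measure_completion) simp
  moreover have "measure lebesgue S = measure lborel S"
    using assms by (intro measure_completion) simp
  ultimately show "measure lborel {(x, y). (x / t, y / t) \<in> S} = t\<^sup>2 * measure lborel S"
    unfolding eq by (simp add: power2_eq_square)
qed

lemma lattice_point_count_scaled:
  fixes S :: "(real \<times> real) set" and N i j :: int
  assumes N: "N \<ge> 1" and meas: "S \<in> sets borel"
    and B: "\<And>x y. (x, y) \<in> S \<Longrightarrow> \<bar>x\<bar> \<le> B \<and> \<bar>y\<bar> \<le> B" "B \<ge> 0"
    and hor: "\<And>y. convex {x. (x, y) \<in> S}" and ver: "\<And>x. convex {y. (x, y) \<in> S}"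
    and t: "t > 0"
  shows "\<bar>card {(m, n). [m = i] (mod N) \<and> [n = j] (mod N) \<and> (real_of_int m / t, real_of_int n / t) \<in> S}
            - measure lborel S / N\<^sup>2 * t\<^sup>2\<bar> \<le> 4 * B * t + 1"
    and "finite {(m, n). [m = i] (mod N) \<and> [n = j] (mod N) \<and> (real_of_int m / t, real_of_int n / t) \<in> S}"
proof -
  let ?S = "{(x, y). (x / t, y / t) \<in> S}"
  have cv: "convex {x. x / t \<in> A}" if "convex A" for A
  proof -
    have "{x. x / t \<in> A} = (\<lambda>x. t * x) ` A" using t by (auto simp: image_iff field_simps intro!: bexI[of _ "_ / t"])
    thus ?thesis using convex_scaling[OF that, of t] by simp
  qed
  have "(x, y) \<in> ?S \<Longrightarrow> \<bar>x\<bar> \<le> B * t \<and> \<bar>y\<bar> \<le> B * t" for x y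
    using B(1)[of "x / t" "y / t"] t by (auto simp: field_simps)
  moreover have "convex {x. (x, y) \<in> ?S}" for y using cv[OF hor[of "y / t"]] by simp
  moreover have "convex {y. (x, y) \<in> ?S}" for x using cv[OF ver[of "x / t"]] by simp
  ultimately have *: "\<bar>card {(m, n). [m = i] (mod N) \<and> [n = j] (mod N) \<and> (real_of_int m, real_of_int n) \<in> ?S}
            - measure lborel ?S / N\<^sup>2\<bar> \<le> 4 * (B * t) + 1 \<and>
     finite {(m, n). [m = i] (mod N) \<and> [n = j] (mod N) \<and> (real_of_int m, real_of_int n) \<in> ?S}"
    using lattice_point_count[OF N measure_lborel_scaled(1)[OF meas t], of "B * t" i j] B(2) t by auto
  show "\<bar>card {(m, n). [m = i] (mod N) \<and> [n = j] (mod N) \<and> (real_of_int m / t, real_of_int n / t) \<in> S}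
            - measure lborel S / N\<^sup>2 * t\<^sup>2\<bar> \<le> 4 * B * t + 1"
    using * unfolding measure_lborel_scaled(2)[OF meas t] by (simp add: mult_ac)
  show "finite {(m, n). [m = i] (mod N) \<and> [n = j] (mod N) \<and> (real_of_int m / t, real_of_int n / t) \<in> S}"
    using * by simp
qed

section \<open>The Moebius function\<close>

definition moebius_mu :: "nat \<Rightarrow> real" where
  "moebius_mu n = (if squarefree n then (-1) ^ card (prime_factors n) else 0)"

lemma abs_moebius_le: "\<bar>moebius_mu n\<bar> \<le> 1"
  by (simp add: moebius_mu_def)

lemma moebius_prime_mult:
  assumes "prime p" "d > 0"
  shows "moebius_mu (p * d) = (if p dvd d then 0 else - moebius_mu d)"
proof (cases "p dvd d")
  case True
  hence "p\<^sup>2 dvd p * d" by (simp add: power2_eq_square)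
  hence "\<not> squarefree (p * d)" using assms by (intro not_squarefreeI[of p]) (auto dest: not_prime_unit)
  thus ?thesis using True by (simp add: moebius_mu_def)
next
  case False
  hence cop: "coprime p d" using assms by (simp add: prime_imp_coprime)
  have "squarefree (p * d) \<longleftrightarrow> squarefree d"
    using cop assms squarefree_mult_coprime[OF cop] squarefree_multD(2) squarefree_prime by blast
  moreover have "prime_factors (p * d) = insert p (prime_factors d)"
    using assms by (simp add: prime_factors_product prime_factorization_prime)
  moreover have "p \<notin> prime_factors d" using False by auto
  ultimately show ?thesis using False by (simp add: moebius_mu_def)
qed

text \<open>For a prime \<open>p\<close> dividing \<open>n\<close>, the divisors \<open>e\<close>
  prime to \<open>p\<close> cancel against their multiples \<open>p * e\<close>, and divisors
  divisible by the square of \<open>p\<close> contribute 0.\<close>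

lemma sum_moebius_divisors:
  assumes "n > 0"
  shows "(\<Sum>d | d dvd n. moebius_mu d) = (if n = 1 then 1 else 0)"
proof (cases "n = 1")
  case False
  then obtain p where p: "prime p" "p dvd n" using prime_factor_nat by blast
  have fin: "finite {d. d dvd n}" using assms by simp
  have "(\<Sum>d | d dvd n. moebius_mu d) = (\<Sum>d | d dvd n \<and> \<not> p dvd d. moebius_mu d) + (\<Sum>d | d dvd n \<and> p dvd d. moebius_mu d)"
    using fin by (subst sum.union_disjoint[symmetric]) (auto intro!: sum.cong)
  also have "(\<Sum>d | d dvd n \<and> p dvd d. moebius_mu d) = (\<Sum>e | p * e dvd n. moebius_mu (p * e))"
    by (rule sum.reindex_bij_witness[of _ "\<lambda>e. p * e" "\<lambda>d. d div p"]) (use p in auto)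
  also have "\<dots> = (\<Sum>e | p * e dvd n \<and> \<not> p dvd e. - moebius_mu e)"
  proof (rule sum.mono_neutral_cong_right)
    have "{e. p * e dvd n} \<subseteq> {e. e dvd n}" by (auto dest: dvd_mult_right)
    thus "finite {e. p * e dvd n}" using fin finite_subset by blast
    have pos: "e > 0" if "p * e dvd n" for e using that assms by (intro Nat.gr0I) auto
    show "\<forall>e\<in>{e. p * e dvd n} - {e. p * e dvd n \<and> \<not> p dvd e}. moebius_mu (p * e) = 0"
      using pos p by (auto simp: moebius_prime_mult)
    show "moebius_mu (p * e) = - moebius_mu e" if "e \<in> {e. p * e dvd n \<and> \<not> p dvd e}" for e
      using that pos p by (auto simp: moebius_prime_mult)
  qed auto
  also have "{e. p * e dvd n \<and> \<not> p dvd e} = {e. e dvd n \<and> \<not> p dvd e}"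
    using p by (auto dest: dvd_mult_right intro!: divides_mult simp: prime_imp_coprime)
  finally show ?thesis using False by (simp add: sum_negf)
qed (simp add: moebius_mu_def)

section \<open>Sequences of linear growth from regions in the plane\<close>

text \<open>Exponents above 1 follow from the exponent 1 because \<open>x \<ge> 1\<close>.\<close>

lemma linear_growthI:
  assumes "\<And>\<theta>. 1/2 < \<theta> \<Longrightarrow> \<theta> \<le> 1 \<Longrightarrow> \<exists>K. \<forall>x\<ge>1. \<bar>summatory a x - C * x\<bar> \<le> K * x powr \<theta>"
  shows "linear_growth a C"
  unfolding linear_growth_def
proof (intro allI impI)
  fix \<theta> :: real assume \<theta>: "\<theta> > 1/2"
  obtain K where K: "\<And>x. x \<ge> 1 \<Longrightarrow> \<bar>summatory a x - C * x\<bar> \<le> K * x powr (min \<theta> 1)"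
    using assms[of "min \<theta> 1"] \<theta> by auto
  have "\<bar>summatory a x - C * x\<bar> \<le> \<bar>K\<bar> * x powr \<theta>" if "x \<ge> 1" for x
  proof -
    have "K * x powr (min \<theta> 1) \<le> \<bar>K\<bar> * x powr \<theta>"
      using that by (intro mult_mono powr_mono) auto
    thus ?thesis using K[OF that] by linarith
  qed
  thus "\<exists>K. \<forall>x\<ge>1. \<bar>summatory a x - C * x\<bar> \<le> K * x powr \<theta>" by blast
qed

lemma linear_growth_zero: "linear_growth (\<lambda>_. 0) 0"
  unfolding linear_growth_def by (auto simp: summatory_def intro!: exI[of _ 0])

lemma linear_growth_cmult:
  assumes "linear_growth a C"
  shows "linear_growth (\<lambda>n. c * a n) (c * C)"
  unfolding linear_growth_def
proof (intro allI impI)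
  fix \<theta> :: real assume \<theta>: "\<theta> > 1/2"
  obtain K where K: "\<And>x. x \<ge> 1 \<Longrightarrow> \<bar>summatory a x - C * x\<bar> \<le> K * x powr \<theta>"
    using linear_growthE[OF assms \<theta>] by blast
  have "\<bar>summatory (\<lambda>n. c * a n) x - c * C * x\<bar> \<le> (\<bar>c\<bar> * K) * x powr \<theta>" if "x \<ge> 1" for x
  proof -
    have "summatory (\<lambda>n. c * a n) x - c * C * x = c * (summatory a x - C * x)"
      by (simp add: summatory_def sum_distrib_left right_diff_distrib mult.assoc)
    also have "\<bar>\<dots>\<bar> \<le> \<bar>c\<bar> * (K * x powr \<theta>)" unfolding abs_mult by (intro mult_left_mono K that) auto
    finally show ?thesis by (simp add: mult.assoc)
  qed
  thus "\<exists>K. \<forall>x\<ge>1. \<bar>summatory (\<lambda>n. c * a n) x - c * C * x\<bar> \<le> K * x powr \<theta>" by blast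
qed

lemma linear_growth_add:
  assumes "linear_growth a C" "linear_growth b D"
  shows "linear_growth (\<lambda>n. a n + b n) (C + D)"
  unfolding linear_growth_def
proof (intro allI impI)
  fix \<theta> :: real assume \<theta>: "\<theta> > 1/2"
  obtain K where K: "\<And>x. x \<ge> 1 \<Longrightarrow> \<bar>summatory a x - C * x\<bar> \<le> K * x powr \<theta>"
    using linear_growthE[OF assms(1) \<theta>] by blast
  obtain K' where K': "\<And>x. x \<ge> 1 \<Longrightarrow> \<bar>summatory b x - D * x\<bar> \<le> K' * x powr \<theta>"
    using linear_growthE[OF assms(2) \<theta>] by blast
  have "\<bar>summatory (\<lambda>n. a n + b n) x - (C + D) * x\<bar> \<le> (K + K') * x powr \<theta>" if "x \<ge> 1" for x
    using K[OF that] K'[OF that] by (simp add: summatory_def sum.distrib distrib_right)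
  thus "\<exists>K. \<forall>x\<ge>1. \<bar>summatory (\<lambda>n. a n + b n) x - (C + D) * x\<bar> \<le> K * x powr \<theta>" by blast
qed

lemma linear_growth_sum:
  assumes "finite I" "\<And>i. i \<in> I \<Longrightarrow> linear_growth (a i) (C i)"
  shows "linear_growth (\<lambda>n. \<Sum>i\<in>I. a i n) (\<Sum>i\<in>I. C i)"
  using assms by (induction I rule: finite_induct) (auto intro: linear_growth_zero linear_growth_add)

lemma summatory_card:
  fixes f :: "'a \<Rightarrow> nat"
  assumes fin: "finite {p \<in> A. 1 \<le> f p \<and> real (f p) \<le> x}" and x: "x \<ge> 0"
  shows "summatory (\<lambda>n. real (card {p \<in> A. f p = n})) x = card {p \<in> A. 1 \<le> f p \<and> real (f p) \<le> x}"
proof -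
  have "{p \<in> A. 1 \<le> f p \<and> real (f p) \<le> x} = (\<Union>n\<in>{1..nat \<lfloor>x\<rfloor>}. {p \<in> A. f p = n})" (is "?L = ?R")
    using x by (auto simp: le_nat_iff le_floor_iff)
  moreover have "card ?R = (\<Sum>n\<in>{1..nat \<lfloor>x\<rfloor>}. card {p \<in> A. f p = n})"
  proof (rule card_UN_disjoint)
    show "\<forall>n\<in>{1..nat \<lfloor>x\<rfloor>}. finite {p \<in> A. f p = n}"
      by (intro ballI finite_subset[OF _ fin]) (use x in \<open>auto simp: le_nat_iff le_floor_iff\<close>)
  qed auto
  ultimately show ?thesis by (simp add: summatory_def)
qed

lemma measure_lborel_pos:
  fixes S :: "(real \<times> real) set"
  assumes "S \<in> sets borel" "bounded S" "open U" "U \<subseteq> S" "U \<noteq> {}"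
  shows "measure lborel S > 0"
proof (rule ccontr)
  assume "\<not> measure lborel S > 0"
  hence "measure lborel S = 0" using measure_nonneg[of lborel S] by linarith
  hence "emeasure lborel S = 0"
    using emeasure_bounded_finite[OF assms(2)] by (auto simp: measure_def enn2real_eq_0_iff)
  hence "S \<in> null_sets lborel" using assms(1) by (intro null_setsI) auto
  hence "negligible S" by (simp add: negligible_iff_null_sets null_sets_completionI)
  hence "negligible U" using assms(4) negligible_subset by blast
  thus False using open_not_negligible[OF assms(3,5)] by blast
qed

text \<open>The hypothesis linking \<open>S\<close> and \<open>f\<close> expresses that
  \<open>f\<close> is homogeneous of degree 2 and that \<open>S\<close> is its sublevel set at 1.
  The points with \<open>f \<le> x\<close> are then those of \<open>S\<close> enlarged by
  \<open>sqrt x\<close>, whose area grows like \<open>x\<close> and whose diameter grows like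
  \<open>sqrt x\<close>.\<close>

lemma linear_growth_region:
  fixes S :: "(real \<times> real) set" and N i j :: int and f :: "int \<times> int \<Rightarrow> nat"
  assumes N: "N \<ge> 1" and meas: "S \<in> sets borel"
    and B: "\<And>x y. (x, y) \<in> S \<Longrightarrow> \<bar>x\<bar> \<le> B \<and> \<bar>y\<bar> \<le> B" "B \<ge> 0"
    and hor: "\<And>y. convex {x. (x, y) \<in> S}" and ver: "\<And>x. convex {y. (x, y) \<in> S}"
    and S: "\<And>t m n. t > 0 \<Longrightarrow> (real_of_int m / t, real_of_int n / t) \<in> S \<longleftrightarrow> (m, n) \<in> A \<and> real (f (m, n)) \<le> t\<^sup>2"
    and f: "\<And>p. p \<in> A \<Longrightarrow> f p \<ge> 1"
  shows "linear_growth (\<lambda>n. real (card {p. [fst p = i] (mod N) \<and> [snd p = j] (mod N) \<and> p \<in> A \<and> f p = n})) (measure lborel S / N\<^sup>2)"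
proof (rule linear_growthI)
  fix \<theta> :: real assume \<theta>: "1/2 < \<theta>" "\<theta> \<le> 1"
  define A' where "A' = {p. [fst p = i] (mod N) \<and> [snd p = j] (mod N) \<and> p \<in> A}"
  have "\<bar>summatory (\<lambda>n. real (card {p \<in> A'. f p = n})) x - measure lborel S / N\<^sup>2 * x\<bar> \<le> (4 * B + 1) * x powr \<theta>"
    if x: "x \<ge> 1" for x
  proof -
    have t: "sqrt x > 0" "(sqrt x)\<^sup>2 = x" "sqrt x \<ge> 1" using x by auto
    have eq: "{p \<in> A'. 1 \<le> f p \<and> real (f p) \<le> x} =
      {(m, n). [m = i] (mod N) \<and> [n = j] (mod N) \<and> (real_of_int m / sqrt x, real_of_int n / sqrt x) \<in> S}"
      unfolding S[OF t(1)] t(2) A'_def using f by auto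
    note c = lattice_point_count_scaled[OF N meas B hor ver t(1), of i j]
    have "summatory (\<lambda>n. real (card {p \<in> A'. f p = n})) x = card {p \<in> A'. 1 \<le> f p \<and> real (f p) \<le> x}"
      using c(2) x by (intro summatory_card) (simp_all only: eq)
    hence "\<bar>summatory (\<lambda>n. real (card {p \<in> A'. f p = n})) x - measure lborel S / N\<^sup>2 * x\<bar> \<le> 4 * B * sqrt x + 1"
      using c(1) unfolding eq t(2) by simp
    also have "\<dots> \<le> (4 * B + 1) * sqrt x" using t(3) by (simp add: distrib_right)
    also have "\<dots> \<le> (4 * B + 1) * x powr \<theta>"
      using x \<theta> B(2) unfolding powr_half_sqrt[symmetric, OF order_trans[OF zero_le_one x]]
      by (intro mult_left_mono powr_mono) auto
    finally show ?thesis .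
  qed
  thus "\<exists>K. \<forall>x\<ge>1. \<bar>summatory (\<lambda>n. real (card {p. [fst p = i] (mod N) \<and> [snd p = j] (mod N) \<and> p \<in> A \<and> f p = n})) x
       - measure lborel S / N\<^sup>2 * x\<bar> \<le> K * x powr \<theta>"
    by (intro exI[of _ "4 * B + 1"]) (simp add: A'_def conj_assoc)
qed

text \<open>The strict version removes the two boundary rays. They will carry the hexagonal
  lattices, which have a different weight.\<close>

definition sector :: "bool \<Rightarrow> real \<Rightarrow> real \<Rightarrow> (real \<times> real) set" where
  "sector strict r r' = {(x, y). 0 < x \<and> 0 < y \<and> x \<le> r * y \<and> y \<le> r' * x \<and>
      (strict \<longrightarrow> x < r * y \<and> y < r' * x)}"

text \<open>The sector stays away from both axes and so cuts off the cusps of the region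
  \<open>x * y \<le> 1\<close>. What remains is bounded, and the growth is linear instead of the
  \<open>x * ln x\<close> of the divisor problem. The condition \<open>r * r' > 1\<close> makes the
  interior nonempty.\<close>

lemma linear_growth_sector:
  fixes i j :: int
  assumes r: "r > 0" "r' > 0"
  shows "\<exists>C\<ge>0. (\<not> strict \<longrightarrow> r * r' > 1 \<longrightarrow> C > 0) \<and>
    linear_growth (\<lambda>n. real (card {p. [fst p = i] (mod 2) \<and> [snd p = j] (mod 2) \<and>
      (real_of_int (fst p), real_of_int (snd p)) \<in> sector strict r r' \<and> nat (fst p * snd p) = n})) C"
proof -
  define S where "S = sector strict r r' \<inter> {(x, y). x * y \<le> 1}"
  have S_eq: "S = {p. 0 < fst p \<and> 0 < snd p \<and> fst p \<le> r * snd p \<and> snd p \<le> r' * fst p \<and>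
      (strict \<longrightarrow> fst p < r * snd p \<and> snd p < r' * fst p) \<and> fst p * snd p \<le> 1}"
    by (auto simp: S_def sector_def)
  have "{p \<in> space (borel \<Otimes>\<^sub>M borel). 0 < fst p \<and> 0 < snd p \<and> fst p \<le> r * snd p \<and> snd p \<le> r' * fst p \<and>
      (strict \<longrightarrow> fst p < r * snd p \<and> snd p < r' * fst p) \<and> fst p * snd p \<le> 1} \<in> sets (borel \<Otimes>\<^sub>M borel)"
    by measurable
  hence meas: "S \<in> sets borel" by (simp add: S_eq space_pair_measure flip: borel_prod)
  \<comment> \<open>In the sector \<open>x * x \<le> r * (x * y) \<le> r\<close>, which is at most
    the square of \<open>1 + r\<close>; the coordinate \<open>y\<close> is treated likewise with
    \<open>r'\<close>.\<close>
  define B where "B = 1 + r + r'"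
  have sq: "s \<le> (1 + s)\<^sup>2" if "s > 0" for s :: real
    using that mult_pos_pos[OF that that] by (simp add: power2_eq_square algebra_simps)
  have B: "\<bar>x\<bar> \<le> B \<and> \<bar>y\<bar> \<le> B" if "(x, y) \<in> S" for x y
  proof -
    have xy: "0 < x" "0 < y" "x \<le> r * y" "y \<le> r' * x" "x * y \<le> 1" using that by (auto simp: S_def sector_def)
    have "x * x \<le> r * y * x" using xy by (intro mult_right_mono) auto
    also have "\<dots> = r * (x * y)" by simp
    also have "\<dots> \<le> r * 1" using xy r by (intro mult_left_mono) auto
    finally have "x\<^sup>2 \<le> (1 + r)\<^sup>2" using sq[OF r(1)] by (simp add: power2_eq_square)
    hence 1: "x \<le> 1 + r" by (rule power2_le_imp_le) (use r in simp)
    have "y * y \<le> r' * x * y" using xy by (intro mult_right_mono) auto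
    also have "\<dots> = r' * (x * y)" by simp
    also have "\<dots> \<le> r' * 1" using xy r by (intro mult_left_mono) auto
    finally have "y\<^sup>2 \<le> (1 + r')\<^sup>2" using sq[OF r(2)] by (simp add: power2_eq_square)
    hence "y \<le> 1 + r'" by (rule power2_le_imp_le) (use r in simp)
    with 1 xy r show ?thesis by (simp add: B_def)
  qed
  have hor: "convex {x. (x, y) \<in> S}" for y
    unfolding is_interval_convex_1[symmetric] is_interval_1
  proof (intro ballI allI impI, elim conjE)
    fix a b x assume ab: "a \<in> {x. (x, y) \<in> S}" "b \<in> {x. (x, y) \<in> S}" and x: "a \<le> x" "x \<le> b"
    have "x * y \<le> b * y" using ab x by (intro mult_right_mono) (auto simp: S_def sector_def)
    also have "\<dots> \<le> 1" using ab by (auto simp: S_def)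
    finally have "x * y \<le> 1" .
    moreover have "r' * a \<le> r' * x" using r x by (intro mult_left_mono) auto
    ultimately show "x \<in> {x. (x, y) \<in> S}" using ab x by (auto simp: S_def sector_def)
  qed
  have ver: "convex {y. (x, y) \<in> S}" for x
    unfolding is_interval_convex_1[symmetric] is_interval_1
  proof (intro ballI allI impI, elim conjE)
    fix a b y assume ab: "a \<in> {y. (x, y) \<in> S}" "b \<in> {y. (x, y) \<in> S}" and y: "a \<le> y" "y \<le> b"
    have "x * y \<le> x * b" using ab y by (intro mult_left_mono) (auto simp: S_def sector_def)
    also have "\<dots> \<le> 1" using ab by (auto simp: S_def)
    finally have "x * y \<le> 1" .
    moreover have "r * a \<le> r * y" using r y by (intro mult_left_mono) auto
    ultimately show "y \<in> {y. (x, y) \<in> S}" using ab y by (auto simp: S_def sector_def)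
  qed
  define A where "A = {p. (real_of_int (fst p), real_of_int (snd p)) \<in> sector strict r r'}"
  have pos: "1 \<le> fst p * snd p" if "p \<in> A" for p
  proof -
    have "0 < fst p" "0 < snd p" using that by (auto simp: A_def sector_def)
    hence "0 < fst p * snd p" by simp
    thus ?thesis by linarith
  qed
  have "linear_growth (\<lambda>n. real (card {p. [fst p = i] (mod 2) \<and> [snd p = j] (mod 2) \<and> p \<in> A \<and> nat (fst p * snd p) = n}))
     (measure lborel S / (2::int)\<^sup>2)"
  proof (rule linear_growth_region[OF _ meas B _ hor ver])
    show "B \<ge> 0" using r by (simp add: B_def)
    show "1 \<le> nat (fst p * snd p)" if "p \<in> A" for p using pos[OF that] by simp
    fix t :: real and m n :: int assume t: "t > 0"
    have "(m, n) \<in> A \<longleftrightarrow> (real_of_int m / t, real_of_int n / t) \<in> sector strict r r'"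
      using t by (auto simp: A_def sector_def field_simps)
    moreover have "real_of_int m / t * (real_of_int n / t) \<le> 1 \<longleftrightarrow> real (nat (fst (m,n) * snd (m,n))) \<le> t\<^sup>2" if "(m, n) \<in> A"
    proof -
      have "real (nat (fst (m,n) * snd (m,n))) = real_of_int m * real_of_int n"
        using pos[OF that] by simp
      thus ?thesis using t by (simp add: field_simps power2_eq_square)
    qed
    ultimately show "(real_of_int m / t, real_of_int n / t) \<in> S \<longleftrightarrow> (m, n) \<in> A \<and> real (nat (fst (m,n) * snd (m,n))) \<le> t\<^sup>2"
      by (auto simp: S_def)
  qed auto
  moreover have "measure lborel S > 0" if "\<not> strict" "r * r' > 1"
  proof (rule measure_lborel_pos[OF meas])
    show "bounded S"
      by (rule bounded_subset[of "{-B..B} \<times> {-B..B}"]) (use B in \<open>force intro!: bounded_Times\<close>)+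
    define U where "U = {p::real \<times> real. 0 < fst p \<and> 0 < snd p \<and> fst p < r * snd p \<and> snd p < r' * fst p \<and> fst p * snd p < 1}"
    show "open U" unfolding U_def
      by (intro open_Collect_conj open_Collect_less continuous_intros)
    show "U \<subseteq> S" using that by (auto simp: U_def S_eq)
    \<comment> \<open>An interior point is found on a ray of slope strictly between the two boundary
      rays, close enough to the origin to lie below the hyperbola.\<close>
    have "1 / r' < r" using that r by (simp add: field_simps)
    then obtain u where u: "1 / r' < u" "u < r" using dense by blast
    have u0: "u > 0" using u r by (meson divide_pos_pos less_trans zero_less_one)
    obtain e where e: "0 < e" "e < min 1 (1 / u)" using dense[of 0 "min 1 (1/u)"] u0 by auto
    have "(u * e) * e < 1 * 1" using e u0 by (intro mult_strict_mono) (auto simp: field_simps)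
    moreover have "e < r' * (u * e)" using u r e by (simp add: field_simps)
    moreover have "u * e < r * e" using u e by simp
    ultimately have "(u * e, e) \<in> U" using e u0 by (simp add: U_def)
    thus "U \<noteq> {}" by blast
  qed
  ultimately show ?thesis by (intro exI[of _ "measure lborel S / (2::int)\<^sup>2"]) (auto simp: A_def)
qed

section \<open>Primitive vectors of bounded norm\<close>

text \<open>The three integers are the entries of a positive definite integral Gram matrix, with
  \<open>\<beta>\<close> off the diagonal; hence the factor 2 in the mixed term of
  \<open>q\<close>.\<close>

locale pos_def_form =
  fixes \<alpha> \<beta> \<gamma> :: int
  assumes \<alpha>_pos: "\<alpha> > 0" and disc_pos: "\<alpha> * \<gamma> - \<beta>\<^sup>2 > 0"
begin

definition D :: int where "D = \<alpha> * \<gamma> - \<beta>\<^sup>2"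

definition q :: "int \<times> int \<Rightarrow> int" where
  "q v = \<alpha> * (fst v)\<^sup>2 + 2 * \<beta> * fst v * snd v + \<gamma> * (snd v)\<^sup>2"

lemma D_pos: "D > 0" using disc_pos by (simp add: D_def)

lemma \<gamma>_pos: "\<gamma> > 0"
proof -
  have "\<alpha> * \<gamma> > 0" using disc_pos zero_le_power2[of \<beta>] by linarith
  thus ?thesis using \<alpha>_pos by (simp add: zero_less_mult_iff)
qed

lemma \<alpha>_q: "\<alpha> * q v = (\<alpha> * fst v + \<beta> * snd v)\<^sup>2 + D * (snd v)\<^sup>2"
  by (simp add: q_def D_def power2_eq_square algebra_simps)

lemma q_nonneg: "q v \<ge> 0"
proof -
  have "\<alpha> * q v \<ge> 0" unfolding \<alpha>_q using D_pos by simp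
  thus ?thesis using \<alpha>_pos by (simp add: zero_le_mult_iff)
qed

lemma q_eq_0_iff: "q v = 0 \<longleftrightarrow> v = (0, 0)"
proof
  assume "q v = 0"
  hence 0: "(\<alpha> * fst v + \<beta> * snd v)\<^sup>2 + D * (snd v)\<^sup>2 = 0" using \<alpha>_q[of v] by simp
  moreover have "D * (snd v)\<^sup>2 \<ge> 0" using D_pos by simp
  ultimately have "(\<alpha> * fst v + \<beta> * snd v)\<^sup>2 = 0" "D * (snd v)\<^sup>2 = 0"
    using zero_le_power2[of "\<alpha> * fst v + \<beta> * snd v"] by linarith+
  thus "v = (0, 0)" using D_pos \<alpha>_pos by (auto simp: prod_eq_iff)
qed (simp add: q_def)

lemma q_pos: "v \<noteq> (0, 0) \<Longrightarrow> q v \<ge> 1"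
  using q_nonneg[of v] q_eq_0_iff[of v] by linarith

lemma q_scale: "q (k * x, k * y) = k\<^sup>2 * q (x, y)"
  by (simp add: q_def power2_eq_square algebra_simps)

section \<open>The ellipse of the form\<close>

definition ellipse :: "(real \<times> real) set" where
  "ellipse = {(x, y). \<alpha> * x\<^sup>2 + 2 * \<beta> * x * y + \<gamma> * y\<^sup>2 \<le> 1}"

lemma ellipse_borel: "ellipse \<in> sets borel"
proof -
  have "closed ellipse" unfolding ellipse_def case_prod_beta
    by (intro closed_Collect_le continuous_intros)
  thus ?thesis by simp
qed

text \<open>Completing the square in either variable gives
  \<open>D * y\<^sup>2 \<le> \<alpha>\<close> and \<open>D * x\<^sup>2 \<le> \<gamma>\<close>. Since
  \<open>D\<close>, \<open>\<alpha>\<close> and \<open>\<gamma>\<close> are integers and at least 1,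
  these crude bounds follow.\<close>

lemma ellipse_bound:
  assumes "(x, y) \<in> ellipse"
  shows "\<bar>x\<bar> \<le> \<alpha> + \<gamma> \<and> \<bar>y\<bar> \<le> \<alpha> + \<gamma>"
proof -
  have e: "\<alpha> * x\<^sup>2 + 2 * \<beta> * x * y + \<gamma> * y\<^sup>2 \<le> 1" using assms by (simp add: ellipse_def)
  have D1: "real_of_int D \<ge> 1" using D_pos by linarith
  have a1: "real_of_int \<alpha> \<ge> 1" "real_of_int \<gamma> \<ge> 1" using \<alpha>_pos \<gamma>_pos by linarith+
  have *: "\<bar>z\<bar> \<le> a" if "D * z\<^sup>2 \<le> a" "a \<ge> 1" for z a :: real
  proof -
    have "1 * z\<^sup>2 \<le> D * z\<^sup>2" using D1 by (intro mult_right_mono) auto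
    also have "\<dots> \<le> a" by fact
    also have "\<dots> \<le> a\<^sup>2" using that(2) by (simp add: power2_eq_square)
    finally show ?thesis using that(2) abs_le_square_iff[of z a] by simp
  qed
  have "(\<alpha> * x + \<beta> * y)\<^sup>2 + D * y\<^sup>2 = \<alpha> * (\<alpha> * x\<^sup>2 + 2 * \<beta> * x * y + \<gamma> * y\<^sup>2)"
    by (simp add: D_def power2_eq_square algebra_simps)
  also have "\<dots> \<le> real_of_int \<alpha> * (1::real)" using e a1 by (intro mult_left_mono) auto
  finally have "D * y\<^sup>2 \<le> \<alpha>" using zero_le_power2[of "\<alpha> * x + \<beta> * y"] by linarith
  from *[OF this a1(1)] have 1: "\<bar>y\<bar> \<le> \<alpha>" .
  have "(\<beta> * x + \<gamma> * y)\<^sup>2 + D * x\<^sup>2 = \<gamma> * (\<alpha> * x\<^sup>2 + 2 * \<beta> * x * y + \<gamma> * y\<^sup>2)"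
    by (simp add: D_def power2_eq_square algebra_simps)
  also have "\<dots> \<le> real_of_int \<gamma> * (1::real)" using e a1 by (intro mult_left_mono) auto
  finally have "D * x\<^sup>2 \<le> \<gamma>" using zero_le_power2[of "\<beta> * x + \<gamma> * y"] by linarith
  from *[OF this a1(2)] have "\<bar>x\<bar> \<le> \<gamma>" .
  with 1 a1 show ?thesis by linarith
qed

lemma convex_quadratic_sublevel:
  fixes a b c :: real
  assumes "a > 0"
  shows "convex {x. a * x\<^sup>2 + b * x + c \<le> 0}"
  unfolding is_interval_convex_1[symmetric] is_interval_1
proof (intro ballI allI impI, elim conjE)
  fix x w z assume x: "x \<in> {x. a * x\<^sup>2 + b * x + c \<le> 0}" and w: "w \<in> {x. a * x\<^sup>2 + b * x + c \<le> 0}"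
    and z: "x \<le> z" "z \<le> w"
  show "z \<in> {x. a * x\<^sup>2 + b * x + c \<le> 0}"
  proof (cases "x = w")
    case False
    hence xw: "w - x > 0" using z by simp
    have "(w - x) * (a * z\<^sup>2 + b * z + c) = (w - z) * (a * x\<^sup>2 + b * x + c) + (z - x) * (a * w\<^sup>2 + b * w + c)
       - a * ((w - x) * ((z - x) * (w - z)))"
      by (simp add: power2_eq_square algebra_simps)
    moreover have "(w - z) * (a * x\<^sup>2 + b * x + c) \<le> 0" "(z - x) * (a * w\<^sup>2 + b * w + c) \<le> 0"
      using x w z by (auto intro: mult_nonneg_nonpos)
    moreover have "a * ((w - x) * ((z - x) * (w - z))) \<ge> 0" using assms z xw by simp
    ultimately have "(w - x) * (a * z\<^sup>2 + b * z + c) \<le> 0" by linarith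
    thus ?thesis using xw by (simp add: mult_le_0_iff)
  qed (use x z in auto)
qed

lemma ellipse_slices: "convex {x. (x, y) \<in> ellipse}" "convex {y. (x, y) \<in> ellipse}"
proof -
  have "{x::real. (x, y) \<in> ellipse} = {x::real. \<alpha> * x\<^sup>2 + (2 * \<beta> * y) * x + (\<gamma> * y\<^sup>2 - 1) \<le> 0}"
    by (auto simp: ellipse_def algebra_simps)
  thus "convex {x. (x, y) \<in> ellipse}" using convex_quadratic_sublevel[of "real_of_int \<alpha>"] \<alpha>_pos by simp
  have "{y::real. (x, y) \<in> ellipse} = {y::real. \<gamma> * y\<^sup>2 + (2 * \<beta> * x) * y + (\<alpha> * x\<^sup>2 - 1) \<le> 0}"
    by (auto simp: ellipse_def algebra_simps)
  thus "convex {y. (x, y) \<in> ellipse}" using convex_quadratic_sublevel[of "real_of_int \<gamma>"] \<gamma>_pos by simp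
qed

lemma ellipse_area_pos: "measure lborel ellipse > 0"
proof (rule measure_lborel_pos[OF ellipse_borel])
  let ?B = "real_of_int (\<alpha> + \<gamma>)"
  show "bounded ellipse"
    by (rule bounded_subset[of "{-?B..?B} \<times> {-?B..?B}"])
      (use ellipse_bound in \<open>force intro!: bounded_Times\<close>)+
  let ?U = "{(x::real, y::real). \<alpha> * x\<^sup>2 + 2 * \<beta> * x * y + \<gamma> * y\<^sup>2 < 1}"
  show "open ?U" unfolding case_prod_beta
    by (intro open_Collect_less continuous_intros)
  show "?U \<subseteq> ellipse" by (auto simp: ellipse_def)
  have "(0, 0) \<in> ?U" by simp
  thus "?U \<noteq> {}" by blast
qed

lemma ellipse_scaled_iff:
  assumes "t > 0"
  shows "(real_of_int m / t, real_of_int n / t) \<in> ellipse \<longleftrightarrow> real_of_int (q (m, n)) \<le> t\<^sup>2"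
proof -
  have "\<alpha> * (m / t)\<^sup>2 + 2 * \<beta> * (m / t) * (n / t) + \<gamma> * (n / t)\<^sup>2 = real_of_int (q (m, n)) / t\<^sup>2"
    using assms by (simp add: q_def power2_eq_square field_simps)
  thus ?thesis using assms by (simp add: ellipse_def)
qed

section \<open>Moebius inversion in a residue class\<close>

text \<open>The origin is left out because it is divisible by every \<open>d\<close>, which would
  spoil the inversion.\<close>

definition coset_points :: "int \<Rightarrow> int \<times> int \<Rightarrow> real \<Rightarrow> (int \<times> int) set" where
  "coset_points N c x = {v. [fst v = fst c] (mod N) \<and> [snd v = snd c] (mod N) \<and> v \<noteq> (0, 0) \<and> real_of_int (q v) \<le> x}"

lemma finite_q_le: "finite {v. real_of_int (q v) \<le> x}"
proof -
  define t where "t = sqrt (max x 1)"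
  have t: "t > 0" "t\<^sup>2 = max x 1" by (auto simp: t_def)
  have "finite {(m, n). [m = 0] (mod 1) \<and> [n = 0] (mod 1) \<and> (real_of_int m / t, real_of_int n / t) \<in> ellipse}"
    by (rule lattice_point_count_scaled(2)[OF _ ellipse_borel ellipse_bound _ ellipse_slices])
      (use t \<alpha>_pos \<gamma>_pos in auto)
  thus ?thesis by (rule finite_subset[rotated]) (use ellipse_scaled_iff[OF t(1)] t(2) in auto)
qed

lemma finite_coset_points: "finite (coset_points N c x)"
  by (rule finite_subset[OF _ finite_q_le[of x]]) (auto simp: coset_points_def)

text \<open>The constant is uniform in the class \<open>c\<close> and the bound holds for all
  \<open>x > 0\<close>, because the inversion applies it to a class that varies with
  \<open>d\<close> and to \<open>x / d\<^sup>2\<close>, which may be less than 1. In the constant, 2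
  comes from the lattice point count and the origin, and \<open>A\<close> serves the case
  \<open>x < 1\<close>, where there are no points.\<close>

lemma coset_points_count:
  fixes A :: real
  assumes N: "N \<ge> 1" and \<theta>: "1/2 < \<theta>" "\<theta> \<le> 1"
  defines "A \<equiv> measure lborel ellipse / real_of_int (N\<^sup>2)"
  shows "\<exists>K\<ge>0. \<forall>c. \<forall>x>0. \<bar>card (coset_points N c x) - A * x\<bar> \<le> K * x powr \<theta>"
proof (intro exI[of _ "4 * (\<alpha> + \<gamma>) + 2 + A"] conjI allI impI)
  have A: "A \<ge> 0" by (simp add: A_def)
  let ?B = "real_of_int (\<alpha> + \<gamma>)"
  have B: "?B \<ge> 0" using \<alpha>_pos \<gamma>_pos by simp
  show "0 \<le> 4 * (\<alpha> + \<gamma>) + 2 + A" using A B by simp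
  fix c :: "int \<times> int" and x :: real assume x: "x > 0"
  show "\<bar>card (coset_points N c x) - A * x\<bar> \<le> (4 * (\<alpha> + \<gamma>) + 2 + A) * x powr \<theta>"
  proof (cases "x \<ge> 1")
    case False
    have "coset_points N c x = {}"
    proof -
      have "\<not> real_of_int (q v) \<le> x" if "v \<noteq> (0,0)" for v using q_pos[OF that] False by linarith
      thus ?thesis by (auto simp: coset_points_def)
    qed
    moreover have "x powr 1 \<le> x powr \<theta>" using x False \<theta> by (intro powr_mono') auto
    hence "A * x \<le> (4 * (\<alpha> + \<gamma>) + 2 + A) * x powr \<theta>" using A B x by (intro mult_mono) auto
    ultimately show ?thesis using A x by simp
  next
    case True
    have t: "sqrt x > 0" "(sqrt x)\<^sup>2 = x" "sqrt x \<ge> 1" using True by auto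
    let ?X = "{(m, n). [m = fst c] (mod N) \<and> [n = snd c] (mod N) \<and> (real_of_int m / sqrt x, real_of_int n / sqrt x) \<in> ellipse}"
    note cnt = lattice_point_count_scaled[OF N ellipse_borel ellipse_bound _ ellipse_slices t(1), of "fst c" "snd c"]
    have fin: "finite ?X" using cnt(2) B by simp
    have eq: "coset_points N c x = ?X - {(0,0)}"
      unfolding ellipse_scaled_iff[OF t(1)] t(2) coset_points_def by auto
    have "\<bar>real (card (coset_points N c x)) - real (card ?X)\<bar> \<le> 1"
      unfolding eq using fin by (auto simp: card_Diff_singleton_if of_nat_diff Suc_le_eq card_gt_0_iff)
    moreover have "\<bar>card ?X - A * x\<bar> \<le> 4 * ?B * sqrt x + 1" using cnt(1) B by (simp add: A_def t(2))
    ultimately have "\<bar>card (coset_points N c x) - A * x\<bar> \<le> 4 * ?B * sqrt x + 2" by linarith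
    also have "\<dots> \<le> (4 * ?B + 2 + A) * sqrt x"
    proof -
      have "2 * 1 \<le> 2 * sqrt x" "A * sqrt x \<ge> 0" using t(3) A by auto
      thus ?thesis unfolding distrib_right by linarith
    qed
    also have "\<dots> \<le> (4 * ?B + 2 + A) * x powr \<theta>"
      using True \<theta> B A unfolding powr_half_sqrt[symmetric, OF order_trans[OF zero_le_one True]]
      by (intro mult_left_mono powr_mono) auto
    finally show ?thesis by simp
  qed
qed

definition primitive_points :: "int \<Rightarrow> int \<times> int \<Rightarrow> real \<Rightarrow> (int \<times> int) set" where
  "primitive_points N c x = {v. [fst v = fst c] (mod N) \<and> [snd v = snd c] (mod N) \<and> gcd (fst v) (snd v) = 1 \<and> real_of_int (q v) \<le> x}"

text \<open>Division by \<open>d\<close> is a bijection onto the class of \<open>c\<close>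
  multiplied by the inverse \<open>e\<close> of \<open>d\<close> modulo \<open>N\<close>, and it
  divides \<open>q\<close> by the square of \<open>d\<close>.\<close>

lemma card_multiples_coset_points:
  assumes N: "N \<ge> 1" and d: "d \<ge> 1" "coprime d N" "[d * e = 1] (mod N)"
  shows "card {v \<in> coset_points N c x. d dvd fst v \<and> d dvd snd v} =
     card (coset_points N (e * fst c, e * snd c) (x / d\<^sup>2))"
proof -
  have cong: "[d * a = b] (mod N) \<longleftrightarrow> [a = e * b] (mod N)" for a b
  proof
    assume "[d * a = b] (mod N)"
    hence "[e * (d * a) = e * b] (mod N)" by (rule cong_scalar_left)
    moreover have "[e * (d * a) = a] (mod N)"
      using cong_scalar_right[OF d(3), of a] by (simp add: mult_ac)
    ultimately show "[a = e * b] (mod N)" using cong_sym cong_trans by blast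
  next
    assume "[a = e * b] (mod N)"
    hence "[d * a = d * (e * b)] (mod N)" by (rule cong_scalar_left)
    moreover have "[d * (e * b) = b] (mod N)"
      using cong_scalar_right[OF d(3), of b] by (simp add: mult_ac)
    ultimately show "[d * a = b] (mod N)" using cong_trans by blast
  qed
  have qd: "real_of_int (q (d * a, d * b)) \<le> x \<longleftrightarrow> real_of_int (q (a, b)) \<le> x / d\<^sup>2" for a b
    using d(1) unfolding q_scale by (simp add: field_simps)
  have "{v \<in> coset_points N c x. d dvd fst v \<and> d dvd snd v} =
     (\<lambda>u. (d * fst u, d * snd u)) ` coset_points N (e * fst c, e * snd c) (x / d\<^sup>2)" (is "?L = ?f ` ?R")
  proof safe
    fix a b assume v: "(a, b) \<in> coset_points N c x" "d dvd fst (a, b)" "d dvd snd (a, b)"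
    obtain a' b' where ab: "a = d * a'" "b = d * b'" using v(2,3) by (auto elim!: dvdE)
    have "(a', b') \<in> ?R" using v(1) d(1) unfolding ab coset_points_def by (auto simp: cong qd)
    thus "(a, b) \<in> ?f ` ?R" using ab by force
  next
    fix a b assume "(a, b) \<in> ?R"
    thus "(d * fst (a, b), d * snd (a, b)) \<in> coset_points N c x"
      using d(1) unfolding coset_points_def by (auto simp: cong qd)
  qed auto
  thus ?thesis using d(1) by (simp add: card_image inj_on_def prod_eq_iff)
qed

text \<open>The condition that the gcd be 1 is expanded by the Moebius function and the sums are
  exchanged. The inverses \<open>e\<close> are chosen once for all cut-offs \<open>M\<close> and all
  \<open>x\<close>.\<close>

lemma card_primitive_points:
  assumes N: "N \<ge> 1" and cop: "gcd (gcd (fst c) (snd c)) N = 1"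
  obtains e where "\<And>M x. x \<ge> 1 \<Longrightarrow> x \<le> real M \<Longrightarrow> real (card (primitive_points N c x)) =
     (\<Sum>d\<in>{1..M}. (if coprime (int d) N then moebius_mu d else 0) *
        real (card (coset_points N (e d * fst c, e d * snd c) (x / (real d)\<^sup>2))))"
proof -
  \<comment> \<open>Unspecified when \<open>d\<close> is not invertible modulo \<open>N\<close>; the
    coefficient of that summand is 0.\<close>
  define e where "e d = (SOME e. [int d * e = 1] (mod N))" for d
  have e: "[int d * e d = 1] (mod N)" if "coprime (int d) N" for d
    unfolding e_def by (rule someI_ex) (use that cong_solve_coprime_int in blast)
  show ?thesis
  proof (rule that[of e])
    fix M :: nat and x :: real assume x: "x \<ge> 1" "x \<le> real M"
    let ?V = "coset_points N c x"
    have "real (card (primitive_points N c x)) = (\<Sum>v\<in>?V. if gcd (fst v) (snd v) = 1 then 1 else 0)"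
    proof -
      have "primitive_points N c x = {v\<in>?V. gcd (fst v) (snd v) = 1}"
        by (auto simp: primitive_points_def coset_points_def)
      thus ?thesis using finite_coset_points[of N c x] by (simp add: sum.If_cases Int_def)
    qed
    also have "\<dots> = (\<Sum>v\<in>?V. \<Sum>d\<in>{1..M}. if int d dvd fst v \<and> int d dvd snd v then moebius_mu d else 0)"
    proof (intro sum.cong refl)
      fix v assume v: "v \<in> ?V"
      define g where "g = nat (gcd (fst v) (snd v))"
      have v0: "v \<noteq> (0,0)" "real_of_int (q v) \<le> x" using v by (auto simp: coset_points_def)
      hence g0: "g > 0" unfolding g_def by (cases v) (auto simp: zero_less_nat_eq)
      have dg: "d dvd g \<longleftrightarrow> int d dvd fst v \<and> int d dvd snd v" for d
      proof -
        have "d dvd g \<longleftrightarrow> int d dvd int g" by simp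
        also have "int g = gcd (fst v) (snd v)" by (simp add: g_def)
        finally show ?thesis by simp
      qed
      \<comment> \<open>A common divisor \<open>d\<close> of the coordinates satisfies
        \<open>d \<le> d\<^sup>2 \<le> q v \<le> x \<le> M\<close>, so the range
        \<open>{1..M}\<close> loses no divisor.\<close>
      have le: "d \<le> M" if "int d dvd fst v \<and> int d dvd snd v" for d
      proof -
        obtain a b where ab: "fst v = int d * a" "snd v = int d * b" using \<open>_ \<and> _\<close> by (auto elim!: dvdE)
        have vab: "v = (int d * a, int d * b)" using ab by (simp add: prod_eq_iff)
        have "(a, b) \<noteq> (0, 0)" using v0(1) vab by auto
        hence "1 \<le> q (a, b)" by (rule q_pos)
        hence "(int d)\<^sup>2 * 1 \<le> (int d)\<^sup>2 * q (a, b)" by (intro mult_left_mono) auto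
        hence "(int d)\<^sup>2 \<le> q v" unfolding vab q_scale by simp
        moreover have "int d \<le> (int d)\<^sup>2" by (cases d) (auto simp: power2_eq_square)
        ultimately have "int d \<le> q v" by linarith
        hence "real d \<le> real_of_int (q v)" by linarith
        thus ?thesis using v0(2) x by linarith
      qed
      have "(if gcd (fst v) (snd v) = 1 then 1 else 0) = (if g = 1 then 1 else 0 :: real)"
        by (auto simp: g_def nat_eq_iff)
      also have "\<dots> = (\<Sum>d | d dvd g. moebius_mu d)" using sum_moebius_divisors[OF g0] by simp
      also have "\<dots> = (\<Sum>d\<in>{1..M}. if int d dvd fst v \<and> int d dvd snd v then moebius_mu d else 0)"
      proof (rule sum.mono_neutral_cong_left)
        show "{d. d dvd g} \<subseteq> {1..M}" using le g0 by (auto simp: dg[symmetric] Suc_le_eq intro!: Nat.gr0I)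
      qed (auto simp: dg)
      finally show "(if gcd (fst v) (snd v) = 1 then 1 else 0) = (\<Sum>d\<in>{1..M}. if int d dvd fst v \<and> int d dvd snd v then moebius_mu d else 0)" .
    qed
    also have "\<dots> = (\<Sum>d\<in>{1..M}. \<Sum>v\<in>?V. if int d dvd fst v \<and> int d dvd snd v then moebius_mu d else 0)"
      by (rule sum.swap)
    also have "\<dots> = (\<Sum>d\<in>{1..M}. (if coprime (int d) N then moebius_mu d else 0) *
        real (card (coset_points N (e d * fst c, e d * snd c) (x / (real d)\<^sup>2))))"
    proof (intro sum.cong refl)
      fix d assume d: "d \<in> {1..M}"
      have "(\<Sum>v\<in>?V. if int d dvd fst v \<and> int d dvd snd v then moebius_mu d else 0) =
          moebius_mu d * real (card {v\<in>?V. int d dvd fst v \<and> int d dvd snd v})"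
        using finite_coset_points[of N c x] by (simp add: sum.If_cases Int_def mult.commute)
      also have "\<dots> = (if coprime (int d) N then moebius_mu d else 0) *
        real (card (coset_points N (e d * fst c, e d * snd c) (x / (real d)\<^sup>2)))"
      proof (cases "coprime (int d) N")
        case True
        thus ?thesis using card_multiples_coset_points[OF N _ True e[OF True], of c x] d by simp
      next
        case False
        \<comment> \<open>A factor shared by \<open>d\<close> and \<open>N\<close> that divides
          \<open>v\<close> also divides \<open>c\<close>, because \<open>v\<close> and
          \<open>c\<close> agree modulo \<open>N\<close>. This contradicts
          \<open>cop\<close>.\<close>
        have "{v\<in>?V. int d dvd fst v \<and> int d dvd snd v} = {}"
        proof (rule ccontr)
          assume "\<not> ?thesis"
          then obtain v where v: "v \<in> ?V" "int d dvd fst v" "int d dvd snd v" by auto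
          define h where "h = gcd (int d) N"
          have h: "h dvd N" "h dvd fst v" "h dvd snd v" using v by (auto simp: h_def)
          have "[fst v = fst c] (mod h)" "[snd v = snd c] (mod h)"
            using v(1) h(1) by (auto simp: coset_points_def intro: cong_dvd_modulus)
          hence "h dvd fst c" "h dvd snd c" using h by (auto simp: cong_dvd_iff)
          hence "h dvd gcd (gcd (fst c) (snd c)) N" using h by simp
          hence "is_unit h" using cop by simp
          hence "coprime (int d) N" by (simp add: h_def coprime_iff_gcd_eq_1)
          thus False using False by contradiction
        qed
        thus ?thesis using False by (simp only: card.empty) simp
      qed
      finally show "(\<Sum>v\<in>?V. if int d dvd fst v \<and> int d dvd snd v then moebius_mu d else 0) = (if coprime (int d) N then moebius_mu d else 0) *
        real (card (coset_points N (e d * fst c, e d * snd c) (x / (real d)\<^sup>2)))" .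
    qed
    finally show "real (card (primitive_points N c x)) =
     (\<Sum>d\<in>{1..M}. (if coprime (int d) N then moebius_mu d else 0) *
        real (card (coset_points N (e d * fst c, e d * snd c) (x / (real d)\<^sup>2))))" .
  qed
qed

lemma coset_points_empty: "x < 1 \<Longrightarrow> coset_points N c x = {}"
proof -
  assume x: "x < 1"
  have "\<not> real_of_int (q v) \<le> x" if "v \<noteq> (0,0)" for v using q_pos[OF that] x by linarith
  thus ?thesis by (auto simp: coset_points_def)
qed

text \<open>The term for 1 equals 1, and all the others together are at most 3/4 in absolute value.
  This gives positivity without an Euler product.\<close>

lemma coprime_moebius_sum_pos:
  fixes N :: int
  defines "\<mu> \<equiv> \<lambda>d. if coprime (int d) N then moebius_mu d else 0"
  obtains Z where "Z > 0" "(\<lambda>d. \<mu> (Suc d) * (1 / (real (Suc d))\<^sup>2)) sums Z"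
proof -
  define f where "f d = \<mu> (Suc d) * (1 / (real (Suc d))\<^sup>2)" for d
  have \<mu>: "\<bar>\<mu> d\<bar> \<le> 1" for d using abs_moebius_le[of d] by (simp add: \<mu>_def)
  \<comment> \<open>A telescoping majorant of the inverse squares from 2 on. The first difference,
    1/2, is lowered by 1/4 to the exact value 1/4, so that the total is 3/4 and not 1.\<close>
  define b where "b d = 1 / real (Suc d) - 1 / real (Suc (Suc d)) - (if d = 0 then 1/4 else 0)" for d
  have "(\<lambda>d. 1 / real (Suc d) - 1 / real (Suc (Suc d))) sums (1 / real (Suc 0) - 0)"
    by (rule telescope_sums') (rule LIMSEQ_inverse_real_of_nat[unfolded inverse_eq_divide])
  moreover have "(\<lambda>d. if d = 0 then 1/4 else 0 :: real) sums (1/4)"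
    using sums_If_finite[of "\<lambda>d. d = 0" "\<lambda>_. 1/4 :: real"] by simp
  ultimately have b: "b sums (3/4)" unfolding b_def using sums_diff by fastforce
  have fb: "norm (f (Suc d)) \<le> b d" for d
  proof -
    have "norm (f (Suc d)) \<le> 1 * (1 / (real (Suc (Suc d)))\<^sup>2)"
      unfolding f_def norm_mult by (intro mult_mono) (use \<mu> in auto)
    also have "\<dots> \<le> b d"
    proof (cases "d = 0")
      case False
      hence "1 / (real (Suc (Suc d)))\<^sup>2 \<le> 1 / (real (Suc d) * real (Suc (Suc d)))"
        by (intro divide_left_mono) (auto simp: power2_eq_square)
      also have "\<dots> = b d" using False by (simp add: b_def field_simps)
      finally show ?thesis by simp
    qed (simp add: b_def)
    finally show ?thesis .
  qed
  have "summable (\<lambda>d. f (Suc d))"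
    by (rule summable_comparison_test[OF _ sums_summable[OF b]]) (use fb in auto)
  hence sf: "summable f" by (simp add: summable_Suc_iff)
  have "suminf f = (\<Sum>d. f (Suc d)) + f 0" using suminf_split_head[OF sf] by simp
  moreover have "f 0 = 1" by (simp add: f_def \<mu>_def moebius_mu_def)
  moreover have "norm (\<Sum>d. f (Suc d)) \<le> (\<Sum>d. b d)"
    by (rule norm_suminf_le[OF fb sums_summable[OF b]])
  ultimately have "suminf f > 0" using sums_unique[OF b] by simp
  moreover have "(\<lambda>d. \<mu> (Suc d) * (1 / (real (Suc d))\<^sup>2)) sums suminf f"
    using summable_sums[OF sf] unfolding f_def .
  ultimately show ?thesis by (rule that)
qed

text \<open>Inserting the uniform count gives the slope \<open>A * Z\<close>, with an error bounded
  by \<open>K * (x / d\<^sup>2) powr \<theta>\<close> summed over \<open>d\<close>. Since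
  \<open>\<theta> > 1/2\<close>, the exponent \<open>-2 * \<theta>\<close> of \<open>d\<close> is
  below -1 and the sum converges.\<close>

lemma linear_growth_primitive:
  assumes N: "N \<ge> 1" and cop: "gcd (gcd (fst c) (snd c)) N = 1"
  shows "\<exists>C>0. linear_growth (\<lambda>n. real (card {v. [fst v = fst c] (mod N) \<and> [snd v = snd c] (mod N) \<and>
     gcd (fst v) (snd v) = 1 \<and> nat (q v) = n})) C"
proof -
  define \<mu> where "\<mu> = (\<lambda>d. if coprime (int d) N then moebius_mu d else 0)"
  define A where "A = measure lborel ellipse / real_of_int (N\<^sup>2)"
  have A: "A > 0" using ellipse_area_pos N by (simp add: A_def)
  have \<mu>: "\<bar>\<mu> d\<bar> \<le> 1" for d using abs_moebius_le[of d] by (simp add: \<mu>_def)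
  obtain Z where Z: "Z > 0" "(\<lambda>d. \<mu> (Suc d) * (1 / (real (Suc d))\<^sup>2)) sums Z"
    using coprime_moebius_sum_pos[of N] unfolding \<mu>_def by blast
  obtain e where e: "\<And>M x. x \<ge> 1 \<Longrightarrow> x \<le> real M \<Longrightarrow> real (card (primitive_points N c x)) =
     (\<Sum>d\<in>{1..M}. \<mu> d * real (card (coset_points N (e d * fst c, e d * snd c) (x / (real d)\<^sup>2))))"
    using card_primitive_points[OF N cop] unfolding \<mu>_def by blast
  define A' where "A' = {v. [fst v = fst c] (mod N) \<and> [snd v = snd c] (mod N) \<and> gcd (fst v) (snd v) = 1}"
  have q1: "1 \<le> q v" if "v \<in> A'" for v using that by (intro q_pos) (auto simp: A'_def)
  have eqP: "{v \<in> A'. 1 \<le> nat (q v) \<and> real (nat (q v)) \<le> x} = primitive_points N c x" for x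
  proof -
    have "real (nat (q v)) = real_of_int (q v)" "1 \<le> nat (q v)" if "v \<in> A'" for v using q1[OF that] by auto
    thus ?thesis by (auto simp: primitive_points_def A'_def)
  qed
  have finP: "finite (primitive_points N c x)" for x
    by (rule finite_subset[OF _ finite_q_le[of x]]) (auto simp: primitive_points_def)
  have "linear_growth (\<lambda>n. real (card {v \<in> A'. nat (q v) = n})) (A * Z)"
  proof (rule linear_growthI)
    fix \<theta> :: real assume \<theta>: "1/2 < \<theta>" "\<theta> \<le> 1"
    obtain K where K: "K \<ge> 0" "\<And>c x. x > 0 \<Longrightarrow> \<bar>real (card (coset_points N c x)) - A * x\<bar> \<le> K * x powr \<theta>"
      using coset_points_count[OF N \<theta>] unfolding A_def by blast
    define T where "T = (\<Sum>d. real (Suc d) powr (-2 * \<theta>))"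
    have sT: "summable (\<lambda>d. real (Suc d) powr (-2 * \<theta>))" using \<theta> by (intro summable_Suc_powr) simp
    have "\<bar>summatory (\<lambda>n. real (card {v \<in> A'. nat (q v) = n})) x - A * Z * x\<bar> \<le> (K * T) * x powr \<theta>" if x: "x \<ge> 1" for x
    proof -
      define G where "G d = real (card (coset_points N (e d * fst c, e d * snd c) (x / (real d)\<^sup>2)))" for d
      define M where "M = nat \<lceil>x\<rceil>"
      have M: "x \<le> real M" by (simp add: M_def real_nat_ceiling_ge)
      \<comment> \<open>For \<open>d > M\<close> the quotient \<open>x / d\<^sup>2\<close> is below
        1 and no points are left, so the finite inversion sum is a series that can be compared
        termwise with the one for \<open>Z\<close>.\<close>
      have G0: "G (Suc d) = 0" if "d \<ge> M" for d
      proof -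
        have "x < real (Suc d) * 1" using that M by simp
        also have "\<dots> \<le> real (Suc d) * real (Suc d)" by (intro mult_left_mono) auto
        finally have "x < (real (Suc d))\<^sup>2" unfolding power2_eq_square .
        hence "x / (real (Suc d))\<^sup>2 < 1" by simp
        thus ?thesis unfolding G_def by (subst coset_points_empty) auto
      qed
      have "(\<lambda>d. \<mu> (Suc d) * G (Suc d)) sums (\<Sum>d<M. \<mu> (Suc d) * G (Suc d))"
        by (rule sums_finite) (use G0 in auto)
      also have "(\<Sum>d<M. \<mu> (Suc d) * G (Suc d)) = real (card (primitive_points N c x))"
        unfolding e[OF x M] G_def using sum.atLeast1_atMost_eq[of "\<lambda>d. \<mu> d * G d" M] by (simp add: G_def)
      finally have s1: "(\<lambda>d. \<mu> (Suc d) * G (Suc d)) sums real (card (primitive_points N c x))" .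
      have s2: "(\<lambda>d. A * x * (\<mu> (Suc d) * (1 / (real (Suc d))\<^sup>2))) sums (A * x * Z)"
        by (intro sums_mult Z)
      have s3: "(\<lambda>d. \<mu> (Suc d) * G (Suc d) - A * x * (\<mu> (Suc d) * (1 / (real (Suc d))\<^sup>2))) sums
         (real (card (primitive_points N c x)) - A * x * Z)" by (rule sums_diff[OF s1 s2])
      have "norm (\<Sum>d. \<mu> (Suc d) * G (Suc d) - A * x * (\<mu> (Suc d) * (1 / (real (Suc d))\<^sup>2))) \<le>
         (\<Sum>d. K * x powr \<theta> * real (Suc d) powr (-2 * \<theta>))"
      proof (rule norm_suminf_le)
        show "summable (\<lambda>d. K * x powr \<theta> * real (Suc d) powr (-2 * \<theta>))" by (intro summable_mult sT)
        fix d
        have "\<mu> (Suc d) * G (Suc d) - A * x * (\<mu> (Suc d) * (1 / (real (Suc d))\<^sup>2)) =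
           \<mu> (Suc d) * (G (Suc d) - A * (x / (real (Suc d))\<^sup>2))" by (simp add: right_diff_distrib)
        also have "norm \<dots> \<le> 1 * (K * (x / (real (Suc d))\<^sup>2) powr \<theta>)"
          unfolding real_norm_def abs_mult G_def using x by (intro mult_mono \<mu> K) auto
        also have "(x / (real (Suc d))\<^sup>2) powr \<theta> = x powr \<theta> * real (Suc d) powr (-2 * \<theta>)"
        proof -
          have "(x / (real (Suc d))\<^sup>2) powr \<theta> = x powr \<theta> / ((real (Suc d))\<^sup>2) powr \<theta>"
            by (rule powr_divide)
          also have "((real (Suc d))\<^sup>2) powr \<theta> = real (Suc d) powr (2 * \<theta>)"
            unfolding powr_powr[symmetric] by simp
          finally show ?thesis by (simp add: powr_minus divide_inverse)
        qed
        finally show "norm (\<mu> (Suc d) * G (Suc d) - A * x * (\<mu> (Suc d) * (1 / (real (Suc d))\<^sup>2))) \<le>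
           K * x powr \<theta> * real (Suc d) powr (-2 * \<theta>)" by (simp only: mult_1 mult.assoc)
      qed
      also have "\<dots> = (K * T) * x powr \<theta>"
        unfolding T_def by (subst suminf_mult[OF sT]) (simp only: mult_ac)
      finally have "\<bar>real (card (primitive_points N c x)) - A * x * Z\<bar> \<le> (K * T) * x powr \<theta>"
        unfolding sums_unique[OF s3, symmetric] real_norm_def .
      moreover have "summatory (\<lambda>n. real (card {v \<in> A'. nat (q v) = n})) x = card (primitive_points N c x)"
        using summatory_card[of A' "\<lambda>v. nat (q v)" x] finP x unfolding eqP by simp
      ultimately show ?thesis by (simp only: mult_ac)
    qed
    thus "\<exists>K. \<forall>x\<ge>1. \<bar>summatory (\<lambda>n. real (card {v \<in> A'. nat (q v) = n})) x - A * Z * x\<bar> \<le> K * x powr \<theta>" by blast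
  qed
  thus ?thesis using A Z(1) by (intro exI[of _ "A * Z"]) (simp add: A'_def conj_assoc)
qed

end

section \<open>Reduced bases of well-rounded lattices\<close>

definition int_span :: "real^2 \<Rightarrow> real^2 \<Rightarrow> (real^2) set" where
  "int_span v w = {of_int i *\<^sub>R v + of_int j *\<^sub>R w | i j. True}"

text \<open>Two nonzero vectors of equal length whose angle lies between 60 and 120 degrees.\<close>

definition reduced_pair :: "real^2 \<Rightarrow> real^2 \<Rightarrow> bool" where
  "reduced_pair v w \<longleftrightarrow> v \<noteq> 0 \<and> w \<bullet> w = v \<bullet> v \<and> 2 * \<bar>v \<bullet> w\<bar> \<le> v \<bullet> v"

lemma inner_combination:
  fixes v w :: "'a::real_inner"
  assumes "w \<bullet> w = v \<bullet> v"
  shows "(x *\<^sub>R v + y *\<^sub>R w) \<bullet> (x *\<^sub>R v + y *\<^sub>R w) = (x\<^sup>2 + y\<^sup>2) * (v \<bullet> v) + 2 * (x * y) * (v \<bullet> w)"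
  using assms by (simp add: inner_add_left inner_add_right inner_commute power2_eq_square algebra_simps)

text \<open>The lower bound identifies the shortest vectors; the upper bound shows that vectors with
  small coordinates are too short to be nonzero lattice vectors.\<close>

lemma reduced_pair_combination_bounds:
  assumes "reduced_pair v w"
  shows "(x\<^sup>2 + y\<^sup>2 - \<bar>x * y\<bar>) * (v \<bullet> v) \<le> (x *\<^sub>R v + y *\<^sub>R w) \<bullet> (x *\<^sub>R v + y *\<^sub>R w)"
    and "(x *\<^sub>R v + y *\<^sub>R w) \<bullet> (x *\<^sub>R v + y *\<^sub>R w) \<le> (x\<^sup>2 + y\<^sup>2 + \<bar>x * y\<bar>) * (v \<bullet> v)"
proof -
  have r: "w \<bullet> w = v \<bullet> v" "2 * \<bar>v \<bullet> w\<bar> \<le> v \<bullet> v" using assms by (auto simp: reduced_pair_def)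
  have "\<bar>2 * (x * y) * (v \<bullet> w)\<bar> = \<bar>x * y\<bar> * (2 * \<bar>v \<bullet> w\<bar>)" by (simp add: abs_mult)
  also have "\<dots> \<le> \<bar>x * y\<bar> * (v \<bullet> v)" by (intro mult_left_mono r) auto
  finally show "(x\<^sup>2 + y\<^sup>2 - \<bar>x * y\<bar>) * (v \<bullet> v) \<le> (x *\<^sub>R v + y *\<^sub>R w) \<bullet> (x *\<^sub>R v + y *\<^sub>R w)"
    and "(x *\<^sub>R v + y *\<^sub>R w) \<bullet> (x *\<^sub>R v + y *\<^sub>R w) \<le> (x\<^sup>2 + y\<^sup>2 + \<bar>x * y\<bar>) * (v \<bullet> v)"
    unfolding inner_combination[OF r(1)] left_diff_distrib distrib_right by linarith+
qed

lemma reduced_pair_pos: "reduced_pair v w \<Longrightarrow> v \<bullet> v > 0"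
  by (simp add: reduced_pair_def)

lemma reduced_pair_independent:
  assumes "reduced_pair v w" "x *\<^sub>R v + y *\<^sub>R w = 0"
  shows "x = 0 \<and> y = 0"
proof -
  have "(x\<^sup>2 + y\<^sup>2 - \<bar>x * y\<bar>) * (v \<bullet> v) \<le> 0"
    using reduced_pair_combination_bounds(1)[OF assms(1), of x y] assms(2) by simp
  hence 1: "x\<^sup>2 + y\<^sup>2 - \<bar>x * y\<bar> \<le> 0" using reduced_pair_pos[OF assms(1)] by (simp add: mult_le_0_iff)
  have 2: "x\<^sup>2 + y\<^sup>2 - \<bar>x * y\<bar> = (\<bar>x\<bar> - \<bar>y\<bar>)\<^sup>2 + \<bar>x * y\<bar>"
    by (simp add: power2_eq_square abs_mult algebra_simps)
  have "(\<bar>x\<bar> - \<bar>y\<bar>)\<^sup>2 \<ge> 0" "\<bar>x * y\<bar> \<ge> 0" by auto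
  with 1 2 have "(\<bar>x\<bar> - \<bar>y\<bar>)\<^sup>2 = 0" "\<bar>x * y\<bar> = 0" by linarith+
  thus ?thesis by auto
qed

lemma reduced_pair_inj:
  assumes "reduced_pair v w" "x *\<^sub>R v + y *\<^sub>R w = x' *\<^sub>R v + y' *\<^sub>R w"
  shows "x = x' \<and> y = y'"
  using reduced_pair_independent[OF assms(1), of "x - x'" "y - y'"] assms(2)
  by (simp add: algebra_simps)

lemma reduced_pair_span:
  assumes "reduced_pair v w"
  shows "span {v, w} = UNIV" and "\<exists>x y. u = x *\<^sub>R v + y *\<^sub>R w"
proof -
  have ne: "v \<noteq> w" using reduced_pair_inj[OF assms, of 1 0 0 1] by auto
  have w0: "w \<noteq> 0" using reduced_pair_inj[OF assms, of 0 1 0 0] by auto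
  have "v \<notin> span {w}"
  proof
    assume "v \<in> span {w}"
    then obtain k where "v = k *\<^sub>R w" by (auto simp: span_singleton)
    thus False using reduced_pair_inj[OF assms, of 1 0 0 k] by auto
  qed
  hence ind: "independent {v, w}" using w0 ne by (simp add: independent_insert)
  have "UNIV \<subseteq> span {v, w}"
    by (rule card_ge_dim_independent[OF _ ind]) (use ne in \<open>auto simp: dim_UNIV\<close>)
  thus *: "span {v, w} = UNIV" by auto
  hence "u \<in> span {v, w}" by simp
  then obtain x where "u - x *\<^sub>R v \<in> span {w}" by (auto simp: span_insert)
  then obtain y where "u - x *\<^sub>R v = y *\<^sub>R w" by (auto simp: span_singleton)
  thus "\<exists>x y. u = x *\<^sub>R v + y *\<^sub>R w" by (intro exI[of _ x] exI[of _ y]) (simp add: algebra_simps)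
qed

section \<open>Minimal vectors and the number of reduced bases\<close>

text \<open>Besides the generators and their negatives, the difference of the generators is as short
  as they are when the angle is 60 degrees, and their sum when it is 120 degrees.\<close>

definition short_coeffs :: "real^2 \<Rightarrow> real^2 \<Rightarrow> (int \<times> int) set" where
  "short_coeffs v w = {(1,0), (-1,0), (0,1), (0,-1)} \<union>
     (if 2 * (v \<bullet> w) = v \<bullet> v then {(1,-1), (-1,1)} else {}) \<union>
     (if 2 * (v \<bullet> w) = - (v \<bullet> v) then {(1,1), (-1,-1)} else {})"

lemma int_form_ge_1:
  fixes i j :: int
  assumes "(i, j) \<noteq> (0, 0)"
  shows "i\<^sup>2 + j\<^sup>2 - \<bar>i * j\<bar> \<ge> 1"
proof -
  have eq: "i\<^sup>2 + j\<^sup>2 - \<bar>i * j\<bar> = (\<bar>i\<bar> - \<bar>j\<bar>)\<^sup>2 + \<bar>i * j\<bar>"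
    by (simp add: power2_eq_square abs_mult algebra_simps)
  show ?thesis
  proof (cases "i * j = 0")
    case False
    hence "\<bar>i * j\<bar> \<ge> 1" by linarith
    thus ?thesis unfolding eq using zero_le_power2[of "\<bar>i\<bar> - \<bar>j\<bar>"] by linarith
  next
    case True
    hence "(\<bar>i\<bar> - \<bar>j\<bar>)\<^sup>2 \<noteq> 0" using assms by auto
    hence "(\<bar>i\<bar> - \<bar>j\<bar>)\<^sup>2 \<ge> 1" using zero_le_power2[of "\<bar>i\<bar> - \<bar>j\<bar>"] by linarith
    thus ?thesis unfolding eq by simp
  qed
qed

lemma int_form_eq_1:
  fixes i j :: int
  assumes "i\<^sup>2 + j\<^sup>2 - \<bar>i * j\<bar> = 1"
  shows "(i = 0 \<and> \<bar>j\<bar> = 1) \<or> (\<bar>i\<bar> = 1 \<and> j = 0) \<or> (\<bar>i\<bar> = 1 \<and> \<bar>j\<bar> = 1)"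
proof -
  have eq: "i\<^sup>2 + j\<^sup>2 - \<bar>i * j\<bar> = (\<bar>i\<bar> - \<bar>j\<bar>)\<^sup>2 + \<bar>i * j\<bar>"
    by (simp add: power2_eq_square abs_mult algebra_simps)
  show ?thesis
  proof (cases "i * j = 0")
    case True
    thus ?thesis using assms by (auto simp: power2_eq_1_iff)
  next
    case False
    hence "\<bar>i * j\<bar> \<ge> 1" by linarith
    hence "\<bar>i * j\<bar> = 1" using assms eq zero_le_power2[of "\<bar>i\<bar> - \<bar>j\<bar>"] by linarith
    thus ?thesis by (metis abs_zmult_eq_1 mult.commute)
  qed
qed

text \<open>The squared length is at least \<open>i\<^sup>2 + j\<^sup>2 - \<bar>i * j\<bar>\<close>
  times \<open>v \<bullet> v\<close>, and this integer is at least 1 off the origin. Equality leaves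
  only coefficients in {-1, 0, 1}; when both are nonzero, the inner product decides.\<close>

lemma minimal_vectors_int_span:
  assumes "reduced_pair v w"
  shows "minimal_vectors (int_span v w) = (\<lambda>(i, j). of_int i *\<^sub>R v + of_int j *\<^sub>R w) ` short_coeffs v w"
proof -
  let ?f = "\<lambda>i j. of_int i *\<^sub>R v + of_int j *\<^sub>R w"
  have r: "w \<bullet> w = v \<bullet> v" using assms by (simp add: reduced_pair_def)
  note pos = reduced_pair_pos[OF assms]
  have ge: "v \<bullet> v \<le> ?f i j \<bullet> ?f i j" if "(i, j) \<noteq> (0, 0)" for i j
  proof -
    have "1 \<le> real_of_int (i\<^sup>2 + j\<^sup>2 - \<bar>i * j\<bar>)" using int_form_ge_1[OF that] by linarith
    hence "1 * (v \<bullet> v) \<le> real_of_int (i\<^sup>2 + j\<^sup>2 - \<bar>i * j\<bar>) * (v \<bullet> v)" using pos by (intro mult_right_mono) auto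
    also have "\<dots> \<le> ?f i j \<bullet> ?f i j" using reduced_pair_combination_bounds(1)[OF assms, of "of_int i" "of_int j"] by simp
    finally show ?thesis by simp
  qed
  have nz: "?f i j = 0 \<longleftrightarrow> (i, j) = (0, 0)" for i j
    using reduced_pair_independent[OF assms, of "of_int i" "of_int j"] by auto
  have v_in: "v \<in> int_span v w" unfolding int_span_def
    by (intro CollectI exI[of _ 1] exI[of _ 0]) simp
  have min_iff: "?f i j \<in> minimal_vectors (int_span v w) \<longleftrightarrow> (i, j) \<noteq> (0, 0) \<and> ?f i j \<bullet> ?f i j = v \<bullet> v" for i j
  proof
    assume m: "?f i j \<in> minimal_vectors (int_span v w)"
    hence ne: "(i, j) \<noteq> (0, 0)" using nz[of i j] by (auto simp: minimal_vectors_def)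
    have "norm (?f i j) \<le> norm v" using m v_in pos by (auto simp: minimal_vectors_def)
    hence "?f i j \<bullet> ?f i j \<le> v \<bullet> v" by (simp add: norm_le)
    thus "(i, j) \<noteq> (0, 0) \<and> ?f i j \<bullet> ?f i j = v \<bullet> v" using ge[OF ne] ne by auto
  next
    assume *: "(i, j) \<noteq> (0, 0) \<and> ?f i j \<bullet> ?f i j = v \<bullet> v"
    have "norm (?f i j) \<le> norm y" if "y \<in> int_span v w" "y \<noteq> 0" for y
    proof -
      obtain i' j' where y: "y = ?f i' j'" using \<open>y \<in> int_span v w\<close> by (auto simp: int_span_def)
      have "(i', j') \<noteq> (0, 0)" using \<open>y \<noteq> 0\<close> y nz by auto
      from ge[OF this] show ?thesis using * unfolding y norm_le by simp
    qed
    moreover have "?f i j \<in> int_span v w" by (auto simp: int_span_def)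
    moreover have "?f i j \<noteq> 0" using * nz by blast
    ultimately show "?f i j \<in> minimal_vectors (int_span v w)" by (simp add: minimal_vectors_def)
  qed
  have coeff: "(i, j) \<in> short_coeffs v w \<longleftrightarrow> (i, j) \<noteq> (0, 0) \<and> ?f i j \<bullet> ?f i j = v \<bullet> v" for i j
  proof
    assume "(i, j) \<in> short_coeffs v w"
    thus "(i, j) \<noteq> (0, 0) \<and> ?f i j \<bullet> ?f i j = v \<bullet> v"
      unfolding inner_combination[OF r] by (auto simp: short_coeffs_def split: if_splits)
  next
    assume *: "(i, j) \<noteq> (0, 0) \<and> ?f i j \<bullet> ?f i j = v \<bullet> v"
    have "real_of_int (i\<^sup>2 + j\<^sup>2 - \<bar>i * j\<bar>) * (v \<bullet> v) \<le> 1 * (v \<bullet> v)"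
      using reduced_pair_combination_bounds(1)[OF assms, of "of_int i" "of_int j"] * by simp
    hence "real_of_int (i\<^sup>2 + j\<^sup>2 - \<bar>i * j\<bar>) \<le> 1" using pos by (simp only: mult_le_cancel_right_pos)
    hence "i\<^sup>2 + j\<^sup>2 - \<bar>i * j\<bar> = 1" using int_form_ge_1[of i j] * by linarith
    from int_form_eq_1[OF this] show "(i, j) \<in> short_coeffs v w"
    proof (elim disjE)
      assume ij: "\<bar>i\<bar> = 1 \<and> \<bar>j\<bar> = 1"
      hence "i = 1 \<or> i = -1" "j = 1 \<or> j = -1" by linarith+
      thus ?thesis using * unfolding inner_combination[OF r]
        by (elim disjE) (auto simp: short_coeffs_def)
    qed (auto simp: short_coeffs_def abs_eq_iff')
  qed
  show ?thesis
  proof (intro equalityI subsetI)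
    fix x assume x: "x \<in> minimal_vectors (int_span v w)"
    then obtain i j where ij: "x = ?f i j" by (auto simp: minimal_vectors_def int_span_def)
    have "(i, j) \<in> short_coeffs v w" using x unfolding ij min_iff coeff .
    thus "x \<in> (\<lambda>(i, j). ?f i j) ` short_coeffs v w" using ij by force
  next
    fix x assume "x \<in> (\<lambda>(i, j). ?f i j) ` short_coeffs v w"
    then obtain i j where ij: "x = ?f i j" "(i, j) \<in> short_coeffs v w" by auto
    show "x \<in> minimal_vectors (int_span v w)" using ij(2) unfolding ij(1) min_iff coeff .
  qed
qed

lemma card_minimal_vectors_int_span:
  assumes "reduced_pair v w"
  shows "finite (minimal_vectors (int_span v w))"
    and "card (minimal_vectors (int_span v w)) = (if 2 * \<bar>v \<bullet> w\<bar> = v \<bullet> v then 6 else 4)"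
proof -
  have inj: "inj_on (\<lambda>(i, j). of_int i *\<^sub>R v + of_int j *\<^sub>R w) (short_coeffs v w)"
    by (auto simp: inj_on_def dest: reduced_pair_inj[OF assms])
  show "finite (minimal_vectors (int_span v w))"
    unfolding minimal_vectors_int_span[OF assms] by (intro finite_imageI) (simp add: short_coeffs_def)
  have "card (short_coeffs v w) = (if 2 * \<bar>v \<bullet> w\<bar> = v \<bullet> v then 6 else 4)"
  proof -
    have c: "v \<bullet> v > 0" by (rule reduced_pair_pos[OF assms])
    consider "2 * (v \<bullet> w) = v \<bullet> v" | "2 * (v \<bullet> w) = - (v \<bullet> v)" |
      "2 * (v \<bullet> w) \<noteq> v \<bullet> v" "2 * (v \<bullet> w) \<noteq> - (v \<bullet> v)" by blast
    thus ?thesis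
    proof cases
      case 1
      hence "2 * (v \<bullet> w) \<noteq> - (v \<bullet> v)" "2 * \<bar>v \<bullet> w\<bar> = v \<bullet> v" using c by linarith+
      with 1 show ?thesis by (simp add: short_coeffs_def)
    next
      case 2
      hence "2 * (v \<bullet> w) \<noteq> v \<bullet> v" "2 * \<bar>v \<bullet> w\<bar> = v \<bullet> v" using c by linarith+
      with 2 show ?thesis by (simp add: short_coeffs_def)
    next
      case 3
      hence "2 * \<bar>v \<bullet> w\<bar> \<noteq> v \<bullet> v" by linarith
      with 3 show ?thesis by (simp add: short_coeffs_def)
    qed
  qed
  thus "card (minimal_vectors (int_span v w)) = (if 2 * \<bar>v \<bullet> w\<bar> = v \<bullet> v then 6 else 4)"
    unfolding minimal_vectors_int_span[OF assms] card_image[OF inj] .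
qed

lemma generators_minimal:
  assumes "reduced_pair v w"
  shows "v \<in> minimal_vectors (int_span v w)" "w \<in> minimal_vectors (int_span v w)"
    "w \<noteq> v" "w \<noteq> -v"
proof -
  show "v \<in> minimal_vectors (int_span v w)" unfolding minimal_vectors_int_span[OF assms]
    by (rule image_eqI[of _ _ "(1,0)"]) (auto simp: short_coeffs_def)
  show "w \<in> minimal_vectors (int_span v w)" unfolding minimal_vectors_int_span[OF assms]
    by (rule image_eqI[of _ _ "(0,1)"]) (auto simp: short_coeffs_def)
  show "w \<noteq> v" using reduced_pair_inj[OF assms, of 0 1 1 0] by auto
  show "w \<noteq> -v" using reduced_pair_inj[OF assms, of 0 1 "-1" 0] by auto
qed

lemma well_rounded_int_span:
  assumes "reduced_pair v w" shows "well_rounded (int_span v w)"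
proof -
  have "{v, w} \<subseteq> minimal_vectors (int_span v w)" using generators_minimal[OF assms] by auto
  hence "span {v, w} \<subseteq> span (minimal_vectors (int_span v w))" by (rule span_mono)
  thus ?thesis using reduced_pair_span(1)[OF assms] by (auto simp: well_rounded_def)
qed

text \<open>Minimality of \<open>v\<close> against the sum and the difference of \<open>v\<close>
  and \<open>w\<close> bounds the inner product. Any independent pair of shortest vectors then
  generates, by rounding real coordinates.\<close>

lemma minimal_pair_generates:
  assumes add: "\<And>x y. x \<in> M \<Longrightarrow> y \<in> M \<Longrightarrow> x + y \<in> M" and neg: "\<And>x. x \<in> M \<Longrightarrow> - x \<in> M"
    and v: "v \<in> minimal_vectors M" and w: "w \<in> minimal_vectors M" and ne: "w \<noteq> v" "w \<noteq> -v"
  shows "reduced_pair v w" "M = int_span v w"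
proof -
  have vM: "v \<in> M" "v \<noteq> 0" and wM: "w \<in> M" "w \<noteq> 0" using v w by (auto simp: minimal_vectors_def)
  have min: "v \<bullet> v \<le> x \<bullet> x" if "x \<in> M" "x \<noteq> 0" for x
    using v that by (auto simp: minimal_vectors_def norm_le)
  have eq: "w \<bullet> w = v \<bullet> v" using v w vM wM by (auto simp: minimal_vectors_def norm_le intro: antisym)
  have "v \<bullet> v \<le> (v + w) \<bullet> (v + w)" using ne add[OF vM(1) wM(1)] by (intro min) (auto simp: add_eq_0_iff)
  moreover have "v \<bullet> v \<le> (v + - w) \<bullet> (v + - w)" using ne add[OF vM(1) neg[OF wM(1)]] by (intro min) auto
  ultimately show red: "reduced_pair v w"
    using vM eq by (auto simp: reduced_pair_def inner_add_left inner_add_right inner_diff_left inner_diff_right inner_commute)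
  have zero: "0 \<in> M" using add[OF vM(1) neg[OF vM(1)]] by simp
  have natmul: "of_nat n *\<^sub>R x \<in> M" if "x \<in> M" for n x
    by (induction n) (use that zero add in \<open>auto simp: scaleR_add_left\<close>)
  have intmul: "of_int n *\<^sub>R x \<in> M" if "x \<in> M" for n x
    using natmul[OF that] neg[OF natmul[OF that]] by (cases n rule: int_cases2) auto
  show "M = int_span v w"
  proof (intro equalityI subsetI)
    fix x assume "x \<in> int_span v w" thus "x \<in> M" using add intmul vM wM by (auto simp: int_span_def)
  next
    fix u assume u: "u \<in> M"
    obtain x y where xy: "u = x *\<^sub>R v + y *\<^sub>R w" using reduced_pair_span(2)[OF red] by blast
    \<comment> \<open>Rounded coordinates leave at most 1/2 each, so the remainder has squared
      length at most \<open>1/4 + 1/4 + 1/4 = 3/4\<close> of the minimum and must vanish.\<close>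
    define r s where "r = x - of_int (round x)" and "s = y - of_int (round y)"
    have rs: "\<bar>r\<bar> \<le> 1/2" "\<bar>s\<bar> \<le> 1/2"
      using of_int_round_abs_le[of x] of_int_round_abs_le[of y] by (auto simp: r_def s_def abs_minus_commute)
    define u' where "u' = r *\<^sub>R v + s *\<^sub>R w"
    have "u' = u + (of_int (- round x) *\<^sub>R v + of_int (- round y) *\<^sub>R w)"
      by (simp add: u'_def r_def s_def xy algebra_simps)
    hence u'M: "u' \<in> M" using add[OF u add[OF intmul[OF vM(1)] intmul[OF wM(1)]]] by (simp only:)
    have "u' = 0"
    proof (rule ccontr)
      assume "u' \<noteq> 0"
      from min[OF u'M this] have 1: "v \<bullet> v \<le> u' \<bullet> u'" .
      have "u' \<bullet> u' \<le> (r\<^sup>2 + s\<^sup>2 + \<bar>r * s\<bar>) * (v \<bullet> v)"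
        unfolding u'_def by (rule reduced_pair_combination_bounds(2)[OF red])
      also have "\<dots> \<le> (3/4) * (v \<bullet> v)"
      proof (intro mult_right_mono)
        have "\<bar>r\<bar> * \<bar>r\<bar> \<le> (1/2) * (1/2)" "\<bar>s\<bar> * \<bar>s\<bar> \<le> (1/2) * (1/2)" "\<bar>r\<bar> * \<bar>s\<bar> \<le> (1/2) * (1/2)"
          using rs by (intro mult_mono; auto)+
        thus "r\<^sup>2 + s\<^sup>2 + \<bar>r * s\<bar> \<le> 3/4" by (simp add: power2_eq_square abs_mult)
      qed auto
      finally show False using 1 reduced_pair_pos[OF red] by simp
    qed
    hence "r = 0 \<and> s = 0" using reduced_pair_independent[OF red] by (simp add: u'_def)
    hence "u = of_int (round x) *\<^sub>R v + of_int (round y) *\<^sub>R w" by (simp add: xy r_def s_def)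
    thus "u \<in> int_span v w" by (auto simp: int_span_def)
  qed
qed

lemma int_span_add: "x \<in> int_span v w \<Longrightarrow> y \<in> int_span v w \<Longrightarrow> x + y \<in> int_span v w"
proof -
  assume "x \<in> int_span v w" "y \<in> int_span v w"
  then obtain i j i' j' where "x = of_int i *\<^sub>R v + of_int j *\<^sub>R w" "y = of_int i' *\<^sub>R v + of_int j' *\<^sub>R w"
    by (auto simp: int_span_def)
  hence "x + y = of_int (i + i') *\<^sub>R v + of_int (j + j') *\<^sub>R w" by (simp add: algebra_simps)
  thus ?thesis unfolding int_span_def by blast
qed

lemma int_span_neg: "x \<in> int_span v w \<Longrightarrow> - x \<in> int_span v w"
proof -
  assume "x \<in> int_span v w"
  then obtain i j where "x = of_int i *\<^sub>R v + of_int j *\<^sub>R w" by (auto simp: int_span_def)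
  hence "- x = of_int (- i) *\<^sub>R v + of_int (- j) *\<^sub>R w" by (simp add: algebra_simps)
  thus ?thesis unfolding int_span_def by blast
qed

lemma reduced_pairs_of_lattice:
  assumes "reduced_pair v w"
  defines "X \<equiv> minimal_vectors (int_span v w)"
  shows "{(v', w'). reduced_pair v' w' \<and> int_span v' w' = int_span v w} = (SIGMA a:X. X - {a, -a})"
proof (intro equalityI subsetI)
  fix p assume "p \<in> {(v', w'). reduced_pair v' w' \<and> int_span v' w' = int_span v w}"
  then obtain v' w' where p: "p = (v', w')" "reduced_pair v' w'" "int_span v' w' = int_span v w" by auto
  show "p \<in> (SIGMA a:X. X - {a, -a})" using generators_minimal[OF p(2)] unfolding p(3) by (auto simp: p(1) X_def)
next
  fix p assume "p \<in> (SIGMA a:X. X - {a, -a})"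
  then obtain v' w' where p: "p = (v', w')" "v' \<in> X" "w' \<in> X" "w' \<noteq> v'" "w' \<noteq> - v'" by auto
  show "p \<in> {(v', w'). reduced_pair v' w' \<and> int_span v' w' = int_span v w}"
    using minimal_pair_generates[OF int_span_add int_span_neg p(2,3)[unfolded X_def] p(4,5)] p(1) by auto
qed

text \<open>The first vector is any minimal one and the second avoids it and its negative:
  \<open>6 * 4\<close> choices in the hexagonal case, \<open>4 * 2\<close> otherwise.\<close>

lemma card_reduced_pairs_of_lattice:
  assumes "reduced_pair v w"
  shows "card {(v', w'). reduced_pair v' w' \<and> int_span v' w' = int_span v w} =
     (if 2 * \<bar>v \<bullet> w\<bar> = v \<bullet> v then 24 else 8)"
proof -
  define X where "X = minimal_vectors (int_span v w)"
  have fin: "finite X" and card: "card X = (if 2 * \<bar>v \<bullet> w\<bar> = v \<bullet> v then 6 else 4)"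
    using card_minimal_vectors_int_span[OF assms] by (auto simp: X_def)
  have neg: "-a \<in> X" "a \<noteq> -a" if "a \<in> X" for a
  proof -
    have "a \<noteq> 0" using that by (simp add: X_def minimal_vectors_def)
    thus "a \<noteq> -a" by (metis add_eq_0_iff2 scaleR_2 scaleR_eq_0_iff zero_neq_numeral)
    show "-a \<in> X" using that int_span_neg[of a v w] by (auto simp: X_def minimal_vectors_def)
  qed
  have "card (X - {a, -a}) = card X - 2" if "a \<in> X" for a
    using neg[OF that] that fin by (subst card_Diff_subset) auto
  hence "card (SIGMA a:X. X - {a, -a}) = card X * (card X - 2)"
    using fin by (subst card_SigmaI) auto
  thus ?thesis unfolding reduced_pairs_of_lattice[OF assms] X_def[symmetric] card by simp
qed

lemma well_rounded_imp_reduced_pair: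
  assumes add: "\<And>x y. x \<in> M \<Longrightarrow> y \<in> M \<Longrightarrow> x + y \<in> M" and neg: "\<And>x. x \<in> M \<Longrightarrow> - x \<in> M"
    and wr: "well_rounded M"
  obtains v w where "v \<in> M" "w \<in> M" "reduced_pair v w" "M = int_span v w"
proof -
  have sp: "span (minimal_vectors M) = UNIV" using wr by (simp add: well_rounded_def)
  have "minimal_vectors M \<noteq> {}"
  proof
    assume "minimal_vectors M = {}"
    hence "(UNIV :: (real^2) set) = {0}" using sp by simp
    thus False by (metis UNIV_I singletonD zero_neq_one)
  qed
  then obtain v where v: "v \<in> minimal_vectors M" by blast
  have "\<not> minimal_vectors M \<subseteq> {v, -v}"
  proof
    assume "minimal_vectors M \<subseteq> {v, -v}"
    hence "minimal_vectors M \<subseteq> span {v}" by (auto intro: span_neg span_base)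
    hence "span (minimal_vectors M) \<subseteq> span {v}" by (simp add: span_minimal)
    hence "dim (UNIV :: (real^2) set) \<le> dim (span {v})" unfolding sp by (rule dim_subset)
    also have "\<dots> \<le> card {v}" unfolding dim_span by (rule dim_le_card') simp
    finally show False by (simp add: dim_UNIV)
  qed
  then obtain w where w: "w \<in> minimal_vectors M" "w \<noteq> v" "w \<noteq> -v" by blast
  from minimal_pair_generates[OF add neg v w] v w show ?thesis
    by (intro that[of v w]) (auto simp: minimal_vectors_def)
qed

section \<open>The index of a sublattice\<close>

definition idet :: "int \<times> int \<Rightarrow> int \<times> int \<Rightarrow> int" where
  "idet v w = fst v * snd w - snd v * fst w"

definition int_comb :: "int \<times> int \<Rightarrow> int \<times> int \<Rightarrow> (int \<times> int) set" where
  "int_comb v w = {(i * fst v + j * fst w, i * snd v + j * snd w) | i j. True}"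

text \<open>For triangular generators a box of residues represents the quotient: the second
  coordinate determines the multiple of \<open>(c, f)\<close>, and then the first determines the
  multiple of \<open>(a, 0)\<close>.\<close>

lemma coset_representatives_triangular:
  fixes a c f :: int
  assumes a: "a \<noteq> 0" and f: "f \<noteq> 0"
  defines "R \<equiv> {0..<\<bar>a\<bar>} \<times> {0..<\<bar>f\<bar>}"
  shows "\<exists>!r. r \<in> R \<and> p - r \<in> int_comb (c, f) (a, 0)"
proof -
  obtain x y where p: "p = (x, y)" by fastforce
  \<comment> \<open>The sign adjusts for negative \<open>f\<close>, as the quotient is taken by the
    absolute value.\<close>
  define i where "i = sgn f * (y div \<bar>f\<bar>)"
  have "\<bar>f\<bar> * (y div \<bar>f\<bar>) = i * f" by (simp add: i_def abs_sgn mult_ac)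
  hence y: "y = i * f + y mod \<bar>f\<bar>" by (metis mult_div_mod_eq)
  define j where "j = sgn a * ((x - i * c) div \<bar>a\<bar>)"
  have "\<bar>a\<bar> * ((x - i * c) div \<bar>a\<bar>) = j * a" by (simp add: j_def abs_sgn mult_ac)
  hence x: "x - i * c = j * a + (x - i * c) mod \<bar>a\<bar>" by (metis mult_div_mod_eq)
  define r where "r = ((x - i * c) mod \<bar>a\<bar>, y mod \<bar>f\<bar>)"
  have "r \<in> R" using a f by (simp add: r_def R_def)
  moreover have "p - r \<in> int_comb (c, f) (a, 0)"
  proof -
    have "p - r = (i * c + j * a, i * f + j * 0)" using x y by (simp add: p r_def)
    thus ?thesis unfolding int_comb_def by auto
  qed
  moreover have "r1 = r2" if r1: "r1 \<in> R" "p - r1 \<in> int_comb (c, f) (a, 0)" and r2: "r2 \<in> R" "p - r2 \<in> int_comb (c, f) (a, 0)" for r1 r2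
  proof -
    obtain i1 j1 i2 j2 where ij: "p - r1 = (i1 * c + j1 * a, i1 * f)" "p - r2 = (i2 * c + j2 * a, i2 * f)"
      using r1(2) r2(2) by (auto simp: int_comb_def)
    have small: "d = 0" if "\<bar>d * b\<bar> < \<bar>b\<bar>" for d b :: int
    proof (rule ccontr)
      assume "d \<noteq> 0"
      hence "1 * \<bar>b\<bar> \<le> \<bar>d\<bar> * \<bar>b\<bar>" by (intro mult_right_mono) auto
      thus False using that by (simp add: abs_mult)
    qed
    have "snd r2 - snd r1 = (i1 - i2) * f" using ij by (auto simp: prod_eq_iff algebra_simps)
    moreover have "\<bar>snd r2 - snd r1\<bar> < \<bar>f\<bar>" using r1(1) r2(1) by (auto simp: R_def)
    ultimately have i0: "i1 - i2 = 0" using small by metis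
    have "fst r2 - fst r1 = (i1 - i2) * c + (j1 - j2) * a" using ij by (auto simp: prod_eq_iff algebra_simps)
    hence "fst r2 - fst r1 = (j1 - j2) * a" using i0 by simp
    moreover have "\<bar>fst r2 - fst r1\<bar> < \<bar>a\<bar>" using r1(1) r2(1) by (auto simp: R_def)
    ultimately have "j1 - j2 = 0" using small by metis
    thus "r1 = r2" using ij i0 by (simp add: prod_eq_iff)
  qed
  ultimately show ?thesis by blast
qed

lemma int_comb_euclid_step:
  "int_comb w (fst v - k * fst w, snd v - k * snd w) = int_comb v w"
proof (intro equalityI subsetI)
  fix p assume "p \<in> int_comb w (fst v - k * fst w, snd v - k * snd w)"
  then obtain i j where "p = (i * fst w + j * (fst v - k * fst w), i * snd w + j * (snd v - k * snd w))"
    by (auto simp: int_comb_def)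
  hence "p = (j * fst v + (i - j * k) * fst w, j * snd v + (i - j * k) * snd w)" by (simp add: algebra_simps)
  thus "p \<in> int_comb v w" unfolding int_comb_def by blast
next
  fix p assume "p \<in> int_comb v w"
  then obtain i j where "p = (i * fst v + j * fst w, i * snd v + j * snd w)" by (auto simp: int_comb_def)
  hence "p = ((j + i * k) * fst w + i * (fst v - k * fst w), (j + i * k) * snd w + i * (snd v - k * snd w))"
    by (simp add: algebra_simps)
  thus "p \<in> int_comb w (fst v - k * fst w, snd v - k * snd w)" unfolding int_comb_def by auto
qed

text \<open>Euclid's algorithm on the second coordinates leads to triangular generators. Each step
  preserves the generated subgroup and only changes the sign of the determinant.\<close>

lemma coset_representatives:
  assumes "idet v w \<noteq> 0"
  shows "\<exists>R. finite R \<and> card R = nat \<bar>idet v w\<bar> \<and> (\<forall>p. \<exists>!r. r \<in> R \<and> p - r \<in> int_comb v w)"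
  using assms
proof (induction "nat \<bar>snd w\<bar>" arbitrary: v w rule: less_induct)
  case less
  show ?case
  proof (cases "snd w = 0")
    case True
    have "snd v \<noteq> 0" "fst w \<noteq> 0" using less.prems True by (auto simp: idet_def)
    moreover have "v = (fst v, snd v)" "w = (fst w, 0)" using True by (auto simp: prod_eq_iff)
    ultimately have "\<exists>!r. r \<in> {0..<\<bar>fst w\<bar>} \<times> {0..<\<bar>snd v\<bar>} \<and> p - r \<in> int_comb v w" for p
      using coset_representatives_triangular[of "fst w" "snd v" p "fst v"] by simp
    moreover have "card ({0..<\<bar>fst w\<bar>} \<times> {0..<\<bar>snd v\<bar>}) = nat \<bar>idet v w\<bar>"
      using True by (simp add: idet_def abs_mult nat_mult_distrib)
    ultimately show ?thesis by (intro exI[of _ "{0..<\<bar>fst w\<bar>} \<times> {0..<\<bar>snd v\<bar>}"]) auto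
  next
    case False
    define k where "k = snd v div snd w"
    define v' where "v' = (fst v - k * fst w, snd v - k * snd w)"
    have "snd v' = snd v mod snd w" by (simp add: v'_def k_def minus_div_mult_eq_mod)
    hence "nat \<bar>snd v'\<bar> < nat \<bar>snd w\<bar>" using False abs_mod_less[of "snd w" "snd v"] by simp
    moreover have det: "idet w v' = - idet v w" by (simp add: idet_def v'_def algebra_simps)
    ultimately have "\<exists>R. finite R \<and> card R = nat \<bar>idet w v'\<bar> \<and> (\<forall>p. \<exists>!r. r \<in> R \<and> p - r \<in> int_comb w v')"
      using less.prems by (intro less.hyps) auto
    thus ?thesis unfolding v'_def int_comb_euclid_step unfolding v'_def[symmetric] det by simp
  qed
qed

section \<open>From integer coordinates to the lattice\<close>

definition lat_vec :: "(2 \<Rightarrow> real^2) \<Rightarrow> int \<times> int \<Rightarrow> real^2" where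
  "lat_vec b p = of_int (fst p) *\<^sub>R b 1 + of_int (snd p) *\<^sub>R b 2"

lemma lat_vec_add: "lat_vec b (p + r) = lat_vec b p + lat_vec b r"
  and lat_vec_diff: "lat_vec b (p - r) = lat_vec b p - lat_vec b r"
  by (simp_all add: lat_vec_def algebra_simps)

lemma lat_vec_int_comb:
  "int_span (lat_vec b v) (lat_vec b w) = lat_vec b ` int_comb v w"
proof -
  have "of_int i *\<^sub>R lat_vec b v + of_int j *\<^sub>R lat_vec b w = lat_vec b (i * fst v + j * fst w, i * snd v + j * snd w)" for i j
    by (simp add: lat_vec_def algebra_simps)
  thus ?thesis unfolding int_span_def int_comb_def by (auto simp: image_iff)
qed

lemma lattice_basis_range:
  assumes "lattice_basis b L" shows "L = range (lat_vec b)"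
proof -
  have L: "L = {(\<Sum>i\<in>UNIV. of_int (z i) *\<^sub>R b i) | z :: 2 \<Rightarrow> int. True}" using assms by (simp add: lattice_basis_def)
  have "\<exists>z :: 2 \<Rightarrow> int. lat_vec b p = (\<Sum>i\<in>UNIV. of_int (z i) *\<^sub>R b i)" for p
    by (intro exI[of _ "\<lambda>i. if i = 1 then fst p else snd p"]) (simp add: sum_2 lat_vec_def)
  moreover have "(\<Sum>i\<in>UNIV. of_int (z i) *\<^sub>R b i) = lat_vec b (z 1, z 2)" for z :: "2 \<Rightarrow> int"
    by (simp add: sum_2 lat_vec_def)
  ultimately show ?thesis unfolding L by (auto simp: image_iff)
qed

lemma lat_vec_inj:
  assumes "lattice_basis b L" shows "inj (lat_vec b)"
proof -
  have ind: "independent (range b)" "inj b" using assms by (auto simp: lattice_basis_def)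
  have ne: "b 1 \<noteq> b 2" using ind(2) by (auto simp: inj_eq)
  have "range b = {b 1, b 2}" using UNIV_2 by (metis image_insert image_empty)
  hence nin: "b 1 \<notin> span {b 2}" and nz: "b 2 \<noteq> 0" using ind(1) ne by (auto simp: independent_insert dependent_zero)
  have "p = (0, 0)" if "lat_vec b p = 0" for p
  proof -
    have eq: "of_int (fst p) *\<^sub>R b 1 = - (of_int (snd p) *\<^sub>R b 2)" using that by (simp add: lat_vec_def add_eq_0_iff2)
    have "fst p = 0"
    proof (rule ccontr)
      assume "fst p \<noteq> 0"
      hence "b 1 = (- of_int (snd p) / of_int (fst p)) *\<^sub>R b 2"
        using arg_cong[OF eq, of "scaleR (1 / of_int (fst p))"] by simp
      thus False using nin by (metis span_base span_scale singletonI)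
    qed
    thus ?thesis using eq nz by (simp add: prod_eq_iff)
  qed
  thus ?thesis using lat_vec_diff by (metis (no_types, lifting) diff_self eq_iff_diff_eq_0 injI zero_prod_def)
qed

lemma additive_group_simps:
  "carrier (additive_group L) = L" "x \<otimes>\<^bsub>additive_group L\<^esub> y = x + y" "\<one>\<^bsub>additive_group L\<^esub> = 0"
  by (simp_all add: additive_group_def)

lemma additive_group_group:
  assumes "lattice_basis b L"
  shows "group (additive_group L)" and "x \<in> L \<Longrightarrow> inv\<^bsub>additive_group L\<^esub> x = - x"
proof -
  have neg: "- lat_vec b p = lat_vec b (- p)" for p by (simp add: lat_vec_def)
  have L: "L = range (lat_vec b)" by (rule lattice_basis_range[OF assms])
  have closed: "x + y \<in> L" "- x \<in> L" if "x \<in> L" "y \<in> L" for x y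
    using that unfolding L by (auto simp: neg lat_vec_add[symmetric])
  have zero: "0 \<in> L" unfolding L by (rule range_eqI[of _ _ "(0,0)"]) (simp add: lat_vec_def)
  show G: "group (additive_group L)"
    by (rule groupI) (use closed zero in \<open>auto simp: additive_group_simps add.assoc intro: bexI[where x = "- x" for x]\<close>)
  show "inv\<^bsub>additive_group L\<^esub> x = - x" if "x \<in> L"
    using that closed by (intro group.inv_equality[OF G]) (auto simp: additive_group_simps)
qed

lemma rcosets_additive: "rcosets\<^bsub>additive_group L\<^esub> M = (\<lambda>a. (\<lambda>h. h + a) ` M) ` L"
  by (auto simp: RCOSETS_def r_coset_def additive_group_simps)

lemma int_span_sublattice:
  assumes b: "lattice_basis b L" and det: "idet v w \<noteq> 0"
  shows "sublattice (int_span (lat_vec b v) (lat_vec b w)) L"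
    and "lattice_index L (int_span (lat_vec b v) (lat_vec b w)) = nat \<bar>idet v w\<bar>"
proof -
  let ?M = "int_span (lat_vec b v) (lat_vec b w)"
  have L: "L = range (lat_vec b)" by (rule lattice_basis_range[OF b])
  have M: "?M = lat_vec b ` int_comb v w" by (rule lat_vec_int_comb)
  have M_sub: "?M \<subseteq> L" unfolding L M by auto
  have zero: "0 \<in> ?M" unfolding int_span_def by (intro CollectI exI[of _ 0]) simp
  have sub: "subgroup ?M (additive_group L)"
  proof (rule subgroup.intro)
    show "inv\<^bsub>additive_group L\<^esub> x \<in> ?M" if "x \<in> ?M" for x
      using that M_sub int_span_neg additive_group_group(2)[OF b, of x] by auto
  qed (use M_sub zero int_span_add in \<open>auto simp: additive_group_simps\<close>)
  obtain R where R: "finite R" "card R = nat \<bar>idet v w\<bar>" "\<And>p. \<exists>!r. r \<in> R \<and> p - r \<in> int_comb v w"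
    using coset_representatives[OF det] by blast
  define C where "C p = (\<lambda>h. h + lat_vec b p) ` ?M" for p
  have C_eq: "C p = C r \<longleftrightarrow> p - r \<in> int_comb v w" for p r
  proof
    assume "C p = C r"
    moreover have "lat_vec b p \<in> C p" unfolding C_def using zero by force
    ultimately obtain h where h: "h \<in> ?M" "lat_vec b p = h + lat_vec b r" by (auto simp: C_def)
    hence "lat_vec b (p - r) \<in> lat_vec b ` int_comb v w" unfolding M by (simp add: lat_vec_diff)
    thus "p - r \<in> int_comb v w" using lat_vec_inj[OF b] by (simp add: inj_image_mem_iff)
  next
    assume "p - r \<in> int_comb v w"
    hence m: "lat_vec b p - lat_vec b r \<in> ?M" unfolding M lat_vec_diff[symmetric] by blast
    have sub: "C p' \<subseteq> C r'" if m: "lat_vec b p' - lat_vec b r' \<in> ?M" for p' r'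
    proof
      fix x assume "x \<in> C p'"
      then obtain h where h: "h \<in> ?M" "x = h + lat_vec b p'" by (auto simp: C_def)
      have "h + (lat_vec b p' - lat_vec b r') \<in> ?M" using h m int_span_add by blast
      moreover have "x = (h + (lat_vec b p' - lat_vec b r')) + lat_vec b r'" using h by simp
      ultimately show "x \<in> C r'" unfolding C_def by blast
    qed
    show "C p = C r" using sub[OF m] sub[of r p] int_span_neg[OF m] by auto
  qed
  have "rcosets\<^bsub>additive_group L\<^esub> ?M = C ` UNIV"
    unfolding rcosets_additive L C_def by (simp add: image_image)
  also have "\<dots> = C ` R"
  proof (intro equalityI subsetI)
    fix x assume "x \<in> C ` UNIV"
    then obtain p where x: "x = C p" by blast
    obtain r where "r \<in> R" "p - r \<in> int_comb v w" using R(3)[of p] by blast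
    thus "x \<in> C ` R" using x C_eq by blast
  qed auto
  finally have rc: "rcosets\<^bsub>additive_group L\<^esub> ?M = C ` R" .
  have self: "(0, 0) \<in> int_comb v w" unfolding int_comb_def by (intro CollectI exI[of _ 0]) simp
  have "inj_on C R"
  proof (rule inj_onI)
    fix p r assume pr: "p \<in> R" "r \<in> R" "C p = C r"
    have "p - r \<in> int_comb v w" using pr(3) C_eq by blast
    moreover have "p - p \<in> int_comb v w" using self by (simp add: zero_prod_def)
    ultimately show "p = r" using R(3)[of p] pr by blast
  qed
  hence "card (C ` R) = nat \<bar>idet v w\<bar>" using R(2) by (simp add: card_image)
  thus "lattice_index L ?M = nat \<bar>idet v w\<bar>" unfolding lattice_index_def rc .
  show "sublattice ?M L" unfolding sublattice_def rc using sub R(1) by simp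
qed

section \<open>Parametrisation of reduced bases\<close>

lemma dirichlet_conv_counts:
  fixes f :: "'a \<Rightarrow> nat" and h :: "'b \<Rightarrow> nat" and w :: "'b \<Rightarrow> real"
  assumes m: "m > 0" and A: "\<And>d. finite {x \<in> A. f x = d}" and B: "\<And>d. d > 0 \<Longrightarrow> finite {y \<in> B. h y = d}"
  shows "dirichlet_conv (\<lambda>n. real (card {x \<in> A. f x = n})) (\<lambda>n. \<Sum>y | y \<in> B \<and> h y = n. w y) m =
    (\<Sum>(x, y) | x \<in> A \<and> y \<in> B \<and> f x * h y = m. w y)"
    and "finite {(x, y). x \<in> A \<and> y \<in> B \<and> f x * h y = m}"
proof -
  let ?S = "SIGMA d:{d. d dvd m}. {x \<in> A. f x = d} \<times> {y \<in> B. h y = m div d}"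
  have fin: "finite ({x \<in> A. f x = d} \<times> {y \<in> B. h y = m div d})" if "d dvd m" for d
    using that m by (intro finite_cartesian_product A B) (auto elim!: dvdE)
  have img: "{(x, y). x \<in> A \<and> y \<in> B \<and> f x * h y = m} = snd ` ?S"
    using m by (auto simp: image_iff)
  show "finite {(x, y). x \<in> A \<and> y \<in> B \<and> f x * h y = m}"
    unfolding img by (rule finite_imageI, rule finite_SigmaI) (use m fin in simp_all)
  have "dirichlet_conv (\<lambda>n. real (card {x \<in> A. f x = n})) (\<lambda>n. \<Sum>y | y \<in> B \<and> h y = n. w y) m =
    (\<Sum>d | d dvd m. \<Sum>(x, y)\<in>{x \<in> A. f x = d} \<times> {y \<in> B. h y = m div d}. w y)"
    unfolding dirichlet_conv_def by (intro sum.cong refl) (simp add: sum.cartesian_product[symmetric])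
  also have "\<dots> = (\<Sum>(d, x, y)\<in>?S. w y)"
    using fin m by (subst sum.Sigma) (auto simp: case_prod_unfold)
  also have "\<dots> = (\<Sum>(x, y) | x \<in> A \<and> y \<in> B \<and> f x * h y = m. w y)"
    by (rule sum.reindex_bij_witness[of _ "\<lambda>(x, y). (f x, x, y)" snd]) (use m in auto)
  finally show "dirichlet_conv (\<lambda>n. real (card {x \<in> A. f x = n})) (\<lambda>n. \<Sum>y | y \<in> B \<and> h y = n. w y) m =
    (\<Sum>(x, y) | x \<in> A \<and> y \<in> B \<and> f x * h y = m. w y)" .
qed

text \<open>This is how lattices are counted through their bases: each basis carries the inverse of
  the number of bases of its lattice.\<close>

lemma card_image_weighted:
  assumes "finite R"
  shows "real (card (f ` R)) = (\<Sum>x\<in>R. 1 / real (card {y \<in> R. f y = f x}))"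
proof -
  have "(\<Sum>x\<in>R. 1 / real (card {y \<in> R. f y = f x})) = (\<Sum>z\<in>f ` R. \<Sum>x\<in>{x \<in> R. f x = z}. 1 / real (card {y \<in> R. f y = f x}))"
    using assms by (rule sum.image_gen)
  also have "\<dots> = (\<Sum>z\<in>f ` R. 1)"
  proof (intro sum.cong refl)
    fix z assume "z \<in> f ` R"
    hence "card {x \<in> R. f x = z} > 0" using assms by (auto simp: card_gt_0_iff)
    thus "(\<Sum>x\<in>{x \<in> R. f x = z}. 1 / real (card {y \<in> R. f y = f x})) = 1" by simp
  qed
  finally show ?thesis by simp
qed

section \<open>Orthogonal vectors and their dependence on the residue class\<close>

context pos_def_form
begin

definition bf :: "int \<times> int \<Rightarrow> int \<times> int \<Rightarrow> int" where
  "bf v w = \<alpha> * fst v * fst w + \<beta> * (fst v * snd w + snd v * fst w) + \<gamma> * snd v * snd w"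

text \<open>\<open>X v\<close> and \<open>Y v\<close> are the coordinates of the Gram matrix applied
  to \<open>v\<close>, so that \<open>bf v w = X v * fst w + Y v * snd w\<close>.\<close>

definition X :: "int \<times> int \<Rightarrow> int" where "X v = \<alpha> * fst v + \<beta> * snd v"
definition Y :: "int \<times> int \<Rightarrow> int" where "Y v = \<beta> * fst v + \<gamma> * snd v"

text \<open>With \<open>D\<close> included, \<open>G\<close> depends only on \<open>v\<close> modulo
  \<open>D\<close>, also when the chosen representative of a class is not primitive. For primitive
  vectors it is the gcd of \<open>X v\<close> and \<open>Y v\<close>.\<close>

definition G :: "int \<times> int \<Rightarrow> int" where "G v = gcd (gcd (X v) (Y v)) D"

text \<open>For primitive \<open>v\<close> this is the primitive vector orthogonal to \<open>v\<close>.\<close>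

definition orth :: "int \<times> int \<Rightarrow> int \<times> int" where "orth v = (- (Y v div G v), X v div G v)"

lemma G_pos: "G v > 0" using D_pos by (simp add: G_def)

lemma G_dvd: "G v dvd X v" "G v dvd Y v" "G v dvd D"
  unfolding G_def using gcd_dvd1 gcd_dvd2 dvd_trans by blast+

lemma G_orth: "G v * fst (orth v) = - Y v" "G v * snd (orth v) = X v"
  using G_dvd[of v] by (simp_all add: orth_def)

text \<open>All three are polynomial identities for the vector \<open>(- Y v, X v)\<close>, which is
  \<open>G v\<close> times \<open>orth v\<close>. The second is the one that later removes
  \<open>q v\<close> from the conditions on the shape.\<close>

lemma orth_facts:
  shows "G v * idet v (orth v) = q v" "(G v)\<^sup>2 * q (orth v) = D * q v" "bf v (orth v) = 0"
proof -
  have "G v * idet v (orth v) = fst v * (G v * snd (orth v)) - snd v * (G v * fst (orth v))"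
    by (simp add: idet_def algebra_simps)
  thus "G v * idet v (orth v) = q v" unfolding G_orth
    by (simp add: X_def Y_def q_def power2_eq_square algebra_simps)
  have "(G v)\<^sup>2 * q (orth v) = q (G v * fst (orth v), G v * snd (orth v))"
    by (simp add: q_scale)
  also have "\<dots> = D * q v" unfolding G_orth
    by (simp add: X_def Y_def q_def D_def power2_eq_square algebra_simps)
  finally show "(G v)\<^sup>2 * q (orth v) = D * q v" .
  have "G v * bf v (orth v) = X v * (G v * fst (orth v)) + Y v * (G v * snd (orth v))"
    by (simp add: bf_def X_def Y_def algebra_simps)
  hence "G v * bf v (orth v) = 0" unfolding G_orth by (simp add: algebra_simps)
  thus "bf v (orth v) = 0" using G_pos[of v] by simp
qed

text \<open>By the adjugate matrix, \<open>D\<close> times \<open>v\<close> is an integral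
  combination of \<open>X v\<close> and \<open>Y v\<close>, so for primitive \<open>v\<close> their
  gcd divides \<open>D\<close>.\<close>

lemma G_primitive:
  assumes "gcd (fst v) (snd v) = 1" shows "G v = gcd (X v) (Y v)"
proof -
  let ?g = "gcd (X v) (Y v)"
  have "D * fst v = \<gamma> * X v - \<beta> * Y v" "D * snd v = \<alpha> * Y v - \<beta> * X v"
    by (simp_all add: D_def X_def Y_def power2_eq_square algebra_simps)
  hence "?g dvd D * fst v" "?g dvd D * snd v" by simp_all
  hence "?g dvd gcd (D * fst v) (D * snd v)" by simp
  also have "\<dots> = D" using assms D_pos by (simp add: gcd_mult_left)
  finally show ?thesis by (simp add: G_def gcd_proj1_iff)
qed

text \<open>After division by \<open>G u\<close> the orthogonality relation has coprime
  coefficients, so its integral solutions are the multiples of one vector.\<close>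

lemma orthogonal_multiple:
  assumes prim: "gcd (fst u) (snd u) = 1" and orth: "bf u b = 0"
  shows "\<exists>l. fst b = l * fst (orth u) \<and> snd b = l * snd (orth u)"
proof -
  define s t where "s = X u div G u" and "t = Y u div G u"
  have st: "X u = G u * s" "Y u = G u * t" using G_dvd[of u] by (simp_all add: s_def t_def)
  have "X u * fst b + Y u * snd b = 0" using orth by (simp add: bf_def X_def Y_def algebra_simps)
  hence "G u * (s * fst b + t * snd b) = 0" unfolding st by (simp add: algebra_simps)
  hence 0: "s * fst b + t * snd b = 0" using G_pos[of u] by simp
  have "gcd (G u * s) (G u * t) = G u * gcd s t" using G_pos[of u] by (simp add: gcd_mult_left)
  moreover have "gcd (G u * s) (G u * t) = G u" using G_primitive[OF prim] st by simp
  ultimately have "gcd s t = 1" using G_pos[of u] by simp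
  then obtain x y where xy: "x * s + y * t = 1" using bezout_int[of s t] by auto
  \<comment> \<open>The Bezout coefficients of \<open>s\<close> and \<open>t\<close> recover the
    multiplier from the two coordinates of \<open>b\<close>.\<close>
  define l where "l = x * snd b - y * fst b"
  have "l * s = snd b * (x * s + y * t) - y * (s * fst b + t * snd b)" by (simp add: l_def algebra_simps)
  moreover have "l * (- t) = fst b * (x * s + y * t) - x * (s * fst b + t * snd b)" by (simp add: l_def algebra_simps)
  ultimately have "snd b = l * s" "fst b = l * (- t)" using xy 0 by simp_all
  thus ?thesis unfolding orth_def s_def[symmetric] t_def[symmetric] by auto
qed

lemma X_cong: "[fst v = fst c] (mod m) \<Longrightarrow> [snd v = snd c] (mod m) \<Longrightarrow> [X v = X c] (mod m)"
  and Y_cong: "[fst v = fst c] (mod m) \<Longrightarrow> [snd v = snd c] (mod m) \<Longrightarrow> [Y v = Y c] (mod m)"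
  unfolding X_def Y_def by (intro cong_add cong_scalar_left; assumption)+

text \<open>This is the reason for the modulus \<open>2 * D\<close>: as \<open>G c\<close> divides
  \<open>D\<close>, dividing a congruence modulo \<open>2 * D\<close> by \<open>G c\<close> still
  leaves one modulo 2.\<close>

lemma G_orth_cong:
  assumes "[fst v = fst c] (mod 2 * D)" "[snd v = snd c] (mod 2 * D)"
  shows "G v = G c" "[fst (orth v) = fst (orth c)] (mod 2)" "[snd (orth v) = snd (orth c)] (mod 2)"
proof -
  have XY: "[X v = X c] (mod 2 * D)" "[Y v = Y c] (mod 2 * D)" using assms X_cong Y_cong by blast+
  have XY': "[X v = X c] (mod D)" "[Y v = Y c] (mod D)" using XY cong_dvd_modulus dvd_triv_right by blast+
  have "G v = gcd (gcd (X v) D) (gcd (Y v) D)" for v by (simp add: G_def gcd.assoc gcd.commute gcd.left_commute)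
  thus G: "G v = G c" using cong_gcd_eq[OF XY'(1)] cong_gcd_eq[OF XY'(2)] by simp
  obtain h where h: "D = G c * h" using G_dvd(3)[of c] by blast
  have even: "[a div G c = b div G c] (mod 2)" if h': "[a = b] (mod 2 * D)" "G c dvd a" "G c dvd b" for a b
  proof -
    obtain a' where a: "a = G c * a'" using h'(2) by (rule dvdE)
    obtain b' where b: "b = G c * b'" using h'(3) by (rule dvdE)
    note ab = a b
    obtain k where "a - b = 2 * D * k" using h'(1) unfolding cong_iff_dvd_diff by (rule dvdE)
    hence "G c * (a' - b') = G c * (2 * h * k)" using ab h by (simp add: algebra_simps)
    hence "a' - b' = 2 * (h * k)" using G_pos[of c] by simp
    hence "[a' = b'] (mod 2)" by (simp add: cong_iff_dvd_diff)
    thus ?thesis using ab G_pos[of c] by simp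
  qed
  show "[fst (orth v) = fst (orth c)] (mod 2)" "[snd (orth v) = snd (orth c)] (mod 2)"
    using even[OF XY(1)] even[OF XY(2)] G_dvd[of v] G_dvd[of c] unfolding orth_def G by (simp_all add: cong_minus_minus_iff)
qed

section \<open>Bases described by a primitive vector and a shape\<close>

text \<open>The condition for half the sum and half the difference of \<open>k\<close> times
  \<open>c\<close> and \<open>l\<close> times \<open>orth c\<close> to be integral.\<close>

definition par :: "int \<times> int \<Rightarrow> int \<Rightarrow> int \<Rightarrow> bool" where
  "par c k l \<longleftrightarrow> [k * fst c = l * fst (orth c)] (mod 2) \<and> [k * snd c = l * snd (orth c)] (mod 2)"

text \<open>The inequalities between the squared lengths of \<open>k u\<close> and
  \<open>l u'\<close> and 3 times each other, multiplied by \<open>(G c)\<^sup>2\<close> and divided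
  by the common factor \<open>q u\<close>. They confine the slope of \<open>(k, l)\<close> to an
  interval.\<close>

definition wide :: "int \<times> int \<Rightarrow> int \<Rightarrow> int \<Rightarrow> bool" where
  "wide c k l \<longleftrightarrow> k\<^sup>2 * (G c)\<^sup>2 \<le> 3 * D * l\<^sup>2 \<and> D * l\<^sup>2 \<le> 3 * (k\<^sup>2 * (G c)\<^sup>2)"

text \<open>Within \<open>wide\<close>, the two boundary rays: angles of exactly 60 or 120
  degrees.\<close>

definition hex :: "int \<times> int \<Rightarrow> int \<Rightarrow> int \<Rightarrow> bool" where
  "hex c k l \<longleftrightarrow> k\<^sup>2 * (G c)\<^sup>2 = 3 * D * l\<^sup>2 \<or> D * l\<^sup>2 = 3 * (k\<^sup>2 * (G c)\<^sup>2)"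

definition shapes :: "int \<times> int \<Rightarrow> (int \<times> int) set" where
  "shapes c = {(k, l). k > 0 \<and> l > 0 \<and> par c k l \<and> wide c k l}"

definition shape_weight :: "int \<times> int \<Rightarrow> int \<times> int \<Rightarrow> real" where
  "shape_weight c p = (if hex c (fst p) (snd p) then 1/3 else 1)"

lemma shapes_cong:
  assumes "[fst v = fst c] (mod 2 * D)" "[snd v = snd c] (mod 2 * D)"
  shows "shapes v = shapes c" "shape_weight v = shape_weight c"
proof -
  note G = G_orth_cong[OF assms]
  have c2: "[fst v = fst c] (mod 2)" "[snd v = snd c] (mod 2)" using assms cong_dvd_modulus dvd_triv_left by blast+
  have "par v k l \<longleftrightarrow> par c k l" for k l
  proof -
    have "[k * fst v = k * fst c] (mod 2)" "[k * snd v = k * snd c] (mod 2)"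
      "[l * fst (orth v) = l * fst (orth c)] (mod 2)" "[l * snd (orth v) = l * snd (orth c)] (mod 2)"
      by (rule cong_scalar_left[OF c2(1)] cong_scalar_left[OF c2(2)] cong_scalar_left[OF G(2)] cong_scalar_left[OF G(3)])+
    thus ?thesis unfolding par_def cong_def by (simp only:)
  qed
  thus "shapes v = shapes c" by (simp add: shapes_def wide_def G(1))
  show "shape_weight v = shape_weight c" by (simp add: fun_eq_iff shape_weight_def hex_def G(1))
qed

lemma q_add: "q (p + r) = q p + q r + 2 * bf p r" and q_diff: "q (r - p) = q p + q r - 2 * bf p r"
  and bf_add_diff: "bf (p + r) (r - p) = q r - q p" and idet_add_diff: "idet (p + r) (r - p) = 2 * idet p r"
  and det_identity: "D * (idet p r)\<^sup>2 = q p * q r - (bf p r)\<^sup>2"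
  by (simp_all add: q_def bf_def idet_def D_def power2_eq_square algebra_simps)

text \<open>Translates properties of the basis \<open>(p, r)\<close> into its orthogonal diagonals
  \<open>p + r\<close> and \<open>r - p\<close>: equal lengths are orthogonality, and the angle
  condition compares the lengths of the diagonals.\<close>

lemma pair_of_shape:
  assumes u: "u \<noteq> (0, 0)" and a: "p + r = (k * fst u, k * snd u)" and b: "r - p = (l * fst (orth u), l * snd (orth u))"
  shows "q p = q r" "2 * G u * idet p r = k * l * q u"
    "2 * \<bar>bf p r\<bar> \<le> q p \<longleftrightarrow> wide u k l" "2 * \<bar>bf p r\<bar> = q p \<longleftrightarrow> hex u k l"
proof -
  have "bf (p + r) (r - p) = k * l * bf u (orth u)" unfolding a b by (simp add: bf_def algebra_simps)
  thus qq: "q p = q r" using bf_add_diff[of p r] orth_facts(3)[of u] by simp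
  have "idet (p + r) (r - p) = k * l * idet u (orth u)" unfolding a b by (simp add: idet_def algebra_simps)
  hence "G u * (2 * idet p r) = k * l * (G u * idet u (orth u))" unfolding idet_add_diff by simp
  thus "2 * G u * idet p r = k * l * q u" unfolding orth_facts by (simp add: mult_ac)
  have qa: "q (p + r) = k\<^sup>2 * q u" unfolding a by (simp add: q_scale)
  have "(G u)\<^sup>2 * q (r - p) = l\<^sup>2 * ((G u)\<^sup>2 * q (orth u))" unfolding b by (simp add: q_scale)
  hence qb: "(G u)\<^sup>2 * q (r - p) = l\<^sup>2 * D * q u" unfolding orth_facts by simp
  have G2: "(G u)\<^sup>2 > 0" and qu: "q u > 0" using G_pos[of u] q_pos[OF u] by auto
  have A: "(2 * bf p r + 2 * q p) = k\<^sup>2 * q u" using q_add[of p r] qa qq by simp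
  have B: "(G u)\<^sup>2 * (2 * q p - 2 * bf p r) = l\<^sup>2 * D * q u" using q_diff[of r p] qb qq by simp
  \<comment> \<open>The bracket is \<open>4 * (q p - 2 * bf p r)\<close>, and in \<open>e2\<close>
    it is \<open>4 * (q p + 2 * bf p r)\<close>. Both are positive multiples of one side of the
    shape condition, so signs and zeros agree.\<close>
  have e1: "(G u)\<^sup>2 * (3 * (2 * q p - 2 * bf p r) - (2 * bf p r + 2 * q p)) = q u * (3 * D * l\<^sup>2 - k\<^sup>2 * (G u)\<^sup>2)"
  proof -
    have "(G u)\<^sup>2 * (3 * (2 * q p - 2 * bf p r) - (2 * bf p r + 2 * q p)) = 3 * ((G u)\<^sup>2 * (2 * q p - 2 * bf p r)) - (G u)\<^sup>2 * (2 * bf p r + 2 * q p)"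
      by (simp add: algebra_simps)
    thus ?thesis unfolding A B by (simp add: algebra_simps)
  qed
  have e2: "(G u)\<^sup>2 * (3 * (2 * bf p r + 2 * q p) - (2 * q p - 2 * bf p r)) = q u * (3 * (k\<^sup>2 * (G u)\<^sup>2) - D * l\<^sup>2)"
  proof -
    have "(G u)\<^sup>2 * (3 * (2 * bf p r + 2 * q p) - (2 * q p - 2 * bf p r)) = 3 * ((G u)\<^sup>2 * (2 * bf p r + 2 * q p)) - (G u)\<^sup>2 * (2 * q p - 2 * bf p r)"
      by (simp add: algebra_simps)
    thus ?thesis unfolding A B by (simp add: algebra_simps)
  qed
  have sgn_iff: "(0 \<le> s \<longleftrightarrow> 0 \<le> t) \<and> (s = 0 \<longleftrightarrow> t = 0)" if "(G u)\<^sup>2 * s = q u * t" for s t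
  proof -
    have s: "0 \<le> s \<longleftrightarrow> 0 \<le> (G u)\<^sup>2 * s" "s = 0 \<longleftrightarrow> (G u)\<^sup>2 * s = 0" using G2 by (auto simp: zero_le_mult_iff)
    have t: "0 \<le> t \<longleftrightarrow> 0 \<le> q u * t" "t = 0 \<longleftrightarrow> q u * t = 0" using qu by (auto simp: zero_le_mult_iff)
    show ?thesis using s t unfolding that by metis
  qed
  note s1 = sgn_iff[OF e1] and s2 = sgn_iff[OF e2]
  have w: "2 * \<bar>bf p r\<bar> \<le> q p \<longleftrightarrow> 0 \<le> 3 * (2 * q p - 2 * bf p r) - (2 * bf p r + 2 * q p) \<and>
      0 \<le> 3 * (2 * bf p r + 2 * q p) - (2 * q p - 2 * bf p r)" by arith
  show "2 * \<bar>bf p r\<bar> \<le> q p \<longleftrightarrow> wide u k l" unfolding w s1[THEN conjunct1] s2[THEN conjunct1] wide_def by simp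
  have "q p \<ge> 0" by (rule q_nonneg)
  hence h: "2 * \<bar>bf p r\<bar> = q p \<longleftrightarrow> 3 * (2 * q p - 2 * bf p r) - (2 * bf p r + 2 * q p) = 0 \<or>
      3 * (2 * bf p r + 2 * q p) - (2 * q p - 2 * bf p r) = 0" by arith
  show "2 * \<bar>bf p r\<bar> = q p \<longleftrightarrow> hex u k l" unfolding h s1[THEN conjunct2] s2[THEN conjunct2] hex_def by auto
qed

definition oriented_pairs :: "int \<Rightarrow> ((int \<times> int) \<times> (int \<times> int)) set" where
  "oriented_pairs n = {(p, r). q p = q r \<and> 2 * \<bar>bf p r\<bar> \<le> q p \<and> idet p r = n}"

text \<open>The weights are proportional to the inverse number of reduced bases of the lattice: a
  hexagonal lattice has 24 of them, any other well-rounded lattice has 8.\<close>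

definition pair_weight :: "(int \<times> int) \<times> (int \<times> int) \<Rightarrow> real" where
  "pair_weight x = (if 2 * \<bar>bf (fst x) (snd x)\<bar> = q (fst x) then 1/3 else 1)"

text \<open>The equation makes the determinant of the attached basis equal to \<open>n\<close>; the
  factor 2 arises because the diagonals span twice the area of the basis.\<close>

definition shape_data :: "int \<Rightarrow> ((int \<times> int) \<times> (int \<times> int)) set" where
  "shape_data n = {(u, s). gcd (fst u) (snd u) = 1 \<and> s \<in> shapes u \<and> q u * (fst s * snd s) = 2 * G u * n}"

text \<open>Recovers \<open>p\<close> and \<open>r\<close> from the diagonals \<open>p + r\<close>
  and \<open>r - p\<close>. The division by 2 is exact when \<open>par\<close> holds.\<close>

definition pair_of :: "(int \<times> int) \<times> (int \<times> int) \<Rightarrow> (int \<times> int) \<times> (int \<times> int)" where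
  "pair_of x = (case x of (u, (k, l)) \<Rightarrow>
     let p = ((k * fst u - l * fst (orth u)) div 2, (k * snd u - l * snd (orth u)) div 2)
     in (p, p + (l * fst (orth u), l * snd (orth u))))"

lemma pair_of_eqs:
  assumes "par u k l" "pair_of (u, (k, l)) = (p, r)"
  shows "p + r = (k * fst u, k * snd u)" "r - p = (l * fst (orth u), l * snd (orth u))"
proof -
  have ev: "2 dvd k * fst u - l * fst (orth u)" "2 dvd k * snd u - l * snd (orth u)"
    using assms(1) by (auto simp: par_def cong_iff_dvd_diff)
  have p': "fst p = (k * fst u - l * fst (orth u)) div 2" "snd p = (k * snd u - l * snd (orth u)) div 2"
    using assms(2) by (auto simp: pair_of_def Let_def)
  have p: "2 * fst p = k * fst u - l * fst (orth u)" "2 * snd p = k * snd u - l * snd (orth u)"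
    unfolding p' using ev by (simp_all only: dvd_mult_div_cancel)
  have r: "r = p + (l * fst (orth u), l * snd (orth u))" using assms(2) by (auto simp: pair_of_def Let_def)
  show "r - p = (l * fst (orth u), l * snd (orth u))" using r by simp
  show "p + r = (k * fst u, k * snd u)" using p r by (simp add: prod_eq_iff)
qed

lemma primitive_multiple_unique:
  fixes u u' :: "int \<times> int"
  assumes "gcd (fst u) (snd u) = 1" "gcd (fst u') (snd u') = 1" "k > 0" "k' > 0"
    and "(k * fst u, k * snd u) = (k' * fst u', k' * snd u')"
  shows "k = k' \<and> u = u'"
proof -
  have "gcd (k * fst u) (k * snd u) = k" "gcd (k' * fst u') (k' * snd u') = k'"
    using assms(1-4) by (simp_all add: gcd_mult_left)
  hence "k = k'" using assms(5) by simp
  thus ?thesis using assms(3,5) by (simp add: prod_eq_iff)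
qed

lemma orth_nonzero: "u \<noteq> (0, 0) \<Longrightarrow> orth u \<noteq> (0, 0)"
proof
  assume "u \<noteq> (0, 0)" "orth u = (0, 0)"
  hence "q u = 0" using orth_facts(1)[of u] by (simp add: idet_def)
  thus False using q_pos[OF \<open>u \<noteq> (0, 0)\<close>] by simp
qed

text \<open>Requiring \<open>k > 0\<close> fixes the sign of \<open>u\<close>, so \<open>k\<close>
  and \<open>u\<close> are determined by \<open>p + r\<close>. The orientation \<open>n > 0\<close>
  then forces \<open>l > 0\<close>.\<close>

lemma pair_of_bij:
  assumes n: "n > 0"
  shows "bij_betw pair_of (shape_data n) (oriented_pairs n)"
    and "x \<in> shape_data n \<Longrightarrow> pair_weight (pair_of x) = shape_weight (fst x) (snd x)"
proof -
  have nz: "u \<noteq> (0, 0)" if "gcd (fst u) (snd u) = 1" for u :: "int \<times> int" using that by auto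
  have fwd: "pair_of (u, (k, l)) \<in> oriented_pairs n \<and> pair_weight (pair_of (u, (k, l))) = shape_weight u (k, l)"
    if x: "(u, (k, l)) \<in> shape_data n" for u k l
  proof -
    obtain p r where pr: "pair_of (u, (k, l)) = (p, r)" by (rule prod.exhaust)
    have h: "gcd (fst u) (snd u) = 1" "par u k l" "wide u k l" "q u * (k * l) = 2 * G u * n"
      using x by (auto simp: shape_data_def shapes_def)
    note f = pair_of_shape[OF nz[OF h(1)] pair_of_eqs[OF h(2) pr]]
    have "G u * idet p r = G u * n" using f(2) h(4) by (simp add: mult_ac)
    hence "idet p r = n" using G_pos[of u] by simp
    thus ?thesis using f h(3) by (simp add: pr oriented_pairs_def pair_weight_def shape_weight_def)
  qed
  thus "pair_weight (pair_of x) = shape_weight (fst x) (snd x)" if "x \<in> shape_data n"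
    using that by (cases x; cases "snd x") auto
  have inj: "inj_on pair_of (shape_data n)"
  proof (rule inj_onI)
    fix x x' assume x: "x \<in> shape_data n" and x': "x' \<in> shape_data n" and eq: "pair_of x = pair_of x'"
    obtain u k l where xe: "x = (u, (k, l))" by (metis prod.collapse)
    obtain u' k' l' where xe': "x' = (u', (k', l'))" by (metis prod.collapse)
    obtain p r where pr: "pair_of x = (p, r)" by (rule prod.exhaust)
    have h: "gcd (fst u) (snd u) = 1" "par u k l" "k > 0" using x by (auto simp: xe shape_data_def shapes_def)
    have h': "gcd (fst u') (snd u') = 1" "par u' k' l'" "k' > 0" using x' by (auto simp: xe' shape_data_def shapes_def)
    note e = pair_of_eqs[OF h(2) pr[unfolded xe]]
    note e' = pair_of_eqs[OF h'(2) pr[unfolded eq xe']]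
    have ku: "k = k' \<and> u = u'" using primitive_multiple_unique[OF h(1) h'(1) h(3) h'(3)] e(1) e'(1) by simp
    hence "l * fst (orth u) = l' * fst (orth u)" "l * snd (orth u) = l' * snd (orth u)" using e(2) e'(2) by auto
    moreover have "orth u \<noteq> (0, 0)" using orth_nonzero nz[OF h(1)] by blast
    ultimately have "l = l'" by (auto simp: prod_eq_iff)
    thus "x = x'" using ku by (simp add: xe xe')
  qed
  have surj: "\<exists>x\<in>shape_data n. y = pair_of x" if y: "y \<in> oriented_pairs n" for y
  proof -
    obtain p r where ye: "y = (p, r)" by (rule prod.exhaust)
    have h: "q p = q r" "2 * \<bar>bf p r\<bar> \<le> q p" "idet p r = n" using y by (auto simp: ye oriented_pairs_def)
    define a b where "a = p + r" and "b = r - p"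
    have dab: "idet a b = 2 * n" using idet_add_diff[of p r] h(3) by (simp add: a_def b_def)
    hence a0: "a \<noteq> (0, 0)" using n by (auto simp: idet_def)
    \<comment> \<open>The content of the diagonal \<open>p + r\<close>; its primitive part is
      \<open>u\<close>.\<close>
    define k where "k = gcd (fst a) (snd a)"
    have k0: "k > 0" using a0 by (cases a) (auto simp: k_def)
    define u where "u = (fst a div k, snd a div k)"
    have au: "a = (k * fst u, k * snd u)" by (simp add: u_def k_def prod_eq_iff)
    have pu: "gcd (fst u) (snd u) = 1"
    proof -
      have "gcd (fst a) (snd a) = gcd (k * fst u) (k * snd u)" by (subst au, subst au) simp
      hence "k = k * gcd (fst u) (snd u)" using k0 by (simp add: k_def[symmetric] gcd_mult_left)
      thus ?thesis using k0 by simp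
    qed
    have "bf a b = k * bf u b" unfolding au by (simp add: bf_def algebra_simps)
    moreover have "bf a b = 0" using bf_add_diff[of p r] h(1) by (simp add: a_def b_def)
    ultimately have "bf u b = 0" using k0 by simp
    then obtain l where "fst b = l * fst (orth u)" "snd b = l * snd (orth u)" using orthogonal_multiple[OF pu] by blast
    hence bl: "b = (l * fst (orth u), l * snd (orth u))" by (simp add: prod_eq_iff)
    note f = pair_of_shape[OF nz[OF pu] au[unfolded a_def] bl[unfolded b_def]]
    have klq: "k * l * q u = 2 * G u * n" using f(2) h(3) by simp
    have "k * l * q u > 0" unfolding klq using G_pos[of u] n by simp
    hence l0: "l > 0" using k0 q_pos[OF nz[OF pu]] by (simp add: zero_less_mult_iff)
    have par: "par u k l"
    proof -
      have "k * fst u - l * fst (orth u) = fst a - fst b" "k * snd u - l * snd (orth u) = snd a - snd b"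
        using au bl by (metis fst_conv snd_conv)+
      moreover have "fst a - fst b = 2 * fst p" "snd a - snd b = 2 * snd p" by (simp_all add: a_def b_def)
      ultimately show ?thesis by (simp add: par_def cong_iff_dvd_diff)
    qed
    have x: "(u, (k, l)) \<in> shape_data n"
      using pu k0 l0 par f(3) h(2) klq by (simp add: shape_data_def shapes_def mult_ac)
    obtain p' r' where pr': "pair_of (u, (k, l)) = (p', r')" by (rule prod.exhaust)
    note e = pair_of_eqs[OF par pr']
    have "p' + r' = p + r" "r' - p' = r - p" using e au bl by (simp_all add: a_def b_def)
    hence "p' = p \<and> r' = r" by (auto simp: prod_eq_iff)
    hence "y = pair_of (u, (k, l))" using pr' ye by simp
    thus ?thesis using x by (rule bexI)
  qed
  show "bij_betw pair_of (shape_data n) (oriented_pairs n)"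
    unfolding bij_betw_def
  proof (intro conjI inj equalityI subsetI)
    fix y assume "y \<in> pair_of ` shape_data n"
    then obtain u k l where "y = pair_of (u, (k, l))" "(u, (k, l)) \<in> shape_data n" by (metis imageE prod.collapse)
    thus "y \<in> oriented_pairs n" using fwd by blast
  next
    fix y assume "y \<in> oriented_pairs n" thus "y \<in> pair_of ` shape_data n" using surj by blast
  qed
qed

lemma sum_oriented_pairs:
  assumes "n > 0"
  shows "(\<Sum>x\<in>oriented_pairs n. pair_weight x) = (\<Sum>x\<in>shape_data n. shape_weight (fst x) (snd x))"
  using sum.reindex_bij_betw[OF pair_of_bij(1)[OF assms], of pair_weight] pair_of_bij(2)[OF assms]
  by (metis (no_types, lifting) sum.cong)

end

section \<open>Splitting by the residue class of the primitive vector\<close>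

context pos_def_form
begin

definition primitives :: "int \<times> int \<Rightarrow> (int \<times> int) set" where
  "primitives c = {v. [fst v = fst c] (mod 2 * D) \<and> [snd v = snd c] (mod 2 * D) \<and> gcd (fst v) (snd v) = 1}"

definition primitive_count :: "int \<times> int \<Rightarrow> nat \<Rightarrow> real" where
  "primitive_count c n = real (card {v \<in> primitives c. nat (q v) = n})"

definition shape_count :: "int \<times> int \<Rightarrow> nat \<Rightarrow> real" where
  "shape_count c n = (\<Sum>s | s \<in> shapes c \<and> nat (fst s * snd s) = n. shape_weight c s)"

definition residues :: "(int \<times> int) set" where
  "residues = {0..<2 * D} \<times> {0..<2 * D}"

lemma finite_primitives: "finite {v \<in> primitives c. nat (q v) = n}"
  by (rule finite_subset[OF _ finite_q_le[of "real n"]]) (use q_nonneg in \<open>auto simp: nat_eq_iff\<close>)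

lemma finite_shapes: "n > 0 \<Longrightarrow> finite {s \<in> shapes c. nat (fst s * snd s) = n}"
proof (rule finite_subset)
  assume n: "n > 0"
  show "{s \<in> shapes c. nat (fst s * snd s) = n} \<subseteq> {0..int n} \<times> {0..int n}"
  proof
    fix s assume "s \<in> {s \<in> shapes c. nat (fst s * snd s) = n}"
    then obtain k l where s: "s = (k, l)" "k > 0" "l > 0" "k * l = int n" by (auto simp: shapes_def)
    have "k * 1 \<le> k * l" "1 * l \<le> k * l" using s by (intro mult_left_mono mult_right_mono; simp)+
    thus "s \<in> {0..int n} \<times> {0..int n}" using s by auto
  qed
qed auto

text \<open>The quotient is the determinant of an integral basis. It guarantees that the convolution
  vanishes off the multiples of \<open>2 * G c\<close>.\<close>

lemma shape_product_dvd:
  assumes "u \<in> primitives c" "s \<in> shapes c"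
  shows "2 * G c dvd q u * (fst s * snd s)"
proof -
  obtain k l where s: "s = (k, l)" by (rule prod.exhaust)
  have c: "[fst u = fst c] (mod 2 * D)" "[snd u = snd c] (mod 2 * D)" and pr: "gcd (fst u) (snd u) = 1"
    using assms(1) by (auto simp: primitives_def)
  have par: "par u k l" using assms(2) shapes_cong(1)[OF c] by (auto simp: s shapes_def)
  obtain p r where pe: "pair_of (u, (k, l)) = (p, r)" by (rule prod.exhaust)
  have "u \<noteq> (0, 0)" using pr by auto
  hence "2 * G u * idet p r = k * l * q u" using pair_of_eqs[OF par pe] by (rule pair_of_shape(2))
  hence "q u * (fst s * snd s) = 2 * G c * idet p r" using G_orth_cong(1)[OF c] by (simp add: s mult_ac)
  thus ?thesis by simp
qed

lemma conv_counts_eq: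
  assumes "m > 0"
  shows "dirichlet_conv (primitive_count c) (shape_count c) m =
    (\<Sum>(u, s) | u \<in> primitives c \<and> s \<in> shapes c \<and> nat (q u) * nat (fst s * snd s) = m. shape_weight c s)"
    and "finite {(u, s). u \<in> primitives c \<and> s \<in> shapes c \<and> nat (q u) * nat (fst s * snd s) = m}"
proof -
  have eq: "primitive_count c = (\<lambda>n. real (card {v \<in> primitives c. nat (q v) = n}))"
    "shape_count c = (\<lambda>n. \<Sum>s | s \<in> shapes c \<and> nat (fst s * snd s) = n. shape_weight c s)"
    by (simp_all add: fun_eq_iff primitive_count_def shape_count_def)
  show "dirichlet_conv (primitive_count c) (shape_count c) m =
    (\<Sum>(u, s) | u \<in> primitives c \<and> s \<in> shapes c \<and> nat (q u) * nat (fst s * snd s) = m. shape_weight c s)"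
    unfolding eq by (rule dirichlet_conv_counts(1)[OF assms finite_primitives finite_shapes])
  show "finite {(u, s). u \<in> primitives c \<and> s \<in> shapes c \<and> nat (q u) * nat (fst s * snd s) = m}"
    by (rule dirichlet_conv_counts(2)[OF assms finite_primitives finite_shapes])
qed

lemma conv_counts_multiples:
  assumes "m > 0" "\<not> nat (2 * G c) dvd m"
  shows "dirichlet_conv (primitive_count c) (shape_count c) m = 0"
proof -
  have empty: "{(u, s). u \<in> primitives c \<and> s \<in> shapes c \<and> nat (q u) * nat (fst s * snd s) = m} = {}"
  proof -
    have False if us: "u \<in> primitives c" "s \<in> shapes c" "nat (q u) * nat (fst s * snd s) = m" for u s
    proof -
      have "int m = q u * (fst s * snd s)"
        using us q_nonneg[of u] by (auto simp: shapes_def nat_mult_distrib[symmetric])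
      hence "int (nat (2 * G c)) dvd int m" using shape_product_dvd[OF us(1,2)] G_pos[of c] by simp
      thus False using assms(2) by (simp only: int_dvd_int_iff)
    qed
    thus ?thesis by blast
  qed
  show ?thesis unfolding conv_counts_eq[OF assms(1)] empty by simp
qed

text \<open>Within one class, \<open>G\<close>, the admissible shapes and their weights are
  constant. Vector and shape are then coupled only through the product of \<open>q u\<close> and
  \<open>k * l\<close>, which is a convolution.\<close>

lemma sum_shape_data:
  assumes n: "n > 0"
  shows "(\<Sum>x\<in>shape_data (int n). shape_weight (fst x) (snd x)) =
    (\<Sum>c\<in>residues. dirichlet_conv (primitive_count c) (shape_count c) (nat (2 * G c) * n))"
proof -
  let ?T = "\<lambda>c. {(u, s). u \<in> primitives c \<and> s \<in> shapes c \<and> nat (q u) * nat (fst s * snd s) = nat (2 * G c) * n}"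
  have fin: "finite (?T c)" for c using conv_counts_eq(2)[of "nat (2 * G c) * n" c] G_pos[of c] n by simp
  have D2: "2 * D > 0" using D_pos by simp
  have mem: "x \<in> ?T c \<longleftrightarrow> x \<in> shape_data (int n) \<and> fst (fst x) mod (2 * D) = fst c \<and> snd (fst x) mod (2 * D) = snd c"
    if c: "c \<in> residues" for x c
  proof -
    obtain u s where x: "x = (u, s)" by (rule prod.exhaust)
    have cm: "fst c mod (2 * D) = fst c" "snd c mod (2 * D) = snd c" using c by (auto simp: residues_def)
    have 1: "(u, s) \<in> ?T c \<longleftrightarrow> (u, s) \<in> shape_data (int n)"
      if cg: "[fst u = fst c] (mod 2 * D)" "[snd u = snd c] (mod 2 * D)"
    proof -
      note sc = shapes_cong(1)[OF cg] and G = G_orth_cong(1)[OF cg]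
      have "nat (q u) * nat (fst s * snd s) = nat (2 * G c) * n \<longleftrightarrow> q u * (fst s * snd s) = 2 * G u * int n" if "s \<in> shapes c"
      proof -
        have s0: "fst s * snd s \<ge> 0" using that by (auto simp: shapes_def)
        have "nat (q u) * nat (fst s * snd s) = nat (2 * G c) * n \<longleftrightarrow> int (nat (q u) * nat (fst s * snd s)) = int (nat (2 * G c) * n)"
          by (simp only: of_nat_eq_iff)
        thus ?thesis using s0 q_nonneg[of u] G_pos[of c] G by simp
      qed
      thus ?thesis using cg sc by (auto simp: shape_data_def primitives_def)
    qed
    have 2: "[fst u = fst c] (mod 2 * D) \<longleftrightarrow> fst u mod (2 * D) = fst c" "[snd u = snd c] (mod 2 * D) \<longleftrightarrow> snd u mod (2 * D) = snd c"
      using cm by (simp_all only: cong_def)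
    have 3: "(u, s) \<in> ?T c \<Longrightarrow> [fst u = fst c] (mod 2 * D) \<and> [snd u = snd c] (mod 2 * D)" by (simp add: primitives_def)
    show ?thesis unfolding x fst_conv 2[symmetric] using 1 3 by blast
  qed
  have finR: "finite residues" by (simp add: residues_def)
  have un: "shape_data (int n) = (\<Union>c\<in>residues. ?T c)"
  proof (intro equalityI subsetI)
    fix x assume x: "x \<in> shape_data (int n)"
    define c where "c = (fst (fst x) mod (2 * D), snd (fst x) mod (2 * D))"
    have c: "c \<in> residues" using D2 by (simp add: c_def residues_def)
    hence "x \<in> ?T c" using x unfolding mem[OF c] by (simp add: c_def)
    thus "x \<in> (\<Union>c\<in>residues. ?T c)" using c by blast
  next
    fix x assume "x \<in> (\<Union>c\<in>residues. ?T c)"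
    then obtain c where "c \<in> residues" "x \<in> ?T c" by (rule UN_E)
    thus "x \<in> shape_data (int n)" using mem by blast
  qed
  have dis: "?T c \<inter> ?T c' = {}" if "c \<in> residues" "c' \<in> residues" "c \<noteq> c'" for c c'
    using mem[OF that(1)] mem[OF that(2)] that(3) by (metis (no_types, lifting) disjoint_iff prod_eq_iff)
  have "(\<Sum>x\<in>shape_data (int n). shape_weight (fst x) (snd x)) = (\<Sum>c\<in>residues. \<Sum>x\<in>?T c. shape_weight (fst x) (snd x))"
    unfolding un using finR fin dis by (intro sum.UNION_disjoint) auto
  also have "\<dots> = (\<Sum>c\<in>residues. dirichlet_conv (primitive_count c) (shape_count c) (nat (2 * G c) * n))"
  proof (intro sum.cong refl)
    fix c
    have "(\<Sum>x\<in>?T c. shape_weight (fst x) (snd x)) = (\<Sum>(u, s)\<in>?T c. shape_weight c s)"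
      by (rule sum.cong) (auto simp: primitives_def shapes_cong(2))
    thus "(\<Sum>x\<in>?T c. shape_weight (fst x) (snd x)) = dirichlet_conv (primitive_count c) (shape_count c) (nat (2 * G c) * n)"
      using conv_counts_eq(1)[of "nat (2 * G c) * n" c] G_pos[of c] n by simp
  qed
  finally show ?thesis .
qed

text \<open>A factor common to both coordinates of \<open>c\<close> and to the modulus divides every
  vector of the class, so a class without coprimality contains no primitive vector.\<close>

lemma linear_growth_primitive_count:
  shows "\<exists>C. linear_growth (primitive_count c) C \<and> (gcd (gcd (fst c) (snd c)) (2 * D) = 1 \<longrightarrow> C > 0)"
proof (cases "gcd (gcd (fst c) (snd c)) (2 * D) = 1")
  case True
  have "2 * D \<ge> 1" using D_pos by simp
  from linear_growth_primitive[OF this True] show ?thesis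
    unfolding primitive_count_def primitives_def by (auto simp: conj_assoc)
next
  case False
  have "primitives c = {}"
  proof -
    have False if v: "v \<in> primitives c" for v
    proof -
      define h where "h = gcd (gcd (fst c) (snd c)) (2 * D)"
      have h: "h dvd fst c" "h dvd snd c" "h dvd 2 * D" unfolding h_def using dvd_trans gcd_dvd1 gcd_dvd2 by blast+
      have "[fst v = fst c] (mod h)" "[snd v = snd c] (mod h)" using v h(3) by (auto simp: primitives_def intro: cong_dvd_modulus)
      hence "h dvd fst v" "h dvd snd v" using h by (auto simp: cong_dvd_iff)
      hence "h dvd gcd (fst v) (snd v)" by (rule gcd_greatest)
      moreover have "gcd (fst v) (snd v) = 1" using v by (simp add: primitives_def)
      ultimately have "is_unit h" by (simp only:)
      thus False using False by (simp add: h_def)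
    qed
    thus ?thesis by blast
  qed
  hence "primitive_count c = (\<lambda>_. 0)" by (simp add: primitive_count_def fun_eq_iff)
  thus ?thesis using False linear_growth_zero by auto
qed

text \<open>Shapes are split by the parities of \<open>k\<close> and \<open>l\<close>, and the
  weight is 1/3 of the closed sector plus 2/3 of the open one. Each piece is a sector count.\<close>

lemma linear_growth_shape_count:
  shows "\<exists>C>0. linear_growth (shape_count c) C"
proof -
  \<comment> \<open>The square roots of the inequalities in \<open>wide\<close>, namely
    \<open>k * G c \<le> sqrt (3 * D) * l\<close> and
    \<open>sqrt D * l \<le> sqrt 3 * (k * G c)\<close>. The product of the two slopes is 3.\<close>
  define r where "r = sqrt (3 * D) / G c"
  define r' where "r' = sqrt 3 * G c / sqrt D"
  have G0: "real_of_int (G c) > 0" and D0: "real_of_int D > 0" using G_pos D_pos by simp_all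
  have r: "r > 0" "r' > 0" using G0 D0 by (simp_all add: r_def r'_def)
  have "r * r' = (sqrt 3)\<^sup>2" using G0 D0 by (simp add: r_def r'_def real_sqrt_mult power2_eq_square)
  hence rr: "r * r' > 1" by simp
  have cmp: "(x \<le> y \<longleftrightarrow> x\<^sup>2 \<le> y\<^sup>2) \<and> (x = y \<longleftrightarrow> x\<^sup>2 = y\<^sup>2)" if "x \<ge> 0" "y \<ge> 0" for x y :: real
    using that by (simp add: power2_eq_iff_nonneg abs_le_square_iff[symmetric])
  have k1: "(real_of_int k \<le> r * l \<longleftrightarrow> k\<^sup>2 * (G c)\<^sup>2 \<le> 3 * D * l\<^sup>2) \<and> (real_of_int k = r * l \<longleftrightarrow> k\<^sup>2 * (G c)\<^sup>2 = 3 * D * l\<^sup>2)"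
    if "k > 0" "l > 0" for k l :: int
  proof -
    have "(real_of_int k \<le> r * l \<longleftrightarrow> k * G c \<le> sqrt (3 * D) * l) \<and> (real_of_int k = r * l \<longleftrightarrow> k * G c = sqrt (3 * D) * l)"
      using G0 by (simp add: r_def field_simps)
    moreover have "(real_of_int (k * G c))\<^sup>2 = real_of_int (k\<^sup>2 * (G c)\<^sup>2)" "(sqrt (3 * D) * l)\<^sup>2 = real_of_int (3 * D * l\<^sup>2)"
      using D0 by (simp_all add: power_mult_distrib)
    moreover have "real_of_int (k * G c) \<ge> 0" "sqrt (3 * D) * l \<ge> 0" using that G0 D0 by simp_all
    ultimately show ?thesis using cmp[of "real_of_int (k * G c)" "sqrt (3 * D) * l"] by (simp only: of_int_le_iff of_int_eq_iff)
  qed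
  have k2: "(real_of_int l \<le> r' * k \<longleftrightarrow> D * l\<^sup>2 \<le> 3 * (k\<^sup>2 * (G c)\<^sup>2)) \<and> (real_of_int l = r' * k \<longleftrightarrow> D * l\<^sup>2 = 3 * (k\<^sup>2 * (G c)\<^sup>2))"
    if "k > 0" "l > 0" for k l :: int
  proof -
    have "(real_of_int l \<le> r' * k \<longleftrightarrow> sqrt D * l \<le> sqrt 3 * (k * G c)) \<and> (real_of_int l = r' * k \<longleftrightarrow> sqrt D * l = sqrt 3 * (k * G c))"
      using D0 by (simp add: r'_def field_simps)
    moreover have "(sqrt D * l)\<^sup>2 = real_of_int (D * l\<^sup>2)" "(sqrt 3 * (k * G c))\<^sup>2 = real_of_int (3 * (k\<^sup>2 * (G c)\<^sup>2))"
      using D0 by (simp_all add: power_mult_distrib)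
    moreover have "sqrt D * l \<ge> 0" "sqrt 3 * (k * G c) \<ge> 0" using that G0 D0 by simp_all
    ultimately show ?thesis using cmp[of "sqrt D * l" "sqrt 3 * (k * G c)"] by (simp only: of_int_le_iff of_int_eq_iff)
  qed
  define S where "S strict ij n = {p. [fst p = fst ij] (mod 2) \<and> [snd p = snd ij] (mod 2) \<and>
      (real_of_int (fst p), real_of_int (snd p)) \<in> sector strict r r' \<and> nat (fst p * snd p) = n}" for strict n and ij :: "int \<times> int"
  have closed_iff: "(real_of_int k, real_of_int l) \<in> sector False r r' \<longleftrightarrow> k > 0 \<and> l > 0 \<and> wide c k l" for k l
    using k1[of k l] k2[of k l] by (auto simp: sector_def wide_def)
  have strict_iff: "(real_of_int k, real_of_int l) \<in> sector True r r' \<longleftrightarrow> k > 0 \<and> l > 0 \<and> wide c k l \<and> \<not> hex c k l" for k l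
    using k1[of k l] k2[of k l] by (auto simp: sector_def wide_def hex_def less_le)
  define P where "P = {ij \<in> {0,1} \<times> {0,1}. par c (fst ij) (snd ij)}"
  have finP: "finite P" by (simp add: P_def)
  \<comment> \<open>Even \<open>k\<close> and \<open>l\<close> always satisfy the parity condition,
    so the total slope has at least one positive summand.\<close>
  have P0: "(0, 0) \<in> P" by (simp add: P_def par_def)
  have par_mod: "par c k l \<longleftrightarrow> par c (k mod 2) (l mod 2)" for k l
    unfolding par_def cong_def by (simp only: mod_mult_left_eq)
  have par_P: "par c k l \<longleftrightarrow> (k mod 2, l mod 2) \<in> P" for k l
    using par_mod[of k l] by (auto simp: P_def)
  have "shape_count c n = (\<Sum>ij\<in>P. 1/3 * real (card (S False ij n)) + 2/3 * real (card (S True ij n)))" if n: "n > 0" for n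
  proof -
    let ?A = "\<lambda>ij. {s. s \<in> shapes c \<and> nat (fst s * snd s) = n \<and> (fst s mod 2, snd s mod 2) = ij}"
    have fA: "finite (?A ij)" for ij by (rule finite_subset[OF _ finite_shapes[OF n, of c]]) auto
    have un: "{s. s \<in> shapes c \<and> nat (fst s * snd s) = n} = (\<Union>ij\<in>P. ?A ij)"
      using par_P by (auto simp: shapes_def)
    have "shape_count c n = (\<Sum>ij\<in>P. \<Sum>s\<in>?A ij. shape_weight c s)"
      unfolding shape_count_def un using finP fA by (intro sum.UNION_disjoint) auto
    also have "\<dots> = (\<Sum>ij\<in>P. 1/3 * real (card (S False ij n)) + 2/3 * real (card (S True ij n)))"
    proof (intro sum.cong refl)
      fix ij assume ij: "ij \<in> P"
      have m2: "[a = b] (mod 2) \<longleftrightarrow> a mod 2 = b" if "b \<in> {0, 1}" for a b :: int using that by (auto simp: cong_def)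
      have ij2: "fst ij \<in> {0, 1}" "snd ij \<in> {0, 1}" using ij by (auto simp: P_def)
      have A: "?A ij = S False ij n"
        unfolding S_def m2[OF ij2(1)] m2[OF ij2(2)] closed_iff using par_P ij by (auto simp: shapes_def)
      have T: "S True ij n = {s \<in> ?A ij. \<not> hex c (fst s) (snd s)}"
        unfolding A S_def closed_iff strict_iff by auto
      \<comment> \<open>The weight equals 1/3 on hexagonal shapes and \<open>1/3 + 2/3\<close> on
        the others.\<close>
      have "(\<Sum>s\<in>?A ij. shape_weight c s) = (\<Sum>s\<in>?A ij. 1/3 + 2/3 * (if \<not> hex c (fst s) (snd s) then 1 else 0))"
        by (intro sum.cong refl) (simp add: shape_weight_def)
      also have "\<dots> = 1/3 * real (card (?A ij)) + 2/3 * (\<Sum>s\<in>?A ij. if \<not> hex c (fst s) (snd s) then 1 else 0)"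
        by (simp add: sum.distrib sum_distrib_left)
      also have "(\<Sum>s\<in>?A ij. if \<not> hex c (fst s) (snd s) then 1 else 0 :: real) = real (card (S True ij n))"
        unfolding T using fA[of ij] by (subst sum.inter_filter[symmetric]) auto
      finally show "(\<Sum>s\<in>?A ij. shape_weight c s) = 1/3 * real (card (S False ij n)) + 2/3 * real (card (S True ij n))"
        unfolding A .
    qed
    finally show ?thesis .
  qed
  hence summ: "summatory (shape_count c) x = summatory (\<lambda>n. \<Sum>ij\<in>P. 1/3 * real (card (S False ij n)) + 2/3 * real (card (S True ij n))) x" for x
    unfolding summatory_def by (intro sum.cong) auto
  have "\<forall>ij. \<exists>C>0. linear_growth (\<lambda>n. real (card (S False ij n))) C"
    unfolding S_def using linear_growth_sector[OF r, where strict = False] rr by blast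
  then obtain C1 where C1: "\<And>ij. C1 ij > 0" "\<And>ij. linear_growth (\<lambda>n. real (card (S False ij n))) (C1 ij)" by metis
  have "\<forall>ij. \<exists>C\<ge>0. linear_growth (\<lambda>n. real (card (S True ij n))) C"
    unfolding S_def using linear_growth_sector[OF r, where strict = True] by blast
  then obtain C2 where C2: "\<And>ij. C2 ij \<ge> 0" "\<And>ij. linear_growth (\<lambda>n. real (card (S True ij n))) (C2 ij)" by metis
  have "linear_growth (\<lambda>n. \<Sum>ij\<in>P. 1/3 * real (card (S False ij n)) + 2/3 * real (card (S True ij n))) (\<Sum>ij\<in>P. 1/3 * C1 ij + 2/3 * C2 ij)"
    by (intro linear_growth_sum finP linear_growth_add linear_growth_cmult C1 C2)
  hence "linear_growth (shape_count c) (\<Sum>ij\<in>P. 1/3 * C1 ij + 2/3 * C2 ij)"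
    unfolding linear_growth_def summ .
  moreover have "(\<Sum>ij\<in>P. 1/3 * C1 ij + 2/3 * C2 ij) > 0"
    using finP P0 C1(1) C2(1) by (intro sum_pos) (auto intro!: add_pos_nonneg)
  ultimately show ?thesis by blast
qed

end

section \<open>Counting well-rounded sublattices\<close>

text \<open>The inverse similarity carries the rational basis back to \<open>L\<close> and
  multiplies inner products by a constant. Clearing the three denominators leaves integers and one
  real scale \<open>t\<close>.\<close>

lemma rational_lattice_integral_gram:
  assumes "rational_lattice L"
  obtains b t \<alpha> \<beta> \<gamma> where "lattice_basis b L" "t > 0" "pos_def_form \<alpha> \<beta> \<gamma>"
    "b 1 \<bullet> b 1 = t * real_of_int \<alpha>" "b 1 \<bullet> b 2 = t * real_of_int \<beta>" "b 2 \<bullet> b 2 = t * real_of_int \<gamma>"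
proof -
  obtain L' b' where sim: "similar_lattice L L'" and b': "lattice_basis b' L'"
    and rat: "\<And>i j. gram_matrix b' $ i $ j \<in> \<rat>" using assms by (auto simp: rational_lattice_def)
  obtain c Q where c: "c > 0" and Q: "rotation_matrix Q" and L': "L' = (\<lambda>x. c *\<^sub>R (Q *v x)) ` L"
    using sim by (auto simp: similar_lattice_def)
  have oQ: "orthogonal_matrix Q" using Q by (simp add: rotation_matrix_def)
  hence QQ: "transpose Q ** Q = mat 1" "Q ** transpose Q = mat 1" by (auto simp: orthogonal_matrix_def)
  define f where "f x = (1 / c) *\<^sub>R (transpose Q *v x)" for x :: "real^2"
  have gf: "c *\<^sub>R (Q *v f x) = x" for x
    using c by (simp add: f_def matrix_vector_mult_scaleR matrix_vector_mul_assoc QQ del: transpose_matrix_vector)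
  have fg: "f (c *\<^sub>R (Q *v x)) = x" for x
    using c by (simp add: f_def matrix_vector_mult_scaleR matrix_vector_mul_assoc QQ del: transpose_matrix_vector)
  have lin: "linear f" unfolding f_def by (intro linear_compose_scale_right matrix_vector_mul_linear)
  have inj: "inj f" using gf by (metis injI)
  have inner: "f x \<bullet> f y = (1 / c\<^sup>2) * (x \<bullet> y)" for x y
  proof -
    have "orthogonal_transformation ((*v) (transpose Q))"
      using oQ by (simp add: orthogonal_matrix_transpose orthogonal_transformation_matrix)
    hence "(transpose Q *v x) \<bullet> (transpose Q *v y) = x \<bullet> y" by (simp add: orthogonal_transformation_def)
    thus ?thesis by (simp add: f_def power2_eq_square)
  qed
  define b where "b i = f (b' i)" for i
  have bL: "lattice_basis b L"
    unfolding lattice_basis_def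
  proof (intro conjI)
    have ib': "inj b'" "independent (range b')" using b' by (auto simp: lattice_basis_def)
    show "inj b" using inj_compose[OF inj ib'(1)] by (simp add: b_def[abs_def] o_def)
    have "range b = f ` range b'" by (auto simp: b_def)
    thus "independent (range b)"
      using linear_independent_injective_image[OF lin ib'(2)] inj inj_on_subset by (metis subset_UNIV)
    have "L = f ` L'" unfolding L' by (auto simp: fg image_image)
    also have "\<dots> = {f (\<Sum>i\<in>UNIV. of_int (z i) *\<^sub>R b' i) | z :: 2 \<Rightarrow> int. True}"
      using b' by (auto simp: lattice_basis_def)
    also have "\<dots> = {(\<Sum>i\<in>UNIV. of_int (z i) *\<^sub>R b i) | z :: 2 \<Rightarrow> int. True}"
      by (simp add: linear_sum[OF lin] linear_scale[OF lin] b_def)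
    finally show "L = {(\<Sum>i\<in>UNIV. of_int (z i) *\<^sub>R b i) | z :: 2 \<Rightarrow> int. True}" .
  qed
  have gr: "b' i \<bullet> b' j \<in> \<rat>" for i j using rat[of i j] by (simp add: gram_matrix_def)
  have den: "\<exists>m::int. m > 0 \<and> (\<exists>k::int. of_int m * r = of_int k)" if rr: "r \<in> \<rat>" for r :: real
  proof -
    obtain k m :: int where "m > 0" "r = of_int k / of_int m" using rr by (elim Rats_cases') auto
    thus ?thesis by (intro exI[of _ m]) auto
  qed
  obtain m1 k1 :: int where 1: "m1 > 0" "of_int m1 * (b' 1 \<bullet> b' 1) = of_int k1" using den[OF gr] by blast
  obtain m2 k2 :: int where 2: "m2 > 0" "of_int m2 * (b' 1 \<bullet> b' 2) = of_int k2" using den[OF gr] by blast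
  obtain m3 k3 :: int where 3: "m3 > 0" "of_int m3 * (b' 2 \<bullet> b' 2) = of_int k3" using den[OF gr] by blast
  define t where "t = 1 / (c\<^sup>2 * real_of_int (m1 * m2 * m3))"
  define \<alpha> \<beta> \<gamma> where "\<alpha> = m2 * m3 * k1" and "\<beta> = m1 * m3 * k2" and "\<gamma> = m1 * m2 * k3"
  have m0: "real_of_int m1 > 0" "real_of_int m2 > 0" "real_of_int m3 > 0" using 1 2 3 by auto
  have t: "t > 0" unfolding t_def using c m0 by simp
  have A: "b 1 \<bullet> b 1 = t * real_of_int \<alpha>"
    unfolding b_def inner t_def \<alpha>_def of_int_mult 1(2)[symmetric] using c m0 by (simp add: field_simps)
  have B: "b 1 \<bullet> b 2 = t * real_of_int \<beta>"
    unfolding b_def inner t_def \<beta>_def of_int_mult 2(2)[symmetric] using c m0 by (simp add: field_simps)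
  have C: "b 2 \<bullet> b 2 = t * real_of_int \<gamma>"
    unfolding b_def inner t_def \<gamma>_def of_int_mult 3(2)[symmetric] using c m0 by (simp add: field_simps)
  have inj_lat: "inj (lat_vec b)" by (rule lat_vec_inj[OF bL])
  have nz: "lat_vec b p \<noteq> 0" if "p \<noteq> (0, 0)" for p
  proof
    assume "lat_vec b p = 0"
    hence "lat_vec b p = lat_vec b (0, 0)" by (simp add: lat_vec_def)
    thus False using injD[OF inj_lat] that by blast
  qed
  have "b 1 \<noteq> 0" using nz[of "(1, 0)"] by (simp add: lat_vec_def)
  hence \<alpha>: "\<alpha> > 0" using A t by (metis inner_gt_zero_iff of_int_0_less_iff zero_less_mult_pos)
  \<comment> \<open>This lattice vector is orthogonal to \<open>b 1\<close>, and its squared length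
    is \<open>t * \<alpha>\<close> times the determinant of the form, which is therefore
    positive.\<close>
  have "lat_vec b (- \<beta>, \<alpha>) \<bullet> lat_vec b (- \<beta>, \<alpha>) > 0" using nz[of "(- \<beta>, \<alpha>)"] \<alpha> by simp
  also have "lat_vec b (- \<beta>, \<alpha>) \<bullet> lat_vec b (- \<beta>, \<alpha>) =
     real_of_int \<beta> ^ 2 * (b 1 \<bullet> b 1) - 2 * real_of_int \<alpha> * real_of_int \<beta> * (b 1 \<bullet> b 2) + real_of_int \<alpha> ^ 2 * (b 2 \<bullet> b 2)"
    by (simp add: lat_vec_def inner_add_left inner_add_right inner_diff_left inner_diff_right inner_commute power2_eq_square algebra_simps)
  also have "\<dots> = t * real_of_int \<alpha> * real_of_int (\<alpha> * \<gamma> - \<beta>\<^sup>2)"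
    unfolding A B C by (simp add: power2_eq_square algebra_simps)
  finally have "0 < t * real_of_int \<alpha> * real_of_int (\<alpha> * \<gamma> - \<beta>\<^sup>2)" .
  hence "0 < real_of_int (\<alpha> * \<gamma> - \<beta>\<^sup>2)" by (rule zero_less_mult_pos) (use t \<alpha> in simp)
  hence "\<alpha> * \<gamma> - \<beta>\<^sup>2 > 0" by (simp only: of_int_0_less_iff)
  hence "pos_def_form \<alpha> \<beta> \<gamma>" using \<alpha> by unfold_locales
  thus ?thesis using that bL t A B C by blast
qed

section \<open>From sublattices to their reduced bases\<close>

context pos_def_form
begin

lemma bf_self: "bf v v = q v" by (simp add: bf_def q_def power2_eq_square algebra_simps)

lemma bf_commute: "bf v w = bf w v" by (simp add: bf_def algebra_simps)

lemma idet_swap: "idet v w = - idet w v" by (simp add: idet_def)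

text \<open>The angle condition leaves at least 3/4 of \<open>(q p)\<^sup>2\<close> in the Gram
  determinant. So the index bounds the lengths, there are finitely many reduced bases of given
  index, and the determinant of a reduced basis is nonzero.\<close>

lemma det_lower_bound:
  assumes "q p = q r" "2 * \<bar>bf p r\<bar> \<le> q p"
  shows "3 * (q p)\<^sup>2 \<le> 4 * D * (idet p r)\<^sup>2"
proof -
  have "(2 * \<bar>bf p r\<bar>)\<^sup>2 \<le> (q p)\<^sup>2" using assms(2) by (intro power_mono) auto
  hence "4 * (bf p r)\<^sup>2 \<le> (q p)\<^sup>2" by (simp add: power_mult_distrib)
  moreover have "D * (idet p r)\<^sup>2 = (q p)\<^sup>2 - (bf p r)\<^sup>2" using det_identity[of p r] assms(1) by (simp add: power2_eq_square)
  ultimately show ?thesis by linarith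
qed

definition all_pairs :: "nat \<Rightarrow> ((int \<times> int) \<times> (int \<times> int)) set" where
  "all_pairs n = {(p, r). q p = q r \<and> 2 * \<bar>bf p r\<bar> \<le> q p \<and> \<bar>idet p r\<bar> = int n}"

lemma finite_all_pairs: "finite (all_pairs n)"
proof (rule finite_subset)
  let ?Q = "{v. real_of_int (q v) \<le> real_of_int (4 * D * (int n)\<^sup>2)}"
  show "finite (?Q \<times> ?Q)" using finite_q_le by blast
  show "all_pairs n \<subseteq> ?Q \<times> ?Q"
  proof (intro subsetI)
    fix x assume "x \<in> all_pairs n"
    then obtain p r where x: "x = (p, r)" "q p = q r" "2 * \<bar>bf p r\<bar> \<le> q p" "\<bar>idet p r\<bar> = int n"
      by (auto simp: all_pairs_def)
    have "(idet p r)\<^sup>2 = (int n)\<^sup>2" using x(4) by (metis power2_abs)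
    hence "3 * (q p)\<^sup>2 \<le> 4 * D * (int n)\<^sup>2" using det_lower_bound[OF x(2,3)] by simp
    moreover have "q p * 1 \<le> q p * q p"
    proof (cases "q p = 0")
      case False
      hence "1 \<le> q p" using q_nonneg[of p] by linarith
      thus ?thesis by (intro mult_left_mono) auto
    qed simp
    hence "q p \<le> (q p)\<^sup>2" by (simp add: power2_eq_square)
    moreover have "(q p)\<^sup>2 \<ge> 0" by simp
    ultimately have "q p \<le> 4 * D * (int n)\<^sup>2" by linarith
    hence "real_of_int (q p) \<le> real_of_int (4 * D * (int n)\<^sup>2)" by (simp only: of_int_le_iff)
    thus "x \<in> ?Q \<times> ?Q" using x(1,2) by simp
  qed
qed

text \<open>Exchanging the two vectors reverses the orientation and keeps the weight.\<close>

lemma sum_all_pairs: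
  assumes n: "n > 0"
  shows "(\<Sum>x\<in>all_pairs n. pair_weight x) = 2 * (\<Sum>x\<in>oriented_pairs (int n). pair_weight x)"
proof -
  have un: "all_pairs n = oriented_pairs (int n) \<union> prod.swap ` oriented_pairs (int n)"
  proof (intro equalityI subsetI)
    fix x assume "x \<in> all_pairs n"
    then obtain p r where x: "x = (p, r)" "q p = q r" "2 * \<bar>bf p r\<bar> \<le> q p" "\<bar>idet p r\<bar> = int n"
      by (auto simp: all_pairs_def)
    have "idet p r = int n \<or> idet r p = int n" using x(4) idet_swap[of p r] by linarith
    thus "x \<in> oriented_pairs (int n) \<union> prod.swap ` oriented_pairs (int n)"
    proof
      assume "idet r p = int n"
      hence "(r, p) \<in> oriented_pairs (int n)" using x bf_commute[of r p] by (simp add: oriented_pairs_def)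
      thus ?thesis unfolding x(1) by force
    qed (use x in \<open>simp add: oriented_pairs_def\<close>)
  next
    fix x assume "x \<in> oriented_pairs (int n) \<union> prod.swap ` oriented_pairs (int n)"
    thus "x \<in> all_pairs n"
    proof
      assume "x \<in> prod.swap ` oriented_pairs (int n)"
      then obtain p r where "x = (r, p)" "q p = q r" "2 * \<bar>bf p r\<bar> \<le> q p" "idet p r = int n"
        by (auto simp: oriented_pairs_def)
      thus ?thesis using idet_swap[of r p] bf_commute[of r p] by (simp add: all_pairs_def)
    qed (auto simp: oriented_pairs_def all_pairs_def)
  qed
  have fin: "finite (oriented_pairs (int n))" "finite (prod.swap ` oriented_pairs (int n))"
    using finite_all_pairs[of n] unfolding un by auto
  have dis: "oriented_pairs (int n) \<inter> prod.swap ` oriented_pairs (int n) = {}"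
  proof (rule ccontr)
    assume "\<not> ?thesis"
    then obtain p r where "idet p r = int n" "idet r p = int n" by (auto simp: oriented_pairs_def)
    thus False using idet_swap[of p r] n by simp
  qed
  have "(\<Sum>x\<in>prod.swap ` oriented_pairs (int n). pair_weight x) = (\<Sum>x\<in>oriented_pairs (int n). pair_weight (prod.swap x))"
    by (subst sum.reindex) (auto simp: o_def)
  also have "\<dots> = (\<Sum>x\<in>oriented_pairs (int n). pair_weight x)"
  proof (intro sum.cong refl)
    fix x assume "x \<in> oriented_pairs (int n)"
    thus "pair_weight (prod.swap x) = pair_weight x"
      using bf_commute by (auto simp: oriented_pairs_def pair_weight_def)
  qed
  finally show ?thesis unfolding un sum.union_disjoint[OF fin dis] by simp
qed

text \<open>Every well-rounded sublattice of index \<open>n\<close> arises from 8 or 24 reduced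
  bases, so each basis counts \<open>pair_weight / 8\<close>. Keeping only one orientation turns the
  8 into 4.\<close>

lemma wr_count_eq_pairs:
  assumes b: "lattice_basis b L" and t: "t > 0"
    and gram: "b 1 \<bullet> b 1 = t * real_of_int \<alpha>" "b 1 \<bullet> b 2 = t * real_of_int \<beta>" "b 2 \<bullet> b 2 = t * real_of_int \<gamma>"
    and n: "n > 0"
  shows "real (wr_count L n) = (\<Sum>x\<in>oriented_pairs (int n). pair_weight x) / 4"
proof -
  let ?l = "lat_vec b"
  define Z where "Z x = int_span (?l (fst x)) (?l (snd x))" for x
  have L: "L = range ?l" by (rule lattice_basis_range[OF b])
  have inj: "inj ?l" by (rule lat_vec_inj[OF b])
  have inner: "?l p \<bullet> ?l r = t * real_of_int (bf p r)" for p r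
  proof -
    have "?l p \<bullet> ?l r = fst p * fst r * (b 1 \<bullet> b 1) + (fst p * snd r + snd p * fst r) * (b 1 \<bullet> b 2) + snd p * snd r * (b 2 \<bullet> b 2)"
      by (simp add: lat_vec_def inner_add_left inner_add_right inner_commute algebra_simps)
    thus ?thesis unfolding gram by (simp add: bf_def algebra_simps)
  qed
  have zero_iff: "?l p = 0 \<longleftrightarrow> p = (0, 0)" for p
    using injD[OF inj, of p "(0, 0)"] by (auto simp: lat_vec_def)
  have red: "reduced_pair (?l p) (?l r) \<longleftrightarrow> p \<noteq> (0, 0) \<and> q p = q r \<and> 2 * \<bar>bf p r\<bar> \<le> q p" for p r
  proof -
    have "2 * \<bar>t * real_of_int (bf p r)\<bar> = t * real_of_int (2 * \<bar>bf p r\<bar>)" using t by (simp add: abs_mult)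
    thus ?thesis unfolding reduced_pair_def inner zero_iff bf_self using t by auto
  qed
  have hexa: "2 * \<bar>?l p \<bullet> ?l r\<bar> = ?l p \<bullet> ?l p \<longleftrightarrow> 2 * \<bar>bf p r\<bar> = q p" for p r
  proof -
    have "2 * \<bar>t * real_of_int (bf p r)\<bar> = t * real_of_int (2 * \<bar>bf p r\<bar>)" using t by (simp add: abs_mult)
    thus ?thesis unfolding inner bf_self using t by (simp only: mult_cancel_left of_int_eq_iff) simp
  qed
  have det_nz: "idet p r \<noteq> 0" if "reduced_pair (?l p) (?l r)" for p r
  proof
    assume "idet p r = 0"
    hence "3 * (q p)\<^sup>2 \<le> 0" using det_lower_bound[of p r] that unfolding red by simp
    hence "q p = 0" by simp
    thus False using that q_eq_0_iff unfolding red by blast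
  qed
  have sub: "sublattice (Z (p, r)) L \<and> lattice_index L (Z (p, r)) = nat \<bar>idet p r\<bar>" if "idet p r \<noteq> 0" for p r
    using int_span_sublattice[OF b that] by (simp add: Z_def)
  have U: "(p, r) \<in> all_pairs n \<longleftrightarrow> reduced_pair (?l p) (?l r) \<and> lattice_index L (Z (p, r)) = n" for p r
  proof
    assume x: "(p, r) \<in> all_pairs n"
    hence nz: "idet p r \<noteq> 0" using n by (auto simp: all_pairs_def)
    hence "p \<noteq> (0, 0)" by (auto simp: idet_def)
    thus "reduced_pair (?l p) (?l r) \<and> lattice_index L (Z (p, r)) = n" using x sub[OF nz] unfolding red by (auto simp: all_pairs_def)
  next
    assume x: "reduced_pair (?l p) (?l r) \<and> lattice_index L (Z (p, r)) = n"
    hence nz: "idet p r \<noteq> 0" using det_nz by blast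
    thus "(p, r) \<in> all_pairs n" using x sub[OF nz] unfolding red by (auto simp: all_pairs_def)
  qed
  have gen: "v \<in> int_span v w" "w \<in> int_span v w" if "reduced_pair v w" for v w
    using generators_minimal[OF that] by (auto simp: minimal_vectors_def)
  have img: "{M. sublattice M L \<and> well_rounded M \<and> lattice_index L M = n} = Z ` all_pairs n"
  proof (intro equalityI subsetI)
    fix M assume "M \<in> {M. sublattice M L \<and> well_rounded M \<and> lattice_index L M = n}"
    hence M: "subgroup M (additive_group L)" "well_rounded M" "lattice_index L M = n" by (auto simp: sublattice_def)
    have M_sub: "M \<subseteq> L" using subgroup.subset[OF M(1)] by (simp add: additive_group_simps)
    have add: "x + y \<in> M" if "x \<in> M" "y \<in> M" for x y
      using subgroup.m_closed[OF M(1) that] by (simp add: additive_group_simps)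
    have neg: "- x \<in> M" if "x \<in> M" for x
      using subgroup.m_inv_closed[OF M(1) that] additive_group_group(2)[OF b, of x] that M_sub by auto
    obtain v w where vw: "v \<in> M" "w \<in> M" "reduced_pair v w" "M = int_span v w"
      using well_rounded_imp_reduced_pair[OF add neg M(2)] by blast
    obtain p r where pr: "v = ?l p" "w = ?l r" using vw(1,2) M_sub L by blast
    have "(p, r) \<in> all_pairs n" unfolding U using vw M(3) by (simp add: pr Z_def)
    moreover have "M = Z (p, r)" using vw(4) by (simp add: pr Z_def)
    ultimately show "M \<in> Z ` all_pairs n" by blast
  next
    fix M assume "M \<in> Z ` all_pairs n"
    then obtain p r where pr: "M = Z (p, r)" "(p, r) \<in> all_pairs n" by auto
    have x: "reduced_pair (?l p) (?l r)" "lattice_index L (Z (p, r)) = n" using pr(2) unfolding U by auto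
    have "well_rounded M" using well_rounded_int_span[OF x(1)] by (simp add: pr(1) Z_def)
    thus "M \<in> {M. sublattice M L \<and> well_rounded M \<and> lattice_index L M = n}"
      using sub[OF det_nz[OF x(1)]] x(2) pr(1) by simp
  qed
  \<comment> \<open>The fibre consists of all reduced bases of one lattice. Their vectors lie in
    that lattice and hence in \<open>L\<close>, so each comes from integer coordinates.\<close>
  have fib: "1 / real (card {y \<in> all_pairs n. Z y = Z x}) = pair_weight x / 8" if x: "x \<in> all_pairs n" for x
  proof -
    obtain p r where xe: "x = (p, r)" by (rule prod.exhaust)
    have xr: "reduced_pair (?l p) (?l r)" "lattice_index L (Z (p, r)) = n" using x unfolding xe U by auto
    let ?F = "{(v', w'). reduced_pair v' w' \<and> int_span v' w' = int_span (?l p) (?l r)}"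
    have img': "map_prod ?l ?l ` {y \<in> all_pairs n. Z y = Z x} = ?F"
    proof (intro equalityI subsetI)
      fix z assume "z \<in> map_prod ?l ?l ` {y \<in> all_pairs n. Z y = Z x}"
      then obtain p' r' where z: "z = (?l p', ?l r')" "(p', r') \<in> all_pairs n" "Z (p', r') = Z x" by auto
      have "reduced_pair (?l p') (?l r')" using z(2) unfolding U by blast
      moreover have "int_span (?l p') (?l r') = int_span (?l p) (?l r)" using z(3) by (simp add: Z_def xe)
      ultimately show "z \<in> ?F" by (simp add: z(1))
    next
      fix z assume "z \<in> ?F"
      then obtain v' w' where z: "z = (v', w')" "reduced_pair v' w'" "int_span v' w' = Z x" by (auto simp: Z_def xe)
      have "Z x \<subseteq> L" unfolding xe Z_def fst_conv snd_conv lat_vec_int_comb L by auto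
      hence "v' \<in> L" "w' \<in> L" using gen[OF z(2)] z(3) by auto
      then obtain p' r' where pr: "v' = ?l p'" "w' = ?l r'" unfolding L by auto
      have "Z (p', r') = Z x" using z(3) by (simp add: Z_def pr)
      moreover from this have "(p', r') \<in> all_pairs n" unfolding U using z(2) xr(2) by (simp add: pr xe)
      ultimately show "z \<in> map_prod ?l ?l ` {y \<in> all_pairs n. Z y = Z x}"
        by (intro image_eqI[of _ _ "(p', r')"]) (simp_all add: z(1) pr)
    qed
    have "inj_on (map_prod ?l ?l) {y \<in> all_pairs n. Z y = Z x}"
      by (rule inj_on_subset[OF prod.inj_map[OF inj inj]]) simp
    from card_image[OF this] have "card {y \<in> all_pairs n. Z y = Z x} = card ?F" unfolding img' ..
    also have "\<dots> = (if 2 * \<bar>bf p r\<bar> = q p then 24 else 8)"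
      using card_reduced_pairs_of_lattice[OF xr(1)] unfolding hexa .
    finally show ?thesis by (simp add: pair_weight_def xe)
  qed
  have "real (wr_count L n) = (\<Sum>x\<in>all_pairs n. 1 / real (card {y \<in> all_pairs n. Z y = Z x}))"
    unfolding wr_count_def img by (rule card_image_weighted[OF finite_all_pairs])
  also have "\<dots> = (\<Sum>x\<in>all_pairs n. pair_weight x / 8)" by (intro sum.cong refl fib)
  also have "\<dots> = (\<Sum>x\<in>oriented_pairs (int n). pair_weight x) / 4"
    unfolding sum_divide_distrib[symmetric] sum_all_pairs[OF n] by simp
  finally show ?thesis .
qed

end

theorem theorem5p15:
  fixes L :: "(real^2) set"
  assumes "rational_lattice L"
  shows "(\<exists>F. F holomorphic_on ({s. Re s > 1/2} - {1}) \<and>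
            is_pole F 1 \<and> zorder F 1 = -2 \<and>
            (\<forall>s. Re s > 1 \<longrightarrow>
               summable (\<lambda>n. wr_dirichlet_term L s (Suc n)) \<and> F s = wr_dirichlet L s)) \<and>
         (\<exists>c>0. wr_summatory L \<sim>[at_top] (\<lambda>x. c * x * ln x))"
proof -
  obtain b t \<alpha> \<beta> \<gamma> where b: "lattice_basis b L" "t > 0" and form: "pos_def_form \<alpha> \<beta> \<gamma>" and
    gram: "b 1 \<bullet> b 1 = t * real_of_int \<alpha>" "b 1 \<bullet> b 2 = t * real_of_int \<beta>" "b 2 \<bullet> b 2 = t * real_of_int \<gamma>"
    using rational_lattice_integral_gram[OF assms] by blast
  interpret pos_def_form \<alpha> \<beta> \<gamma> by (rule form)
  define f where "f n = real (wr_count L n)" for n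
  have f: "f n = (\<Sum>c\<in>residues. 1/4 * dirichlet_conv (primitive_count c) (shape_count c) (nat (2 * G c) * n))" if "n \<ge> 1" for n
  proof -
    have n: "n > 0" using that by simp
    have "f n = (\<Sum>x\<in>shape_data (int n). shape_weight (fst x) (snd x)) / 4"
      unfolding f_def wr_count_eq_pairs[OF b gram n] using sum_oriented_pairs[of "int n"] n by simp
    thus ?thesis unfolding sum_shape_data[OF n] sum_divide_distrib
      by (simp only: times_divide_eq_left mult_1)
  qed
  have "\<forall>c. \<exists>C. linear_growth (primitive_count c) C \<and> (gcd (gcd (fst c) (snd c)) (2 * D) = 1 \<longrightarrow> C > 0)"
    using linear_growth_primitive_count by blast
  from choice[OF this] obtain A where A': "\<forall>c. linear_growth (primitive_count c) (A c) \<and> (gcd (gcd (fst c) (snd c)) (2 * D) = 1 \<longrightarrow> A c > 0)"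
    by (rule exE)
  have A: "linear_growth (primitive_count c) (A c)" for c using A' by blast
  have A_pos: "A c > 0" if "gcd (gcd (fst c) (snd c)) (2 * D) = 1" for c using spec[OF A', of c] that by simp
  have "\<forall>c. \<exists>C. linear_growth (shape_count c) C \<and> C > 0" using linear_growth_shape_count by blast
  from choice[OF this] obtain B where B': "\<forall>c. linear_growth (shape_count c) (B c) \<and> B c > 0" by (rule exE)
  have B: "linear_growth (shape_count c) (B c)" for c using B' by blast
  have B_pos: "B c > 0" for c using B' by blast
  have z0: "primitive_count c n \<ge> 0" for c n by (simp add: primitive_count_def)
  have e0: "shape_count c n \<ge> 0" for c n
    unfolding shape_count_def by (intro sum_nonneg) (simp add: shape_weight_def)
  have \<kappa>: "nat (2 * G c) \<ge> 1" for c using G_pos[of c] by simp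
  \<comment> \<open>This class contains primitive vectors for every form, so its convolution makes
    the coefficient of the double pole positive.\<close>
  have "(1, 0) \<in> residues" using D_pos by (simp add: residues_def)
  moreover have "A (1, 0) > 0" by (rule A_pos) simp
  ultimately have pos: "\<exists>c\<in>residues. (1/4::real) > 0 \<and> A c > 0 \<and> B c > 0" using B_pos by auto
  have finR: "finite residues" by (simp add: residues_def)
  have term_eq: "wr_dirichlet_term L s (Suc n) = of_real (f (Suc n)) * of_nat (Suc n) powr (-s)" for s n
    by (simp add: wr_dirichlet_term_def f_def)
  have summ: "wr_summatory L = summatory f"
  proof
    fix x :: real
    have "{n. 1 \<le> n \<and> real n \<le> x} = {1..nat \<lfloor>x\<rfloor>}" by (auto simp: le_nat_iff le_floor_iff nat_le_iff) linarith+
    thus "wr_summatory L x = summatory f x" by (simp add: wr_summatory_def summatory_def f_def)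
  qed
  obtain F where F: "F holomorphic_on ({s. Re s > 1/2} - {1})" "is_pole F 1" "zorder F 1 = -2"
    "\<And>s. Re s > 1 \<Longrightarrow> (\<lambda>n. of_real (f (Suc n)) * of_nat (Suc n) powr (-s)) sums F s"
    using double_pole_of_convolutions(1)[OF finR _ z0 A e0 B \<kappa> conv_counts_multiples f pos] by auto
  have "summable (\<lambda>n. wr_dirichlet_term L s (Suc n)) \<and> F s = wr_dirichlet L s" if "Re s > 1" for s
    unfolding wr_dirichlet_def term_eq using F(4)[OF that] by (auto simp only: sums_iff)
  moreover have "\<exists>c>0. wr_summatory L \<sim>[at_top] (\<lambda>x. c * x * ln x)"
    unfolding summ using double_pole_of_convolutions(2)[OF finR _ z0 A e0 B \<kappa> conv_counts_multiples f pos] by auto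
  ultimately show ?thesis using F(1-3) by blast
qed

end
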